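(* Let $L,T>0$, $\Omega=(0,L)\times(0,T)$, $\alpha>0$, and let $v_c$ be a given finite bound defining $\mathcal{V}_{ad}=\{v\in L^2(0,L):\|v\|_{L^2(0,L)}\le v_c\}$. Let $k\in L^\infty(0,L)$ be positive and finite-valued, $w\in H^2(0,L)$, $F\in L^2(\Omega)$, and $y\in L^2(\Omega)$. For $v\in\mathcal{V}_{ad}$ let $u(x,t;v)$ be the weak solution of the beam problem with data $(w,v,F)$, and let $$J_\alpha(v)=\int_0^T\int_0^L\big[u(x,t;v)-y(x,t)\big]^2\,dx\,dt+\alpha\int_0^L v(x)^2\,dx .$$ Let $v^*\in\mathcal{V}_{ad}$, let $u^*=u(\cdot,\cdot;v^* )$ be the corresponding weak solution, and let $\psi^*$ be the weak solution of the adjoint problem corresponding to $u^*$. If $v^*$ is optimal, i.e. $J_\alpha(v^* )=\inf_{v\in\mathcal{V}_{ad}}J_\alpha(v)$, then $$\big\langle J'_\alpha(v^* ),v-v^*\big\rangle_{L^2(0,L)}=\big\langle-\psi^*(x,0)+2\alpha v^*,\,v-v^*\big\rangle_{L^2(0,L)}\ge 0\qquad\text{for all }v\in\mathcal{V}_{ad}.$$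
   Context: All functions are real-valued. $H^{2,1}(\Omega)$ is the space of all $f\in L^2(\Omega)$ with weak derivatives $f_t,f_x,f_{xx}\in L^2(\Omega)$, with norm $\|f\|_{H^{2,1}(\Omega)}=\big(\int_0^T\int_0^L[f^2+f_t^2+f_x^2+f_{xx}^2]\,dx\,dt\big)^{1/2}$. $\hat H^{2,1}(\Omega)$ is the subset of those $f\in H^{2,1}(\Omega)$ with $f(0,t)=f(L,t)=0$ for all $t\in[0,T]$, with the same norm. The beam problem with data $(w,v,F)$ is: $u_{tt}+(k(x)u_{xx})_{xx}=F(x,t)$ in $\Omega$; $u(x,0)=w(x)$, $u_t(x,0)=v(x)$ for $x\in(0,L)$; $u(0,t)=u(L,t)=u_{xx}(0,t)=u_{xx}(L,t)=0$ for $t\in(0,T)$. A weak solution is a function $u\in\hat H^{2,1}(\Omega)$ with $u(x,0)=w(x)$ for $x\in(0,L)$ such that $$\int_0^T\int_0^L(-u_t\eta_t+k(x)u_{xx}\eta_{xx})\,dx\,dt=\int_0^T\int_0^L\eta F\,dx\,dt+\int_0^L v(x)\eta(x,0)\,dx$$ for all $\eta\in\hat H^{2,1}(\Omega)$ with $\eta(x,T)=0$ for all $x\in(0,L)$. The adjoint problem corresponding to $u$ is: $\psi_{tt}+(k(x)\psi_{xx})_{xx}=-2[u(x,t)-y(x,t)]$ in $\Omega$; $\psi(x,T)=0$, $\psi_t(x,T)=0$ for $x\in(0,L)$; $\psi(0,t)=\psi(L,t)=\psi_{xx}(0,t)=\psi_{xx}(L,t)=0$ for $t\in(0,T)$. The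 substitution $t\mapsto T-t$ turns it into a beam problem with zero initial data, and its weak solution is understood accordingly: $\psi\in\hat H^{2,1}(\Omega)$, $\psi(x,T)=0$, and $\int_0^T\int_0^L(-\psi_t\eta_t+k\psi_{xx}\eta_{xx})\,dx\,dt=-2\int_0^T\int_0^L(u-y)\eta\,dx\,dt$ for all $\eta\in\hat H^{2,1}(\Omega)$ with $\eta(x,0)=0$ for all $x\in(0,L)$. $J'_\alpha(v)\in L^2(0,L)$ denotes the Fréchet derivative (gradient) of $J_\alpha$ at $v$: $J_\alpha(v+\delta v)-J_\alpha(v)=\langle J'_\alpha(v),\delta v\rangle_{L^2(0,L)}+o(\|\delta v\|_{L^2(0,L)})$ for increments $\delta v\in L^2(0,L)$ with $v+\delta v\in\mathcal{V}_{ad}$. Here $\langle f,g\rangle_{L^2(0,L)}=\int_0^L f g\,dx$. *)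

theory Defs
  imports "HOL-Analysis.Analysis"
begin

definition L2 :: "'a::euclidean_space set \<Rightarrow> ('a \<Rightarrow> real) set" where
  "L2 S = {f \<in> borel_measurable (lebesgue_on S). integrable (lebesgue_on S) (\<lambda>x. (f x)\<^sup>2)}"

definition L2_inner :: "'a::euclidean_space set \<Rightarrow> ('a \<Rightarrow> real) \<Rightarrow> ('a \<Rightarrow> real) \<Rightarrow> real" where
  "L2_inner S f g = (LINT x|lebesgue_on S. f x * g x)"

definition L2_norm :: "'a::euclidean_space set \<Rightarrow> ('a \<Rightarrow> real) \<Rightarrow> real" where
  "L2_norm S f = sqrt (L2_inner S f f)"

definition Linf :: "'a::euclidean_space set \<Rightarrow> ('a \<Rightarrow> real) set" where
  "Linf S = {f \<in> borel_measurable (lebesgue_on S). \<exists>C. AE x in lebesgue_on S. \<bar>f x\<bar> \<le> C}"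

definition partial_deriv :: "'a::euclidean_space \<Rightarrow> ('a \<Rightarrow> real) \<Rightarrow> 'a \<Rightarrow> real" where
  "partial_deriv b f = (\<lambda>x. frechet_derivative f (at x) b)"

text \<open>A multi-index is a list of basis vectors, one for each differentiation.\<close>

definition iterated_deriv :: "'a::euclidean_space list \<Rightarrow> ('a \<Rightarrow> real) \<Rightarrow> 'a \<Rightarrow> real" where
  "iterated_deriv bs f = foldr partial_deriv bs f"

text \<open>If every iterated partial derivative is Frechet differentiable, then all of them are
  continuous, so this is the class of infinitely differentiable functions.\<close>

definition smooth :: "('a::euclidean_space \<Rightarrow> real) \<Rightarrow> bool" where
  "smooth f \<longleftrightarrow> (\<forall>bs. set bs \<subseteq> Basis \<longrightarrow> (\<forall>x. iterated_deriv bs f differentiable (at x)))"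

definition test_functions :: "'a::euclidean_space set \<Rightarrow> ('a \<Rightarrow> real) set" where
  "test_functions S =
     {\<phi>. smooth \<phi> \<and> compact (closure {x. \<phi> x \<noteq> 0}) \<and> closure {x. \<phi> x \<noteq> 0} \<subseteq> S}"

text \<open>\<open>g\<close> is the weak derivative of \<open>f\<close> for the multi-index \<open>bs\<close>, both functions being in \<open>L2 S\<close>.
  For open \<open>S\<close> it is determined by \<open>f\<close> up to a null set.\<close>

definition has_weak_deriv ::
    "'a::euclidean_space set \<Rightarrow> 'a list \<Rightarrow> ('a \<Rightarrow> real) \<Rightarrow> ('a \<Rightarrow> real) \<Rightarrow> bool" where
  "has_weak_deriv S bs f g \<longleftrightarrow> f \<in> L2 S \<and> g \<in> L2 S \<and>
     (\<forall>\<phi>\<in>test_functions S.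
        (LINT x|lebesgue_on S. f x * iterated_deriv bs \<phi> x)
          = (-1) ^ length bs * (LINT x|lebesgue_on S. g x * \<phi> x))"

definition H2 :: "real set \<Rightarrow> (real \<Rightarrow> real) set" where
  "H2 S = {f \<in> L2 S. (\<exists>g. has_weak_deriv S [1] f g) \<and> (\<exists>g. has_weak_deriv S [1, 1] f g)}"

text \<open>Points of the plane are pairs \<open>(x, t)\<close>, so \<open>(1, 0)\<close> is the direction of \<open>x\<close> and \<open>(0, 1)\<close>
  that of \<open>t\<close>.\<close>

abbreviation weak_t :: "(real \<times> real) set \<Rightarrow> (real \<times> real \<Rightarrow> real) \<Rightarrow> (real \<times> real \<Rightarrow> real) \<Rightarrow> bool" where
  "weak_t S \<equiv> has_weak_deriv S [(0, 1)]"

abbreviation weak_x :: "(real \<times> real) set \<Rightarrow> (real \<times> real \<Rightarrow> real) \<Rightarrow> (real \<times> real \<Rightarrow> real) \<Rightarrow> bool" where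
  "weak_x S \<equiv> has_weak_deriv S [(1, 0)]"

abbreviation weak_xx :: "(real \<times> real) set \<Rightarrow> (real \<times> real \<Rightarrow> real) \<Rightarrow> (real \<times> real \<Rightarrow> real) \<Rightarrow> bool" where
  "weak_xx S \<equiv> has_weak_deriv S [(1, 0), (1, 0)]"

definition Omega :: "real \<Rightarrow> real \<Rightarrow> (real \<times> real) set" where
  "Omega L T = {0<..<L} \<times> {0<..<T}"

definition H21 :: "real \<Rightarrow> real \<Rightarrow> (real \<times> real \<Rightarrow> real) set" where
  "H21 L T = {f \<in> L2 (Omega L T).
     (\<exists>g. weak_t (Omega L T) f g) \<and> (\<exists>g. weak_x (Omega L T) f g) \<and> (\<exists>g. weak_xx (Omega L T) f g)}"

text \<open>Pointwise values of a function of class \<open>H21\<close> are those of its representative that is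
  continuous on the closed rectangle; it exists and is unique because \<open>H21\<close> embeds into the
  continuous functions there. The elements of \<open>H21_hat\<close> are these representatives.\<close>

definition H21_hat :: "real \<Rightarrow> real \<Rightarrow> (real \<times> real \<Rightarrow> real) set" where
  "H21_hat L T = {f \<in> H21 L T. continuous_on ({0..L} \<times> {0..T}) f \<and>
     (\<forall>t\<in>{0..T}. f (0, t) = 0 \<and> f (L, t) = 0)}"

text \<open>The bilinear form of \<open>u\<close> and \<open>\<eta>\<close> has the value \<open>c\<close>. Weak derivatives exist for \<open>u\<close> and \<open>\<eta>\<close> in
  \<open>H21\<close> and are unique up to null sets, so quantifying over all of them does not depend on a choice.\<close>

definition beam_form ::
    "real \<Rightarrow> real \<Rightarrow> (real \<Rightarrow> real) \<Rightarrow> (real \<times> real \<Rightarrow> real) \<Rightarrow> (real \<times> real \<Rightarrow> real) \<Rightarrow> real \<Rightarrow> bool" where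
  "beam_form L T k u \<eta> c \<longleftrightarrow>
     (\<forall>ut uxx \<eta>t \<eta>xx.
        weak_t (Omega L T) u ut \<longrightarrow> weak_xx (Omega L T) u uxx \<longrightarrow>
        weak_t (Omega L T) \<eta> \<eta>t \<longrightarrow> weak_xx (Omega L T) \<eta> \<eta>xx \<longrightarrow>
        (LINT (x, t)|lebesgue_on (Omega L T).
            - ut (x, t) * \<eta>t (x, t) + k x * uxx (x, t) * \<eta>xx (x, t)) = c)"

definition weak_solution ::
    "real \<Rightarrow> real \<Rightarrow> (real \<Rightarrow> real) \<Rightarrow> (real \<Rightarrow> real) \<Rightarrow> (real \<Rightarrow> real) \<Rightarrow> (real \<times> real \<Rightarrow> real)
      \<Rightarrow> (real \<times> real \<Rightarrow> real) \<Rightarrow> bool" where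
  "weak_solution L T k w v F u \<longleftrightarrow>
     u \<in> H21_hat L T \<and> (\<forall>x\<in>{0<..<L}. u (x, 0) = w x) \<and>
     (\<forall>\<eta>\<in>H21_hat L T. (\<forall>x\<in>{0<..<L}. \<eta> (x, T) = 0) \<longrightarrow>
        beam_form L T k u \<eta>
          ((LINT p|lebesgue_on (Omega L T). \<eta> p * F p)
            + (LINT x|lebesgue_on {0<..<L}. v x * \<eta> (x, 0))))"

definition adjoint_weak_solution ::
    "real \<Rightarrow> real \<Rightarrow> (real \<Rightarrow> real) \<Rightarrow> (real \<times> real \<Rightarrow> real) \<Rightarrow> (real \<times> real \<Rightarrow> real)
      \<Rightarrow> (real \<times> real \<Rightarrow> real) \<Rightarrow> bool" where
  "adjoint_weak_solution L T k y u \<psi> \<longleftrightarrow>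
     \<psi> \<in> H21_hat L T \<and> (\<forall>x\<in>{0<..<L}. \<psi> (x, T) = 0) \<and>
     (\<forall>\<eta>\<in>H21_hat L T. (\<forall>x\<in>{0<..<L}. \<eta> (x, 0) = 0) \<longrightarrow>
        beam_form L T k \<psi> \<eta> (- 2 * (LINT p|lebesgue_on (Omega L T). (u p - y p) * \<eta> p)))"

definition V_ad :: "real \<Rightarrow> real \<Rightarrow> (real \<Rightarrow> real) set" where
  "V_ad L vc = {v \<in> L2 {0<..<L}. L2_norm {0<..<L} v \<le> vc}"

text \<open>In the cost functional, \<open>u\<close> is the solution map \<open>v \<mapsto> u(\<cdot>, \<cdot>; v)\<close>.\<close>

definition cost ::
    "real \<Rightarrow> real \<Rightarrow> real \<Rightarrow> (real \<times> real \<Rightarrow> real) \<Rightarrow> ((real \<Rightarrow> real) \<Rightarrow> real \<times> real \<Rightarrow> real)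
      \<Rightarrow> (real \<Rightarrow> real) \<Rightarrow> real" where
  "cost L T \<alpha> y u v =
     (LINT p|lebesgue_on (Omega L T). (u v p - y p)\<^sup>2) + \<alpha> * (LINT x|lebesgue_on {0<..<L}. (v x)\<^sup>2)"

text \<open>\<open>G\<close> is a Frechet gradient at \<open>v\<close>, in \<open>L2 S\<close>, of \<open>J\<close> restricted to \<open>V\<close>; the condition spells out
  \<open>J (v + \<delta>v) - J v = \<langle>G, \<delta>v\<rangle> + o(\<parallel>\<delta>v\<parallel>)\<close>.\<close>

definition is_frechet_gradient ::
    "'a::euclidean_space set \<Rightarrow> ('a \<Rightarrow> real) set \<Rightarrow> (('a \<Rightarrow> real) \<Rightarrow> real) \<Rightarrow> ('a \<Rightarrow> real)
      \<Rightarrow> ('a \<Rightarrow> real) \<Rightarrow> bool" where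
  "is_frechet_gradient S V J v G \<longleftrightarrow> G \<in> L2 S \<and>
     (\<forall>\<epsilon>>0. \<exists>r>0. \<forall>\<delta>v\<in>L2 S. (\<lambda>x. v x + \<delta>v x) \<in> V \<longrightarrow> L2_norm S \<delta>v < r \<longrightarrow>
        \<bar>J (\<lambda>x. v x + \<delta>v x) - J v - L2_inner S G \<delta>v\<bar> \<le> \<epsilon> * L2_norm S \<delta>v)"

end

theory Submission
  imports Defs
begin

text \<open>The difference \<open>h\<close> of the solutions for \<open>v\<close> and \<open>v*\<close> is a weak solution with zero initial value,
  initial velocity \<open>\<delta>v = v - v*\<close> and no load. Using \<open>\<psi>*\<close> as test function for \<open>h\<close> and \<open>h\<close> as test
  function for \<open>\<psi>*\<close> gives \<open>2\<langle>u* - y, h\<rangle> = -\<langle>\<psi>*(\<cdot>, 0), \<delta>v\<rangle>\<close>, hence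
  \<open>J(v) - J(v*) = \<langle>-\<psi>*(\<cdot>, 0) + 2\<alpha>v*, \<delta>v\<rangle> + \<parallel>h\<parallel>\<^sup>2 + \<alpha>\<parallel>\<delta>v\<parallel>\<^sup>2\<close>.
  That \<open>\<parallel>h\<parallel>\<^sup>2\<close> is of second order is an energy estimate; \<open>k\<close> may degenerate to zero. Test with
  \<open>\<eta>(x, t) = \<integral>\<^sub>t\<^sup>T (T - s) h(x, s) ds\<close>, so that \<open>\<eta>\<^sub>t = -(T - t)h\<close>. Both terms of the bilinear form become
  squares: \<open>\<integral>\<integral> (T - t) h\<^sub>t h = \<parallel>h\<parallel>\<^sup>2 / 2\<close> and \<open>\<integral>\<integral> k h\<^sub>x\<^sub>x \<eta>\<^sub>x\<^sub>x = \<integral>\<integral> k (\<integral>\<^sub>0\<^sup>t h\<^sub>x\<^sub>x)\<^sup>2 / 2 \<ge> 0\<close>, both instances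
  of \<open>\<integral>\<^sub>0\<^sup>T (T - t) g(t) G(t) dt = \<integral>\<^sub>0\<^sup>T G\<^sup>2 / 2\<close> for \<open>G(t) = \<integral>\<^sub>0\<^sup>t g\<close>. Therefore
  \<open>\<parallel>h\<parallel>\<^sup>2 / 2 \<le> \<langle>\<delta>v, \<eta>(\<cdot>, 0)\<rangle> \<le> T\<^sup>3 \<parallel>\<delta>v\<parallel>\<^sup>2 + \<parallel>h\<parallel>\<^sup>2 / 4\<close>. The optimality condition
  follows by moving from \<open>v*\<close> along segments in the convex set of admissible velocities.\<close>

subsection \<open>Smooth cutoff functions\<close>

text \<open>Testing with \<open>h_t\<close> is impossible, because a weak time derivative in
  \<open>L2\<close> is in general not an admissible test function; time integrals of
  \<open>h\<close> are. The plain choice, the integral of \<open>h\<close> from \<open>t\<close> to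
  an end time \<open>r\<close>, makes both terms of the form squares but bounds \<open>h\<close>
  only at time \<open>r\<close>. Integrating over \<open>r\<close> in \<open>(0, T)\<close> gives
  the weight: \<open>T - s\<close> measures the end times beyond \<open>s\<close>. Hence the bound
  in \<open>L2\<close> over all of Omega.

  Two facts that are evident for smooth functions carry most of the work. Time integration must
  commute with weak space derivatives, so that \<eta> is admissible. And \<open>h\<close> must be
  the integral of its weak time derivative, which ties the pointwise condition
  \<open>h(x, 0) = 0\<close> to a derivative known only through test functions. Both are shown by
  testing with explicit bumps, so members of \<open>test_functions\<close>, defined by
  differentiability of all orders, have to be constructed. Fubini is applied to Borel functions that
  vanish outside Omega, since sections of Lebesgue measurable functions are measurable only almost
  everywhere.\<close>

definition flat :: "nat \<Rightarrow> real \<Rightarrow> real" where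
  "flat n x = (if x > 0 then exp (- 1 / x) / x ^ n else 0)"

lemma flat_nonneg: "0 \<le> flat n x"
  by (simp add: flat_def)

text \<open>A single term of the exponential series at \<open>1 / x\<close> suffices. Its degree
  \<open>n + 2\<close> exceeds \<open>n\<close> by two, and the surplus gives the quadratic decay
  that makes the difference quotient at \<open>0\<close> tend to zero.\<close>

lemma flat_bound: "flat n x \<le> fact (n + 2) * x\<^sup>2"
proof (cases "x > 0")
  case True
  have "(1 / x) ^ (n + 2) / fact (n + 2) \<le> exp (1 / x)"
    using sum_le_suminf[OF summable_exp, of "{n + 2}" "1 / x"] True
    by (simp add: exp_def scaleR_conv_of_real divide_inverse mult.commute del: fact_Suc)
  then have "(1 / x) ^ (n + 2) \<le> fact (n + 2) * exp (1 / x)"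
    by (simp add: divide_le_eq mult.commute del: fact_Suc power_Suc power_one_over)
  then have "exp (- (1 / x)) * (1 / x) ^ (n + 2) \<le> exp (- (1 / x)) * (fact (n + 2) * exp (1 / x))"
    by (intro mult_left_mono) auto
  also have "\<dots> = fact (n + 2)" by (simp add: exp_minus del: fact_Suc)
  finally have "exp (- (1 / x)) * (1 / x) ^ (n + 2) \<le> fact (n + 2)" .
  then have "exp (- (1 / x)) * (1 / x) ^ (n + 2) * x\<^sup>2 \<le> fact (n + 2) * x\<^sup>2"
    by (intro mult_right_mono) auto
  moreover have "exp (- (1 / x)) * (1 / x) ^ (n + 2) * x\<^sup>2 = flat n x"
    using True by (simp add: flat_def power_add power2_eq_square power_one_over)
  ultimately show ?thesis by simp
qed (simp add: flat_def)

text \<open>Dividing by \<open>x ^ n\<close> in \<open>flat\<close> closes the family, up to linear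
  combinations, under differentiation, also at \<open>0\<close>. Smoothness can therefore be shown
  by structural induction instead of formulas for higher derivatives.\<close>

lemma flat_has_derivative:
  "(flat n has_real_derivative (flat (n + 2) x - n * flat (n + 1) x)) (at x)"
proof -
  consider "x > 0" | "x < 0" | "x = 0" by linarith
  then show ?thesis
  proof cases
    case 1
    have "((\<lambda>x. exp (- 1 / x) / x ^ n) has_real_derivative (flat (n + 2) x - n * flat (n + 1) x)) (at x)"
    proof -
      have "((\<lambda>x. exp (- 1 / x) / x ^ n) has_real_derivative
          ((exp (- 1 / x) * (1 / x\<^sup>2)) * x ^ n - exp (- 1 / x) * (real n * x ^ (n - 1))) / (x ^ n * x ^ n)) (at x)"
        using 1 by (auto intro!: derivative_eq_intros simp: power2_eq_square)
      moreover have "((exp (- 1 / x) * (1 / x\<^sup>2)) * x ^ n - exp (- 1 / x) * (real n * x ^ (n - 1))) / (x ^ n * x ^ n)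
          = flat (n + 2) x - n * flat (n + 1) x"
        using 1 by (cases n) (simp_all add: flat_def divide_simps power2_eq_square, simp add: algebra_simps)
      ultimately show ?thesis by simp
    qed
    then show ?thesis
      by (rule has_field_derivative_transform_within_open[where S="{0<..}"]) (use 1 in \<open>auto simp: flat_def\<close>)
  next
    case 2
    have "((\<lambda>x. 0) has_real_derivative (flat (n + 2) x - n * flat (n + 1) x)) (at x)"
      using 2 by (auto simp: flat_def)
    then show ?thesis
      by (rule has_field_derivative_transform_within_open[where S="{..<0}"]) (use 2 in \<open>auto simp: flat_def\<close>)
  next
    case 3
    have "((\<lambda>h. flat n h / h) \<longlongrightarrow> 0) (at 0)"
    proof (rule Lim_null_comparison)
      show "\<forall>\<^sub>F h in at 0. norm (flat n h / h) \<le> fact (n + 2) * \<bar>h\<bar>"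
      proof (intro always_eventually allI)
        fix h :: real
        have "\<bar>flat n h\<bar> / \<bar>h\<bar> \<le> fact (n + 2) * h\<^sup>2 / \<bar>h\<bar>"
          using flat_bound[of n h] flat_nonneg[of n h] by (intro divide_right_mono) auto
        also have "\<dots> = fact (n + 2) * \<bar>h\<bar>"
          by (cases "h = 0") (simp_all add: power2_eq_square abs_if del: fact_Suc)
        finally show "norm (flat n h / h) \<le> fact (n + 2) * \<bar>h\<bar>" by simp
      qed
      show "((\<lambda>h. fact (n + 2) * \<bar>h\<bar>) \<longlongrightarrow> (0::real)) (at 0)"
        by (auto intro!: tendsto_eq_intros)
    qed
    then show ?thesis
      using 3 by (simp add: has_field_derivative_iff flat_def)
  qed
qed

text \<open>Every generator has its partial derivatives in the class again, so all members are smooth. The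
  rule \<open>primitive\<close> supplies antiderivatives in time of mean-zero bumps, and \<open>slice\<close> freezes the time
  in a given smooth function.\<close>

inductive smooth_gen :: "(real \<times> real \<Rightarrow> real) \<Rightarrow> bool" where
  slice: "smooth (f :: real \<times> real \<Rightarrow> real) \<Longrightarrow> smooth_gen (\<lambda>p. f (fst p, t))"
| const: "smooth_gen (\<lambda>p. c)"
| fst: "smooth_gen fst"
| snd: "smooth_gen snd"
| add: "smooth_gen f \<Longrightarrow> smooth_gen g \<Longrightarrow> smooth_gen (\<lambda>p. f p + g p)"
| mult: "smooth_gen f \<Longrightarrow> smooth_gen g \<Longrightarrow> smooth_gen (\<lambda>p. f p * g p)"
| exp: "smooth_gen f \<Longrightarrow> smooth_gen (\<lambda>p. exp (f p))"
| flat: "smooth_gen f \<Longrightarrow> smooth_gen (\<lambda>p. flat n (f p))"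
| primitive: "(\<And>t. (I has_real_derivative q t) (at t)) \<Longrightarrow> smooth_gen (\<lambda>p. q (snd p))
    \<Longrightarrow> smooth_gen (\<lambda>p. I (snd p))"

lemma Basis_plane: "(Basis :: (real \<times> real) set) = {(1, 0), (0, 1)}"
  by (auto simp: Basis_prod_def)

lemma iterated_deriv_snoc: "iterated_deriv (bs @ [b]) f = iterated_deriv bs (partial_deriv b f)"
  by (simp add: iterated_deriv_def)

lemma iterated_deriv_Cons: "iterated_deriv (b # bs) f = partial_deriv b (iterated_deriv bs f)"
  by (simp add: iterated_deriv_def)

lemma iterated_deriv_Nil [simp]: "iterated_deriv [] f = f"
  by (simp add: iterated_deriv_def)

lemma smooth_differentiable: "smooth f \<Longrightarrow> f differentiable (at x)"
  unfolding smooth_def by (drule spec[of _ "[]"]) simp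

lemma smooth_partial_deriv:
  assumes "smooth f" "b \<in> Basis"
  shows "smooth (partial_deriv b f)"
  unfolding smooth_def
proof (intro allI impI)
  fix bs :: "'a list" and x :: 'a
  assume "set bs \<subseteq> Basis"
  then have "set (bs @ [b]) \<subseteq> Basis" using assms(2) by auto
  then show "iterated_deriv bs (partial_deriv b f) differentiable at x"
    using assms(1) unfolding smooth_def by (metis iterated_deriv_snoc)
qed

lemma smooth_iterated_deriv:
  assumes "smooth f" "set bs \<subseteq> Basis"
  shows "smooth (iterated_deriv bs f)"
  using assms(2)
  by (induction bs) (auto simp: iterated_deriv_Cons assms(1) intro: smooth_partial_deriv)

lemma partial_deriv_eq: "(f has_derivative D) (at x) \<Longrightarrow> partial_deriv b f x = D b"
  unfolding partial_deriv_def using frechet_derivative_at by metis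

lemma slice_has_derivative:
  assumes "smooth f"
  shows "((\<lambda>p. f (fst p, t)) has_derivative
    (\<lambda>b. partial_deriv (1, 0) f (fst p, t) * fst b)) (at (p :: real \<times> real))"
proof -
  let ?F = "frechet_derivative f (at (fst p, t))"
  have F: "(f has_derivative ?F) (at (fst p, t))"
    using smooth_differentiable[OF assms] by (simp add: frechet_derivative_works)
  have "((\<lambda>p::real\<times>real. (fst p, t)) has_derivative (\<lambda>b. (fst b, 0))) (at p)"
    by (auto intro!: derivative_eq_intros)
  then have "((\<lambda>p. f (fst p, t)) has_derivative (\<lambda>b. ?F (fst b, 0))) (at p)"
    using has_derivative_compose F by fastforce
  moreover have "(\<lambda>b::real \<times> real. ?F (fst b, 0)) = (\<lambda>b. ?F (1, 0) * fst b)"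
  proof (rule ext)
    fix b :: "real \<times> real"
    show "?F (fst b, 0) = ?F (1, 0) * fst b"
      using linear_scale[OF has_derivative_linear[OF F], of "fst b" "(1, 0)"] by simp
  qed
  ultimately show ?thesis
    by (simp add: partial_deriv_def)
qed

text \<open>The partial derivatives are taken with the basis vector \<open>b\<close> fixed, so that
  factors such as \<open>fst b\<close> and \<open>snd b\<close> are constants of the class.\<close>

lemma smooth_gen_deriv:
  assumes "smooth_gen f"
  shows "\<exists>D. (\<forall>p. (f has_derivative D p) (at p)) \<and> (\<forall>b\<in>Basis. smooth_gen (\<lambda>p. D p b))"
  using assms
proof induction
  case (slice f t)
  show ?case
    by (intro exI[of _ "\<lambda>p b. partial_deriv (1, 0) f (fst p, t) * fst b"] conjI allI
        slice_has_derivative slice ballI smooth_gen.mult)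
      (use slice in \<open>auto intro!: smooth_gen.slice smooth_gen.const smooth_partial_deriv
        simp: Basis_plane\<close>)
next
  case (const c)
  show ?case by (intro exI[of _ "\<lambda>p b. 0"]) (auto intro: smooth_gen.intros)
next
  case fst
  show ?case
    by (intro exI[of _ "\<lambda>p. fst"]) (auto intro!: smooth_gen.intros derivative_eq_intros)
next
  case snd
  show ?case
    by (intro exI[of _ "\<lambda>p. snd"]) (auto intro!: smooth_gen.intros derivative_eq_intros)
next
  case (add f g)
  then obtain D E where "\<forall>p. (f has_derivative D p) (at p)" "\<forall>b\<in>Basis. smooth_gen (\<lambda>p. D p b)"
    "\<forall>p. (g has_derivative E p) (at p)" "\<forall>b\<in>Basis. smooth_gen (\<lambda>p. E p b)" by blast
  then show ?case
    by (intro exI[of _ "\<lambda>p b. D p b + E p b"]) (auto intro!: has_derivative_add smooth_gen.add)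
next
  case (mult f g)
  then obtain D E where "\<forall>p. (f has_derivative D p) (at p)" "\<forall>b\<in>Basis. smooth_gen (\<lambda>p. D p b)"
    "\<forall>p. (g has_derivative E p) (at p)" "\<forall>b\<in>Basis. smooth_gen (\<lambda>p. E p b)" by blast
  with mult(1,2) show ?case
    by (intro exI[of _ "\<lambda>p b. f p * E p b + D p b * g p"])
      (auto intro!: has_derivative_mult smooth_gen.add smooth_gen.mult)
next
  case (exp f)
  then obtain D where "\<forall>p. (f has_derivative D p) (at p)" "\<forall>b\<in>Basis. smooth_gen (\<lambda>p. D p b)" by blast
  with exp(1) show ?case
    by (intro exI[of _ "\<lambda>p b. exp (f p) * D p b"])
      (auto intro!: smooth_gen.mult smooth_gen.exp derivative_eq_intros)
next
  case (flat f n)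
  then obtain D where D: "\<forall>p. (f has_derivative D p) (at p)" "\<forall>b\<in>Basis. smooth_gen (\<lambda>p. D p b)" by blast
  let ?d = "\<lambda>x. flat (n + 2) x + (- real n) * flat (n + 1) x"
  have "((\<lambda>p. flat n (f p)) has_derivative (\<lambda>b. ?d (f p) * D p b)) (at p)" for p
    using has_derivative_compose[of f "D p" p UNIV "flat n" "\<lambda>h. ?d (f p) * h"] D(1)
      flat_has_derivative[of n "f p"]
    by (simp add: has_field_derivative_def)
  with D flat(1) show ?case
    by (intro exI[of _ "\<lambda>p b. ?d (f p) * D p b"] conjI ballI allI smooth_gen.mult smooth_gen.flat
        smooth_gen.add smooth_gen.const) auto
next
  case (primitive I q)
  have "((\<lambda>p. I (snd p)) has_derivative (\<lambda>b. q (snd p) * snd b)) (at p)" for p :: "real \<times> real"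
    using has_derivative_compose[OF bounded_linear_imp_has_derivative[OF bounded_linear_snd]
        primitive(1)[of "snd p", unfolded has_field_derivative_def]] .
  with primitive show ?case
    by (intro exI[of _ "\<lambda>p b. q (snd p) * snd b"] conjI allI ballI smooth_gen.mult
        smooth_gen.const)
qed

lemma smooth_gen_smooth:
  assumes "smooth_gen f"
  shows "smooth f"
proof -
  have "iterated_deriv bs f differentiable at x" if "smooth_gen f" "set bs \<subseteq> Basis" for bs f x
    using that
  \<comment> \<open>\<open>iterated_deriv\<close> applies the last entry of the list first. Removing
    that entry replaces \<open>f\<close> by one of its partial derivatives, again in the class, so
    \<open>f\<close> is generalised.\<close>
  proof (induction bs arbitrary: f rule: rev_induct)
    case Nil
    then show ?case using smooth_gen_deriv[OF Nil(1)] by (metis differentiable_def iterated_deriv_Nil)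
  next
    case (snoc b bs)
    obtain D where D: "\<forall>p. (f has_derivative D p) (at p)" "\<forall>b\<in>Basis. smooth_gen (\<lambda>p. D p b)"
      using smooth_gen_deriv[OF snoc(2)] by blast
    have "partial_deriv b f = (\<lambda>p. D p b)"
      using D(1) partial_deriv_eq by blast
    then show ?case using snoc D(2) by (simp add: iterated_deriv_snoc)
  qed
  then show ?thesis using assms unfolding smooth_def by blast
qed

text \<open>A smooth bump on \<open>(a, b)\<close> with values below \<open>1\<close>. At a point of
  \<open>(a, b)\<close> the product of the two \<open>flat\<close> factors is positive, so the bump
  increases to \<open>1\<close> as \<open>n\<close> grows; it plays the part of a mollified
  indicator. For an empty interval it is zero.\<close>

definition cutoff :: "real \<Rightarrow> real \<Rightarrow> nat \<Rightarrow> real \<Rightarrow> real" where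
  "cutoff a b n x = 1 - exp (- (real n * (flat 0 (x - a) * flat 0 (b - x))))"

lemma smooth_gen_cutoff:
  assumes "smooth_gen f"
  shows "smooth_gen (\<lambda>p. cutoff a b n (f p))"
proof -
  have "smooth_gen (\<lambda>p. 1 + (-1) * exp ((- real n) * (flat 0 (f p + (- a)) * flat 0 (b + (-1) * f p))))"
    by (intro smooth_gen.add smooth_gen.const smooth_gen.mult smooth_gen.exp smooth_gen.flat assms)
  then show ?thesis by (simp add: cutoff_def)
qed

lemma cutoff_range: "0 \<le> cutoff a b n x" "cutoff a b n x \<le> 1"
  using flat_nonneg[of 0 "x - a"] flat_nonneg[of 0 "b - x"] by (auto simp: cutoff_def)

lemma cutoff_outside: "x \<notin> {a<..<b} \<Longrightarrow> cutoff a b n x = 0"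
  by (auto simp: cutoff_def flat_def)

lemma continuous_flat: "continuous_on UNIV (flat n)"
  using flat_has_derivative by (meson DERIV_isCont continuous_at_imp_continuous_on)

lemma continuous_cutoff: "continuous_on UNIV (cutoff a b n)"
  unfolding cutoff_def
  by (intro continuous_intros continuous_on_compose2[OF continuous_flat]) auto

text \<open>The endpoints move with \<open>n\<close> because some limit intervals reach the final
  time \<open>T\<close>, where a fixed bump would not have compact support in Omega. Approaching
  from inside keeps the bumps zero off \<open>(a, b)\<close>.\<close>

lemma cutoff_tendsto:
  assumes "A \<longlonglongrightarrow> a" "B \<longlonglongrightarrow> b" "\<And>n. a \<le> A n" "\<And>n. B n \<le> b"
  shows "(\<lambda>n. cutoff (A n) (B n) n x) \<longlonglongrightarrow> indicator {a<..<b} x"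
proof (cases "x \<in> {a<..<b}")
  case True
  let ?h = "\<lambda>n. flat 0 (x - A n) * flat 0 (B n - x)"
  have c: "isCont (flat 0) y" for y using flat_has_derivative DERIV_isCont by blast
  have "(\<lambda>n. flat 0 (x - A n)) \<longlonglongrightarrow> flat 0 (x - a)" "(\<lambda>n. flat 0 (B n - x)) \<longlonglongrightarrow> flat 0 (b - x)"
    by (intro isCont_tendsto_compose[OF c] tendsto_intros assms)+
  then have "?h \<longlonglongrightarrow> flat 0 (x - a) * flat 0 (b - x)" by (rule tendsto_mult)
  moreover have "flat 0 (x - a) * flat 0 (b - x) > 0"
    using True by (simp add: flat_def)
  ultimately have "LIM n sequentially. ?h n * real n :> at_top"
    using filterlim_tendsto_pos_mult_at_top filterlim_real_sequentially by blast
  then have "(\<lambda>n. exp (- (real n * ?h n))) \<longlonglongrightarrow> 0"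
    by (intro filterlim_compose[OF exp_at_bot]) (simp add: filterlim_uminus_at_bot mult.commute)
  then have "(\<lambda>n. 1 - exp (- (real n * ?h n))) \<longlonglongrightarrow> 1 - 0"
    by (intro tendsto_intros)
  then show ?thesis using True by (simp add: cutoff_def)
next
  case False
  then have "cutoff (A n) (B n) n x = 0" for n
    using assms(3,4)[of n] by (intro cutoff_outside) auto
  then show ?thesis using False by simp
qed

subsection \<open>Borel representatives and weak derivatives\<close>

lemma integral_lebesgue_on_borel:
  fixes f :: "'a::euclidean_space \<Rightarrow> real"
  assumes [measurable]: "S \<in> sets borel" "f \<in> borel_measurable borel"
  shows "(LINT x|lebesgue_on S. f x) = (LINT x|lborel. indicator S x * f x)"
    and "integrable (lebesgue_on S) f \<longleftrightarrow> integrable lborel (\<lambda>x. indicator S x * f x)"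
proof -
  have "(LINT x|lebesgue_on S. f x) = (LINT x|lebesgue. indicator S x *\<^sub>R f x)"
    using assms by (subst integral_restrict_space) auto
  also have "\<dots> = (LINT x|lborel. indicator S x *\<^sub>R f x)"
    by (subst integral_completion) auto
  finally show "(LINT x|lebesgue_on S. f x) = (LINT x|lborel. indicator S x * f x)" by simp
  have "integrable (lebesgue_on S) f \<longleftrightarrow> integrable lebesgue (\<lambda>x. indicator S x *\<^sub>R f x)"
    using assms by (subst integrable_restrict_space) auto
  also have "\<dots> \<longleftrightarrow> integrable lborel (\<lambda>x. indicator S x *\<^sub>R f x)"
    by (subst integrable_completion) auto
  finally show "integrable (lebesgue_on S) f \<longleftrightarrow> integrable lborel (\<lambda>x. indicator S x * f x)" by simp
qed

lemma borel_measurable_lebesgue_on_if_borel: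
  assumes "f \<in> borel_measurable borel"
  shows "f \<in> borel_measurable (lebesgue_on S)"
  using assms by (intro measurable_restrict_space1 measurable_completion) simp

lemma borel_representative:
  fixes f :: "'a::euclidean_space \<Rightarrow> real"
  assumes [measurable]: "S \<in> sets borel" and f: "f \<in> borel_measurable (lebesgue_on S)"
  obtains g where "g \<in> borel_measurable borel" "\<And>x. x \<notin> S \<Longrightarrow> g x = 0"
    "AE x in lebesgue_on S. f x = g x"
proof -
  have "(\<lambda>x. f x * indicator S x) \<in> borel_measurable lebesgue"
    using f by (subst (asm) borel_measurable_restrict_space_iff) (auto simp: mult.commute)
  then obtain g where g: "g \<in> borel_measurable borel" "AE x in lborel. f x * indicator S x = g x"
    using completion_ex_borel_measurable_real[of "\<lambda>x. f x * indicator S x" lborel] by auto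
  let ?g = "\<lambda>x. g x * indicator S x"
  have "AE x in lebesgue. f x * indicator S x = g x"
    using AE_completion[OF g(2)] .
  then have "AE x in lebesgue_on S. f x = ?g x"
    by (subst AE_restrict_space_iff) (auto elim!: eventually_mono)
  then show ?thesis
    using g(1) by (intro that[of ?g]) auto
qed

text \<open>Square integrable Borel functions on the whole space that vanish outside \<open>S\<close>: the
  representatives of \<open>L2 S\<close> to which Fubini's theorem for \<open>lborel\<close> applies.\<close>

definition sqint :: "'a::euclidean_space set \<Rightarrow> ('a \<Rightarrow> real) \<Rightarrow> bool" where
  "sqint S f \<longleftrightarrow> f \<in> borel_measurable borel \<and> integrable lborel (\<lambda>x. (f x)\<^sup>2) \<and> (\<forall>x. x \<notin> S \<longrightarrow> f x = 0)"

lemma sqint_measurable [measurable_dest]: "sqint S f \<Longrightarrow> f \<in> borel_measurable borel"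
  by (simp add: sqint_def)

lemma L2_borel_iff:
  fixes f :: "'a::euclidean_space \<Rightarrow> real"
  assumes "S \<in> sets borel" "f \<in> borel_measurable borel"
  shows "f \<in> L2 S \<longleftrightarrow> integrable lborel (\<lambda>x. indicator S x * (f x)\<^sup>2)"
  using assms by (simp add: L2_def borel_measurable_lebesgue_on_if_borel integral_lebesgue_on_borel)

lemma sqint_indicator:
  assumes "sqint S f"
  shows "indicator S x * (f x * c) = f x * c" "indicator S x * (c * f x) = c * f x"
    "indicator S x * f x = f x"
  using assms by (auto simp: sqint_def indicator_def)

lemma sqint_L2: "S \<in> sets borel \<Longrightarrow> sqint S f \<Longrightarrow> f \<in> L2 S"
  by (subst L2_borel_iff) (simp_all add: sqint_measurable power2_eq_square sqint_indicator, simp_all add: sqint_def power2_eq_square)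

lemma L2_representative:
  fixes f :: "'a::euclidean_space \<Rightarrow> real"
  assumes [measurable]: "S \<in> sets borel" and f: "f \<in> L2 S"
  obtains g where "sqint S g" "AE x in lebesgue_on S. f x = g x"
proof -
  obtain g where g: "g \<in> borel_measurable borel" "\<And>x. x \<notin> S \<Longrightarrow> g x = 0"
    "AE x in lebesgue_on S. f x = g x"
    using borel_representative assms L2_def by blast
  have "AE x in lebesgue_on S. (f x)\<^sup>2 = (g x)\<^sup>2"
    using g(3) by eventually_elim simp
  moreover have "integrable (lebesgue_on S) (\<lambda>x. (f x)\<^sup>2)" "f \<in> borel_measurable (lebesgue_on S)"
    using f by (auto simp: L2_def)
  ultimately have "integrable (lebesgue_on S) (\<lambda>x. (g x)\<^sup>2)"
    using g(1) borel_measurable_lebesgue_on_if_borel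
    by (subst (asm) integrable_cong_AE) (auto intro: borel_measurable_power)
  then have "integrable lborel (\<lambda>x. indicator S x * (g x)\<^sup>2)"
    using g(1) by (simp add: integral_lebesgue_on_borel)
  moreover have "(\<lambda>x. indicator S x * (g x)\<^sup>2) = (\<lambda>x. (g x)\<^sup>2)"
    using g(2) by (auto simp: indicator_def fun_eq_iff)
  ultimately have "sqint S g" using g by (simp add: sqint_def)
  with g(3) show ?thesis using that by blast
qed

lemma square_integrable_mult:
  fixes f g :: "'a \<Rightarrow> real"
  assumes [measurable]: "f \<in> borel_measurable M" "g \<in> borel_measurable M"
    and "integrable M (\<lambda>x. (f x)\<^sup>2)" "integrable M (\<lambda>x. (g x)\<^sup>2)"
  shows "integrable M (\<lambda>x. f x * g x)"
proof (rule Bochner_Integration.integrable_bound)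
  show "integrable M (\<lambda>x. (f x)\<^sup>2 + (g x)\<^sup>2)" using assms by simp
  have "\<bar>f x * g x\<bar> \<le> (f x)\<^sup>2 + (g x)\<^sup>2" for x
    using sum_squares_bound[of "\<bar>f x\<bar>" "\<bar>g x\<bar>"] abs_ge_zero[of "f x * g x"]
    unfolding abs_mult power2_abs by linarith
  then show "AE x in M. norm (f x * g x) \<le> norm ((f x)\<^sup>2 + (g x)\<^sup>2)"
    by (intro AE_I2) simp
qed simp

lemma sqint_mult_integrable: "sqint S f \<Longrightarrow> sqint S g \<Longrightarrow> integrable lborel (\<lambda>x. f x * g x)"
  by (intro square_integrable_mult) (auto simp: sqint_def)

lemma sqint_bounded_mult:
  fixes f :: "'a::euclidean_space \<Rightarrow> real"
  assumes "sqint S f" and [measurable]: "h \<in> borel_measurable borel" and "\<And>x. x \<in> S \<Longrightarrow> \<bar>h x\<bar> \<le> C"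
  shows "sqint S (\<lambda>x. h x * f x)"
  unfolding sqint_def
proof (intro conjI)
  note [measurable] = sqint_measurable[OF assms(1)]
  show "(\<lambda>x. h x * f x) \<in> borel_measurable borel" by measurable
  show "\<forall>x. x \<notin> S \<longrightarrow> h x * f x = 0" using assms by (simp add: sqint_def)
  show "integrable lborel (\<lambda>x. (h x * f x)\<^sup>2)"
  proof (rule Bochner_Integration.integrable_bound)
    show "integrable lborel (\<lambda>x. C\<^sup>2 * (f x)\<^sup>2)" using assms by (simp add: sqint_def)
    have "(h x * f x)\<^sup>2 \<le> C\<^sup>2 * (f x)\<^sup>2" for x
    proof (cases "x \<in> S")
      case True
      then have "(h x)\<^sup>2 \<le> C\<^sup>2" using assms(3)[OF True] by (simp add: abs_le_square_iff [symmetric])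
      then show ?thesis by (simp add: power_mult_distrib mult_right_mono)
    qed (use assms in \<open>simp add: sqint_def\<close>)
    then show "AE x in lborel. norm ((h x * f x)\<^sup>2) \<le> norm (C\<^sup>2 * (f x)\<^sup>2)" by simp
  qed measurable
qed

lemma sqint_integrable:
  fixes f :: "'a::euclidean_space \<Rightarrow> real"
  assumes "sqint S f" "bounded S" "S \<in> sets borel"
  shows "integrable lborel f"
proof -
  have "emeasure lborel S < \<infinity>" using assms emeasure_bounded_finite by blast
  then have "integrable lborel (indicator S :: 'a \<Rightarrow> real)"
    using assms(3) by (intro integrable_real_indicator) auto
  moreover have "(\<lambda>x. (indicator S x)\<^sup>2) = (indicator S :: 'a \<Rightarrow> real)"
    by (auto simp: indicator_def)
  ultimately have "sqint S (indicator S :: 'a \<Rightarrow> real)"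
    using assms(3) by (simp add: sqint_def)
  from sqint_mult_integrable[OF this assms(1)] show ?thesis
    by (simp add: sqint_indicator[OF assms(1)])
qed

text \<open>Away from the closed support the function vanishes on an open set, hence so do all
  derivatives; boundedness and integrability are then compactness of the support.\<close>

lemma test_function_properties:
  assumes "\<phi> \<in> test_functions S" "set bs \<subseteq> Basis"
  shows "continuous_on UNIV (iterated_deriv bs \<phi>)"
    and "\<And>x. x \<notin> S \<Longrightarrow> iterated_deriv bs \<phi> x = 0"
    and "\<exists>C. \<forall>x. \<bar>iterated_deriv bs \<phi> x\<bar> \<le> C"
    and "iterated_deriv bs \<phi> \<in> borel_measurable borel"
    and "integrable lborel (\<lambda>x. (iterated_deriv bs \<phi> x)\<^sup>2)"
proof -
  let ?K = "closure {x. \<phi> x \<noteq> 0}" and ?h = "iterated_deriv bs \<phi>"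
  have K: "smooth \<phi>" "compact ?K" "?K \<subseteq> S" using assms by (auto simp: test_functions_def)
  show c: "continuous_on UNIV ?h"
    using smooth_differentiable[OF smooth_iterated_deriv[OF K(1) assms(2)]]
    by (simp add: continuous_at_imp_continuous_on differentiable_imp_continuous_within)
  show "?h \<in> borel_measurable borel" by (rule borel_measurable_continuous_onI[OF c])
  have z: "?h x = 0" if "x \<notin> ?K" for x
    using that
  proof (induction bs arbitrary: x)
    case Nil
    have "{x. \<phi> x \<noteq> 0} \<subseteq> ?K" by (rule closure_subset)
    with Nil show ?case by auto
  next
    case (Cons b bs)
    have "((\<lambda>x. 0) has_derivative (\<lambda>_. 0)) (at x)" by simp
    then have "(iterated_deriv bs \<phi> has_derivative (\<lambda>_. 0)) (at x)"
      by (rule has_derivative_transform_within_open[where s="- ?K"]) (use Cons in auto)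
    then show ?case by (simp add: iterated_deriv_Cons partial_deriv_eq)
  qed
  then show "?h x = 0" if "x \<notin> S" for x using K(3) that by blast
  have "integrable lborel (\<lambda>x. indicator ?K x *\<^sub>R (?h x)\<^sup>2)"
    by (intro borel_integrable_compact K continuous_intros continuous_on_subset[OF c]) auto
  moreover have "(\<lambda>x. indicator ?K x *\<^sub>R (?h x)\<^sup>2) = (\<lambda>x. (?h x)\<^sup>2)"
    using z by (auto simp: indicator_def fun_eq_iff)
  ultimately show "integrable lborel (\<lambda>x. (?h x)\<^sup>2)" by simp
  have "compact (?h ` ?K)"
    using K(2) c compact_continuous_image continuous_on_subset by blast
  then obtain C where "\<forall>y\<in>?h ` ?K. \<bar>y\<bar> \<le> C" using compact_imp_bounded bounded_real by blast
  then have "\<bar>?h x\<bar> \<le> max C 0" for x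
    using z[of x] by (cases "x \<in> ?K") (auto simp: le_max_iff_disj)
  then show "\<exists>C. \<forall>x. \<bar>?h x\<bar> \<le> C" by blast
qed

lemma test_integral:
  fixes f h :: "'a::euclidean_space \<Rightarrow> real"
  assumes [measurable]: "S \<in> sets borel" "f \<in> borel_measurable borel"
    and "h \<in> borel_measurable borel" "\<And>x. x \<notin> S \<Longrightarrow> h x = 0"
  shows "(LINT x|lebesgue_on S. f x * h x) = (LINT x|lborel. f x * h x)"
proof -
  note [measurable] = assms(3)
  have "(LINT x|lebesgue_on S. f x * h x) = (LINT x|lborel. indicator S x * (f x * h x))"
    by (rule integral_lebesgue_on_borel) auto
  also have "(\<lambda>x. indicator S x * (f x * h x)) = (\<lambda>x. f x * h x)"
    using assms(4) by (auto simp: indicator_def fun_eq_iff)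
  finally show ?thesis .
qed

lemma has_weak_deriv_borel_iff:
  assumes "S \<in> sets borel" "f \<in> borel_measurable borel" "g \<in> borel_measurable borel" "set bs \<subseteq> Basis"
  shows "has_weak_deriv S bs f g \<longleftrightarrow> f \<in> L2 S \<and> g \<in> L2 S \<and>
    (\<forall>\<phi>\<in>test_functions S. (LINT x|lborel. f x * iterated_deriv bs \<phi> x)
      = (-1) ^ length bs * (LINT x|lborel. g x * \<phi> x))"
proof -
  have "(LINT x|lebesgue_on S. f x * iterated_deriv bs \<phi> x) = (LINT x|lborel. f x * iterated_deriv bs \<phi> x)"
    "(LINT x|lebesgue_on S. g x * \<phi> x) = (LINT x|lborel. g x * \<phi> x)"
    if "\<phi> \<in> test_functions S" for \<phi>
    using test_function_properties[OF that, of bs] test_function_properties[OF that, of "[]"] assms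
    by (auto intro!: test_integral)
  then show ?thesis unfolding has_weak_deriv_def by auto
qed

section \<open>Linearity and null-set invariance of \<open>L2\<close> and of weak
  derivatives\<close>

lemma L2_add:
  assumes "f \<in> L2 S" "g \<in> L2 S"
  shows "(\<lambda>x. f x + g x) \<in> L2 S"
proof -
  have "integrable (lebesgue_on S) (\<lambda>x. f x * g x)"
    using assms by (intro square_integrable_mult) (auto simp: L2_def)
  then have "integrable (lebesgue_on S) (\<lambda>x. (f x)\<^sup>2 + (g x)\<^sup>2 + 2 * (f x * g x))"
    using assms by (auto simp: L2_def)
  moreover have "(\<lambda>x. f x + g x) \<in> borel_measurable (lebesgue_on S)"
    using assms by (intro borel_measurable_add) (simp_all add: L2_def)
  ultimately show ?thesis by (simp add: L2_def power2_sum mult.assoc)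
qed

lemma L2_cmult: "f \<in> L2 S \<Longrightarrow> (\<lambda>x. c * f x) \<in> L2 S"
  by (auto simp: L2_def power_mult_distrib)

lemma L2_diff: "f \<in> L2 S \<Longrightarrow> g \<in> L2 S \<Longrightarrow> (\<lambda>x. f x - g x) \<in> L2 S"
  using L2_add[of f S "\<lambda>x. (-1) * g x"] L2_cmult[of g S "-1"] by simp

lemma L2_cong_AE:
  assumes "AE x in lebesgue_on S. f x = f' x" "f \<in> L2 S" "f' \<in> borel_measurable (lebesgue_on S)"
  shows "f' \<in> L2 S"
proof -
  have "AE x in lebesgue_on S. (f x)\<^sup>2 = (f' x)\<^sup>2" using assms(1) by eventually_elim simp
  then have "integrable (lebesgue_on S) (\<lambda>x. (f x)\<^sup>2) \<longleftrightarrow> integrable (lebesgue_on S) (\<lambda>x. (f' x)\<^sup>2)"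
    using assms by (intro integrable_cong_AE) (auto simp: L2_def)
  then show ?thesis using assms by (simp add: L2_def)
qed

lemma has_weak_deriv_cong_AE:
  assumes "has_weak_deriv S bs f g" "AE x in lebesgue_on S. f x = f' x" "AE x in lebesgue_on S. g x = g' x"
    "f' \<in> borel_measurable (lebesgue_on S)" "g' \<in> borel_measurable (lebesgue_on S)" "set bs \<subseteq> Basis"
  shows "has_weak_deriv S bs f' g'"
  unfolding has_weak_deriv_def
proof (intro conjI ballI)
  have L: "f \<in> L2 S" "g \<in> L2 S" using assms(1) by (auto simp: has_weak_deriv_def)
  then show "f' \<in> L2 S" "g' \<in> L2 S" using assms L2_cong_AE by blast+
  have [measurable]: "f \<in> borel_measurable (lebesgue_on S)" "g \<in> borel_measurable (lebesgue_on S)"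
    using L by (auto simp: L2_def)
  note [measurable] = assms(4,5)
  fix \<phi> assume p: "\<phi> \<in> test_functions S"
  have [measurable]: "\<phi> \<in> borel_measurable (lebesgue_on S)"
    "iterated_deriv bs \<phi> \<in> borel_measurable (lebesgue_on S)"
    using test_function_properties(4)[OF p, of "[]"] test_function_properties(4)[OF p assms(6)]
    by (auto intro: borel_measurable_lebesgue_on_if_borel)
  have "(LINT x|lebesgue_on S. f' x * iterated_deriv bs \<phi> x) = (LINT x|lebesgue_on S. f x * iterated_deriv bs \<phi> x)"
    by (intro integral_cong_AE) (use assms(2) in \<open>auto elim!: eventually_mono\<close>)
  moreover have "(LINT x|lebesgue_on S. g' x * \<phi> x) = (LINT x|lebesgue_on S. g x * \<phi> x)"
    by (intro integral_cong_AE) (use assms(3) in \<open>auto elim!: eventually_mono\<close>)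
  ultimately show "(LINT x|lebesgue_on S. f' x * iterated_deriv bs \<phi> x)
      = (-1) ^ length bs * (LINT x|lebesgue_on S. g' x * \<phi> x)"
    using assms(1) p by (simp add: has_weak_deriv_def)
qed

lemma has_weak_deriv_diff:
  assumes "has_weak_deriv S bs f g" "has_weak_deriv S bs f' g'" "set bs \<subseteq> Basis"
  and [measurable]: "S \<in> sets borel"
  shows "has_weak_deriv S bs (\<lambda>x. f x - f' x) (\<lambda>x. g x - g' x)"
proof -
  have L2: "f \<in> L2 S" "g \<in> L2 S" "f' \<in> L2 S" "g' \<in> L2 S"
    using assms by (auto simp: has_weak_deriv_def)
  have int: "integrable (lebesgue_on S) (\<lambda>x. p x * iterated_deriv cs \<phi> x)"
    if "p \<in> L2 S" "\<phi> \<in> test_functions S" "set cs \<subseteq> Basis" for p \<phi> cs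
  proof (rule square_integrable_mult)
    have "sqint S (iterated_deriv cs \<phi>)"
      using test_function_properties[OF that(2,3)] by (simp add: sqint_def)
    from sqint_L2[OF assms(4) this] that(1)
    show "p \<in> borel_measurable (lebesgue_on S)" "integrable (lebesgue_on S) (\<lambda>x. (p x)\<^sup>2)"
      "iterated_deriv cs \<phi> \<in> borel_measurable (lebesgue_on S)"
      "integrable (lebesgue_on S) (\<lambda>x. (iterated_deriv cs \<phi> x)\<^sup>2)"
      by (simp_all add: L2_def)
  qed
  show ?thesis
    unfolding has_weak_deriv_def
  proof (intro conjI ballI L2_diff L2)
    fix \<phi> assume p: "\<phi> \<in> test_functions S"
    show "(LINT x|lebesgue_on S. (f x - f' x) * iterated_deriv bs \<phi> x)
      = (-1) ^ length bs * (LINT x|lebesgue_on S. (g x - g' x) * \<phi> x)"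
      using int[OF L2(1) p assms(3)] int[OF L2(3) p assms(3)] int[OF L2(2) p, of "[]"]
        int[OF L2(4) p, of "[]"] assms(1,2) p
      by (simp add: left_diff_distrib has_weak_deriv_def right_diff_distrib)
  qed
qed

subsection \<open>Backward time integrals\<close>

lemma borel_fst [measurable]: "(fst :: real \<times> real \<Rightarrow> real) \<in> borel_measurable borel"
  and borel_snd [measurable]: "(snd :: real \<times> real \<Rightarrow> real) \<in> borel_measurable borel"
  by (intro borel_measurable_continuous_onI continuous_intros)+

lemma integrable_indicator_Ioo [simp]: "integrable lborel (indicator {a<..<b::real} :: real \<Rightarrow> real)"
  using emeasure_bounded_finite[of "{a<..<b}"] by (intro integrable_real_indicator) auto

lemma plane_Fubini:
  fixes F :: "real \<times> real \<Rightarrow> real"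
  assumes "integrable lborel F"
  shows "AE x in lborel. integrable lborel (\<lambda>t. F (x, t))"
    and "AE t in lborel. integrable lborel (\<lambda>x. F (x, t))"
    and "integrable lborel (\<lambda>x. LINT t|lborel. F (x, t))"
    and "integrable lborel (\<lambda>t. LINT x|lborel. F (x, t))"
    and "(LINT p|lborel. F p) = (LINT x|lborel. LINT t|lborel. F (x, t))"
    and "(LINT p|lborel. F p) = (LINT t|lborel. LINT x|lborel. F (x, t))"
proof -
  have F: "integrable (lborel \<Otimes>\<^sub>M lborel) F" "integrable (lborel \<Otimes>\<^sub>M lborel) (\<lambda>(x, t). F (x, t))"
    using assms by (simp_all add: lborel_prod)
  show "AE x in lborel. integrable lborel (\<lambda>t. F (x, t))"
    by (rule lborel_pair.AE_integrable_fst'[OF F(1)])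
  show "AE t in lborel. integrable lborel (\<lambda>x. F (x, t))"
    by (rule lborel_pair.AE_integrable_snd[OF F(2)])
  show "integrable lborel (\<lambda>x. LINT t|lborel. F (x, t))"
    by (rule lborel_pair.integrable_fst'[OF F(1)])
  show "integrable lborel (\<lambda>t. LINT x|lborel. F (x, t))"
    by (rule lborel_pair.integrable_snd[OF F(2)])
  show "(LINT p|lborel. F p) = (LINT x|lborel. LINT t|lborel. F (x, t))"
    using lborel_pair.integral_fst'[OF F(1)] by (simp add: lborel_prod)
  show "(LINT p|lborel. F p) = (LINT t|lborel. LINT x|lborel. F (x, t))"
    using lborel_pair.integral_snd[OF F(2)] by (simp add: lborel_prod)
qed

lemma plane_integrable:
  fixes F :: "real \<times> real \<Rightarrow> real"
  assumes "F \<in> borel_measurable borel" "AE x in lborel. integrable lborel (\<lambda>t. F (x, t))"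
    "integrable lborel (\<lambda>x. LINT t|lborel. \<bar>F (x, t)\<bar>)"
  shows "integrable lborel F"
  using lborel_pair.Fubini_integrable[of F] assms by (simp add: lborel_prod)

lemma L1_le_L2_interval:
  assumes g: "sqint {0<..<T} g" and "T > 0"
  shows "(LINT s|lborel. \<bar>g s\<bar>)\<^sup>2 \<le> T * (LINT s|lborel. (g s)\<^sup>2)"
proof -
  \<comment> \<open>\<open>c\<close> is the mean of \<open>\<bar>g\<bar>\<close>. It minimises the
    integral of \<open>(\<bar>g\<bar> - c)\<^sup>2\<close> over \<open>(0, T)\<close>, and for this
    \<open>c\<close> nonnegativity of that integral is the Cauchy-Schwarz inequality against the
    constant \<open>1\<close>.\<close>
  define c where "c = (LINT s|lborel. \<bar>g s\<bar>) / T"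
  have i: "integrable lborel (\<lambda>s. \<bar>g s\<bar>)" "integrable lborel (\<lambda>s. (g s)\<^sup>2)"
    "integrable lborel (\<lambda>s. c\<^sup>2 * indicator {0<..<T} s)"
    using sqint_integrable[OF g] g by (auto simp: sqint_def)
  have "0 \<le> (LINT s|lborel. (g s)\<^sup>2 - 2 * c * \<bar>g s\<bar> + c\<^sup>2 * indicator {0<..<T} s)"
  proof (rule Bochner_Integration.integral_nonneg)
    fix s
    have "(g s)\<^sup>2 - 2 * c * \<bar>g s\<bar> + c\<^sup>2 * indicator {0<..<T} s = (\<bar>g s\<bar> - c)\<^sup>2 * indicator {0<..<T} s"
      using g by (cases "s \<in> {0<..<T}") (auto simp: sqint_def power2_diff)
    then show "0 \<le> (g s)\<^sup>2 - 2 * c * \<bar>g s\<bar> + c\<^sup>2 * indicator {0<..<T} s" by simp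
  qed
  also have "\<dots> = (LINT s|lborel. (g s)\<^sup>2) - 2 * c * (LINT s|lborel. \<bar>g s\<bar>) + c\<^sup>2 * T"
    using i assms by simp
  also have "\<dots> = (LINT s|lborel. (g s)\<^sup>2) - (LINT s|lborel. \<bar>g s\<bar>)\<^sup>2 / T"
    using assms by (simp add: c_def power2_eq_square field_simps)
  finally show ?thesis using assms by (simp add: field_simps)
qed

lemma integrable_real_mult_indicator_left:
  fixes f :: "'a \<Rightarrow> real"
  shows "A \<in> sets M \<Longrightarrow> integrable M f \<Longrightarrow> integrable M (\<lambda>x. indicator A x * f x)"
  using integrable_real_mult_indicator[of A M f] by (simp add: mult.commute)

text \<open>For \<open>f = u\<close> extended by zero this is \<open>\<eta>(x, t) = \<integral>\<^sub>t\<^sup>T (T - s) u(x, s) ds\<close>, the test function of the energy estimate.\<close>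

definition tail :: "real \<Rightarrow> (real \<times> real \<Rightarrow> real) \<Rightarrow> real \<times> real \<Rightarrow> real" where
  "tail T f p = (LINT s|lborel. indicator {snd p<..} s * ((T - s) * f (fst p, s)))"

lemma tail_measurable [measurable]:
  assumes [measurable]: "f \<in> borel_measurable borel"
  shows "tail T f \<in> borel_measurable borel"
proof -
  have "(\<lambda>p. LINT s|lborel. (if snd p < s then (T - s) * f (fst p, s) else 0)) \<in> borel_measurable borel"
    by (intro lborel.borel_measurable_lebesgue_integral) measurable
  moreover have "indicator {a<..} s * c = (if a < s then c else 0)" for a s c :: real
    by simp
  ultimately show ?thesis
    unfolding tail_def by simp
qed

lemma sqint_weight:
  assumes g: "sqint {0<..<T} g"
  shows "sqint {0<..<T} (\<lambda>s. (T - s) * g s)"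
  by (rule sqint_bounded_mult[OF g, where C=T]) auto

text \<open>On the support of \<open>g\<close> the weight is at most \<open>T\<close>, which
  contributes \<open>T\<^sup>2\<close>; Cauchy-Schwarz on \<open>(0, T)\<close> contributes one more
  factor \<open>T\<close>. The bound is uniform in the lower limit \<open>t\<close>.\<close>

lemma tail_section_bound:
  assumes g: "sqint {0<..<T} g" and "T > 0"
  shows "(LINT s|lborel. indicator {t<..} s * ((T - s) * g s))\<^sup>2 \<le> T ^ 3 * (LINT s|lborel. (g s)\<^sup>2)"
proof -
  have i: "integrable lborel (\<lambda>s. \<bar>g s\<bar>)" "integrable lborel (\<lambda>s. (T - s) * g s)"
    using sqint_integrable[OF g] sqint_integrable[OF sqint_weight[OF g]] by auto
  have b: "\<bar>(T - s) * g s\<bar> \<le> T * \<bar>g s\<bar>" for s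
    using g by (cases "s \<in> {0<..<T}") (auto simp: sqint_def abs_mult intro!: mult_right_mono)
  have "\<bar>LINT s|lborel. indicator {t<..} s * ((T - s) * g s)\<bar> \<le> (LINT s|lborel. T * \<bar>g s\<bar>)"
    by (rule order_trans[OF integral_abs_bound])
      (use i b order_trans[OF abs_ge_zero b] in
        \<open>intro integral_mono integrable_abs integrable_real_mult_indicator_left; auto simp: indicator_def\<close>)
  then have "(LINT s|lborel. indicator {t<..} s * ((T - s) * g s))\<^sup>2 \<le> (T * (LINT s|lborel. \<bar>g s\<bar>))\<^sup>2"
    by (intro abs_le_square_iff[THEN iffD1]) (simp add: abs_of_nonneg assms(2) less_imp_le)
  also have "\<dots> \<le> T\<^sup>2 * (T * (LINT s|lborel. (g s)\<^sup>2))"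
    using L1_le_L2_interval[OF assms] unfolding power_mult_distrib by (intro mult_left_mono) auto
  finally show ?thesis by (simp add: power3_eq_cube power2_eq_square mult.assoc)
qed

lemma Omega_sets [measurable]: "Omega L T \<in> sets borel"
  unfolding Omega_def by (intro borel_open open_Times) auto

lemma Omega_bounded: "bounded (Omega L T)"
  unfolding Omega_def by (intro bounded_Times) auto

lemma sqint_sections:
  assumes f: "sqint (Omega L T) f"
  shows "AE x in lborel. sqint {0<..<T} (\<lambda>t. f (x, t))"
    and "integrable lborel (\<lambda>x. LINT t|lborel. (f (x, t))\<^sup>2)"
    and "(LINT x|lborel. LINT t|lborel. (f (x, t))\<^sup>2) = (LINT p|lborel. (f p)\<^sup>2)"
proof -
  have i: "integrable lborel (\<lambda>p. (f p)\<^sup>2)" using f by (simp add: sqint_def)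
  note [measurable] = sqint_measurable[OF f]
  show "AE x in lborel. sqint {0<..<T} (\<lambda>t. f (x, t))"
    using plane_Fubini(1)[OF i]
    by eventually_elim (use f in \<open>auto simp: sqint_def Omega_def\<close>)
  show "integrable lborel (\<lambda>x. LINT t|lborel. (f (x, t))\<^sup>2)"
    "(LINT x|lborel. LINT t|lborel. (f (x, t))\<^sup>2) = (LINT p|lborel. (f p)\<^sup>2)"
    using plane_Fubini(3,5)[OF i] by simp_all
qed

text \<open>On almost every line the sectional bound holds for all \<open>t\<close> at once. It
  therefore controls the trace at a fixed time, in particular at \<open>t = 0\<close>, where the
  initial velocity is paired with the test function, and not only the integral over Omega.\<close>

lemma tail_L2:
  assumes f: "sqint (Omega L T) f" and "T > 0"
  shows "tail T f \<in> L2 (Omega L T)"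
    and "integrable lborel (\<lambda>x. (tail T f (x, t))\<^sup>2)"
    and "(LINT x|lborel. (tail T f (x, t))\<^sup>2) \<le> T ^ 3 * (LINT p|lborel. (f p)\<^sup>2)"
proof -
  note [measurable] = sqint_measurable[OF f]
  let ?N = "\<lambda>x. T ^ 3 * (LINT t|lborel. (f (x, t))\<^sup>2)"
  have N: "integrable lborel ?N" "(LINT x|lborel. ?N x) = T ^ 3 * (LINT p|lborel. (f p)\<^sup>2)"
    using sqint_sections(2,3)[OF f] by simp_all
  have b: "AE x in lborel. \<forall>t. (tail T f (x, t))\<^sup>2 \<le> ?N x"
    using sqint_sections(1)[OF f]
    by eventually_elim (use tail_section_bound assms(2) in \<open>auto simp: tail_def\<close>)
  have N0: "?N x \<ge> 0" for x using assms(2) by simp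
  show it: "integrable lborel (\<lambda>x. (tail T f (x, t))\<^sup>2)"
  proof (rule Bochner_Integration.integrable_bound[OF N(1)])
    show "AE x in lborel. norm ((tail T f (x, t))\<^sup>2) \<le> norm (?N x)"
      using b by eventually_elim (use N0 in auto)
  qed measurable
  show "(LINT x|lborel. (tail T f (x, t))\<^sup>2) \<le> T ^ 3 * (LINT p|lborel. (f p)\<^sup>2)"
    unfolding N(2)[symmetric]
    by (rule integral_mono_AE[OF it N(1)]) (use b in \<open>auto elim: eventually_mono\<close>)
  let ?F = "\<lambda>p. indicator (Omega L T) p * (tail T f p)\<^sup>2"
  have s: "AE x in lborel. integrable lborel (\<lambda>t. ?F (x, t)) \<and> (LINT t|lborel. \<bar>?F (x, t)\<bar>) \<le> ?N x * T"
    using b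
  proof eventually_elim
    case (elim x)
    have i: "integrable lborel (\<lambda>t. ?N x * indicator {0<..<T} t)" by simp
    have le: "\<bar>?F (x, t)\<bar> \<le> ?N x * indicator {0<..<T} t" for t
      using elim N0[of x] by (auto simp: indicator_def Omega_def)
    have F: "integrable lborel (\<lambda>t. ?F (x, t))"
      by (rule Bochner_Integration.integrable_bound[OF i]) (use le in \<open>auto intro!: AE_I2 order_trans[OF _ abs_ge_self] simp del: abs_mult abs_power2 abs_indicator\<close>)
    have "(LINT t|lborel. \<bar>?F (x, t)\<bar>) \<le> (LINT t|lborel. ?N x * indicator {0<..<T} t)"
      by (intro integral_mono i integrable_abs F le)
    then show ?case using F assms(2) by simp
  qed
  have "integrable lborel ?F"
  proof (rule plane_integrable)
    show "AE x in lborel. integrable lborel (\<lambda>t. ?F (x, t))" using s by (auto elim: eventually_mono)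
    show "integrable lborel (\<lambda>x. LINT t|lborel. \<bar>?F (x, t)\<bar>)"
    proof (rule Bochner_Integration.integrable_bound)
      show "integrable lborel (\<lambda>x. ?N x * T)" using N(1) by (rule integrable_mult_left)
      show "AE x in lborel. norm (LINT t|lborel. \<bar>?F (x, t)\<bar>) \<le> norm (?N x * T)"
        using s by eventually_elim (use N0 assms(2) in auto)
    qed measurable
  qed measurable
  then show "tail T f \<in> L2 (Omega L T)"
    by (simp add: L2_borel_iff)
qed

subsection \<open>Forward time integrals and quadratic identities\<close>

lemma integrable_tensor:
  fixes g h :: "real \<Rightarrow> real"
  assumes "integrable lborel g" "integrable lborel h"
  shows "integrable lborel (\<lambda>p. g (fst p) * h (snd p))"
proof (rule plane_integrable)
  have [measurable]: "g \<in> borel_measurable borel" "h \<in> borel_measurable borel"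
    using assms by auto
  show "(\<lambda>p. g (fst p) * h (snd p)) \<in> borel_measurable borel" by measurable
  show "integrable lborel (\<lambda>x. LINT t|lborel. \<bar>g (fst (x, t)) * h (snd (x, t))\<bar>)"
    using assms by (simp add: abs_mult)
qed (use assms in simp)

lemma integrable_plane_bounded:
  fixes F :: "real \<times> real \<Rightarrow> real"
  assumes "F \<in> borel_measurable borel" "integrable lborel g" "integrable lborel h"
    "\<And>x t. \<bar>F (x, t)\<bar> \<le> \<bar>g x * h t\<bar>"
  shows "integrable lborel F"
  by (rule Bochner_Integration.integrable_bound[OF integrable_tensor[OF assms(2,3)]])
    (use assms in auto)

lemma integral_lessThan_FTC:
  fixes I q :: "real \<Rightarrow> real"
  assumes "\<And>t. (I has_real_derivative q t) (at t)" "continuous_on UNIV q"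
    "\<And>t. t \<le> a \<Longrightarrow> q t = 0" "a \<le> s"
  shows "(LINT t|lborel. indicator {..<s} t * q t) = I s - I a"
proof -
  have "(LINT t|lborel. indicator {..<s} t * q t) = (LINT t|lborel. q t * indicator {a..s} t)"
  proof (rule integral_cong_AE)
    show "AE t in lborel. indicator {..<s} t * q t = q t * indicator {a..s} t"
      using AE_lborel_singleton[of s]
      by eventually_elim (use assms(3) in \<open>auto simp: indicator_def not_le\<close>)
  qed (use borel_measurable_continuous_onI[OF assms(2)] in measurable)
  also have "\<dots> = I s - I a"
    using assms by (intro integral_FTC_Icc_real) (auto simp: continuous_on_eq_continuous_at)
  finally show ?thesis .
qed

text \<open>For \<open>g\<close> vanishing outside \<open>(0, T)\<close> this is the primitive of
  \<open>g\<close> starting at time \<open>0\<close>. Integrating from minus infinity avoids case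
  distinctions at \<open>0\<close>.\<close>

definition head :: "(real \<Rightarrow> real) \<Rightarrow> real \<Rightarrow> real" where
  "head g s = (LINT t|lborel. indicator {..<s} t * g t)"

lemma head_measurable [measurable]:
  assumes [measurable]: "g \<in> borel_measurable borel"
  shows "head g \<in> borel_measurable borel"
proof -
  have "(\<lambda>s. LINT t|lborel. (if t < s then g t else 0)) \<in> borel_measurable borel"
    by (intro lborel.borel_measurable_lebesgue_integral) measurable
  moreover have "indicator {..<s} t * c = (if t < s then c else 0)" for t s c :: real
    by simp
  ultimately show ?thesis unfolding head_def by simp
qed

lemma head_bound:
  assumes "integrable lborel g"
  shows "\<bar>head g s\<bar> \<le> (LINT t|lborel. \<bar>g t\<bar>)"
  unfolding head_def
  by (rule order_trans[OF integral_abs_bound])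
    (use assms in \<open>intro integral_mono integrable_abs integrable_real_mult_indicator_left; auto simp: indicator_def\<close>)

lemma integrable_mult_head:
  assumes g: "integrable lborel g"
  shows "integrable lborel (\<lambda>t. g t * head g t)"
proof -
  have [measurable]: "g \<in> borel_measurable borel" using g by auto
  show ?thesis
  proof (rule Bochner_Integration.integrable_bound)
    show "integrable lborel (\<lambda>t. g t * (LINT t|lborel. \<bar>g t\<bar>))" using g by simp
    show "AE t in lborel. norm (g t * head g t) \<le> norm (g t * (LINT t|lborel. \<bar>g t\<bar>))"
      using head_bound[OF g] by (auto simp: abs_mult intro!: AE_I2 mult_left_mono)
  qed measurable
qed

text \<open>Here \<open>head g\<close> is only an indefinite Lebesgue integral; Fubini's theorem on the two triangles
  replaces the chain rule \<open>((head g)\<^sup>2)' = 2 g head g\<close>.\<close>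

lemma head_square:
  assumes g: "integrable lborel g"
  shows "(head g s)\<^sup>2 = 2 * (LINT t|lborel. indicator {..<s} t * (g t * head g t))"
proof -
  have [measurable]: "g \<in> borel_measurable borel" using g by auto
  define P where "P = (\<lambda>p::real \<times> real. (if fst p < s \<and> snd p < fst p then g (fst p) * g (snd p) else 0))"
  define Q where "Q = (\<lambda>p::real \<times> real. (if snd p < s \<and> fst p < snd p then g (fst p) * g (snd p) else 0))"
  have QP: "Q (t, \<tau>) = P (\<tau>, t)" for t \<tau> by (simp add: P_def Q_def)
  have [measurable]: "P \<in> borel_measurable borel" "Q \<in> borel_measurable borel"
    unfolding P_def Q_def by measurable
  have P: "integrable lborel P"
    by (rule integrable_plane_bounded[OF _ g g]) (simp_all add: P_def)
  have Q: "integrable lborel Q"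
    by (rule integrable_plane_bounded[OF _ g g]) (simp_all add: Q_def)
  let ?A = "LINT t|lborel. indicator {..<s} t * (g t * head g t)"
  have P1: "(LINT \<tau>|lborel. P (t, \<tau>)) = indicator {..<s} t * (g t * head g t)" for t
  proof -
    have "P (t, \<tau>) = indicator {..<s} t * (g t * (indicator {..<t} \<tau> * g \<tau>))" for \<tau>
      by (auto simp: P_def indicator_def)
    then show ?thesis by (simp add: head_def)
  qed
  have "(LINT t|lborel. LINT \<tau>|lborel. Q (t, \<tau>)) = (LINT \<tau>|lborel. LINT t|lborel. Q (t, \<tau>))"
    using plane_Fubini(5,6)[OF Q] by simp
  then have Q1: "(LINT t|lborel. LINT \<tau>|lborel. Q (t, \<tau>)) = ?A"
    using P1 by (simp add: QP)
  have "AE t in lborel. indicator {..<s} t * g t * head g s = (LINT \<tau>|lborel. P (t, \<tau>)) + (LINT \<tau>|lborel. Q (t, \<tau>))"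
    using plane_Fubini(1)[OF P] plane_Fubini(1)[OF Q]
  proof eventually_elim
    case (elim t)
    have "indicator {..<s} t * g t * head g s = (LINT \<tau>|lborel. indicator {..<s} t * g t * (indicator {..<s} \<tau> * g \<tau>))"
      by (simp add: head_def)
    also have "\<dots> = (LINT \<tau>|lborel. P (t, \<tau>) + Q (t, \<tau>))"
    proof (rule integral_cong_AE)
      show "AE \<tau> in lborel. indicator {..<s} t * g t * (indicator {..<s} \<tau> * g \<tau>) = P (t, \<tau>) + Q (t, \<tau>)"
        \<comment> \<open>The triangles below and above the diagonal miss only the point
          \<open>\<tau> = t\<close> of this line.\<close>
        using AE_lborel_singleton[of t]
        by eventually_elim (auto simp: P_def Q_def)
    qed measurable
    also have "\<dots> = (LINT \<tau>|lborel. P (t, \<tau>)) + (LINT \<tau>|lborel. Q (t, \<tau>))"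
      using elim by simp
    finally show ?case .
  qed
  then have "(LINT t|lborel. indicator {..<s} t * g t * head g s)
      = (LINT t|lborel. (LINT \<tau>|lborel. P (t, \<tau>)) + (LINT \<tau>|lborel. Q (t, \<tau>)))"
    using plane_Fubini(3)[OF P] plane_Fubini(3)[OF Q] by (intro integral_cong_AE) auto
  also have "\<dots> = ?A + ?A"
    using plane_Fubini(3)[OF P] plane_Fubini(3)[OF Q] Q1 by (simp add: P1)
  finally show ?thesis by (simp add: head_def power2_eq_square)
qed

lemma sqint_Ioo_integrable: "sqint {a<..<b::real} g \<Longrightarrow> integrable lborel g"
  by (rule sqint_integrable) auto

text \<open>Integrate \<open>head_square\<close> over \<open>s\<close> in \<open>(0, T)\<close> and
  exchange the integrals: for fixed \<open>t\<close>, the variable \<open>s\<close> runs through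
  \<open>(t, T)\<close>, whose length is the weight \<open>T - t\<close>.\<close>

lemma integral_weight_head:
  assumes g: "sqint {0<..<T} g"
  shows "(LINT t|lborel. (T - t) * (g t * head g t)) = (LINT s|lborel. indicator {0<..<T} s * (head g s)\<^sup>2) / 2"
proof -
  note gi = sqint_Ioo_integrable[OF g]
  note [measurable] = sqint_measurable[OF g]
  let ?F = "\<lambda>p. (if 0 < fst p \<and> fst p < T \<and> snd p < fst p then g (snd p) * head g (snd p) else 0)"
  have "?F \<in> borel_measurable borel" by measurable
  then have F: "integrable lborel ?F"
    by (rule integrable_plane_bounded[OF _ integrable_indicator_Ioo[of 0 T] integrable_mult_head[OF gi]]) simp
  have "(LINT s|lborel. indicator {0<..<T} s * (head g s)\<^sup>2) = 2 * (LINT s|lborel. LINT t|lborel. ?F (s, t))"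
  proof -
    have "?F (s, t) = indicator {0<..<T} s * (indicator {..<s} t * (g t * head g t))" for s t
      by (auto simp: indicator_def)
    then have "(LINT t|lborel. ?F (s, t)) = indicator {0<..<T} s * (LINT t|lborel. indicator {..<s} t * (g t * head g t))" for s
      by (simp only: integral_mult_right_zero)
    then have "indicator {0<..<T} s * (head g s)\<^sup>2 = 2 * (LINT t|lborel. ?F (s, t))" for s
      by (simp only: head_square[OF gi] mult.left_commute)
    then show ?thesis by (simp only: integral_mult_right_zero)
  qed
  also have "(LINT s|lborel. LINT t|lborel. ?F (s, t)) = (LINT t|lborel. LINT s|lborel. ?F (s, t))"
    using plane_Fubini(5,6)[OF F] by simp
  also have "\<dots> = (LINT t|lborel. (T - t) * (g t * head g t))"
  proof (rule Bochner_Integration.integral_cong[OF refl])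
    fix t
    show "(LINT s|lborel. ?F (s, t)) = (T - t) * (g t * head g t)"
    proof (cases "t \<in> {0<..<T}")
      case True
      then have "?F (s, t) = indicator {t<..<T} s * (g t * head g t)" for s by (auto simp: indicator_def)
      then show ?thesis using True by simp
    next
      case False
      then have "g t = 0" using g by (simp add: sqint_def)
      then have "?F (s, t) = 0" for s by simp
      then show ?thesis using \<open>g t = 0\<close> by (simp only: Bochner_Integration.integral_zero mult_zero_left mult_zero_right)
    qed
  qed
  finally show ?thesis by simp
qed

text \<open>Exchanging the integrals turns the backward integral of the second factor into the
  forward integral \<open>head g\<close> of the first, which reduces the claim to
  \<open>integral_weight_head\<close>. This is where the stiffness term becomes a square.\<close>

lemma integral_mult_tail:
  assumes g: "sqint {0<..<T} g"
  shows "(LINT t|lborel. g t * (LINT s|lborel. indicator {t<..} s * ((T - s) * g s)))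
    = (LINT s|lborel. indicator {0<..<T} s * (head g s)\<^sup>2) / 2"
proof -
  note gi = sqint_Ioo_integrable[OF g]
  note hi = sqint_Ioo_integrable[OF sqint_weight[OF g]]
  note [measurable] = sqint_measurable[OF g]
  let ?F = "\<lambda>p. (if fst p < snd p then g (fst p) * ((T - snd p) * g (snd p)) else 0)"
  have "?F \<in> borel_measurable borel" by measurable
  then have F: "integrable lborel ?F"
    by (rule integrable_plane_bounded[OF _ gi hi]) simp
  have "(LINT t|lborel. g t * (LINT s|lborel. indicator {t<..} s * ((T - s) * g s))) = (LINT t|lborel. LINT s|lborel. ?F (t, s))"
  proof -
    have "?F (t, s) = g t * (indicator {t<..} s * ((T - s) * g s))" for t s by simp
    then show ?thesis by simp
  qed
  also have "\<dots> = (LINT s|lborel. LINT t|lborel. ?F (t, s))"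
    using plane_Fubini(5,6)[OF F] by simp
  also have "\<dots> = (LINT s|lborel. (T - s) * (g s * head g s))"
  proof -
    have "?F (t, s) = (T - s) * (g s * (indicator {..<s} t * g t))" for t s by simp
    then show ?thesis by (simp add: head_def)
  qed
  finally show ?thesis using integral_weight_head[OF g] by simp
qed

subsection \<open>Weak derivatives of the backward integral\<close>

lemma cutoff_has_derivative: "\<exists>D. (cutoff a b n has_real_derivative D) (at x)"
  unfolding cutoff_def
  by (rule exI) (rule derivative_eq_intros DERIV_chain2[OF flat_has_derivative] refl)+

text \<open>The factor \<open>c\<close> depends on time alone, so its term in the product rule
  vanishes in direction \<open>(1, 0)\<close>.\<close>

lemma partial_deriv_x_tensor:
  fixes f :: "real \<times> real \<Rightarrow> real"
  assumes "smooth f" "\<And>s. \<exists>D. (c has_real_derivative D) (at s)"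
  shows "partial_deriv (1, 0) (\<lambda>p. f (fst p, t) * c (snd p)) = (\<lambda>p. partial_deriv (1, 0) f (fst p, t) * c (snd p))"
proof
  fix p :: "real \<times> real"
  obtain D where D: "(c has_real_derivative D) (at (snd p))" using assms(2) by blast
  have "((\<lambda>p. c (snd p)) has_derivative (\<lambda>b. D * snd b)) (at p)"
    using has_derivative_compose[OF bounded_linear_imp_has_derivative[OF bounded_linear_snd]
        D[unfolded has_field_derivative_def]] .
  from partial_deriv_eq[OF has_derivative_mult[OF slice_has_derivative[OF assms(1), of t] this], of "(1, 0)"]
  show "partial_deriv (1, 0) (\<lambda>p. f (fst p, t) * c (snd p)) p = partial_deriv (1, 0) f (fst p, t) * c (snd p)"
    by simp
qed

lemma iterated_deriv_x_tensor:
  fixes f :: "real \<times> real \<Rightarrow> real"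
  assumes "smooth f" "\<And>s. \<exists>D. (c has_real_derivative D) (at s)"
  shows "iterated_deriv (replicate n (1, 0)) (\<lambda>p. f (fst p, t) * c (snd p))
    = (\<lambda>p. iterated_deriv (replicate n (1, 0)) f (fst p, t) * c (snd p))"
proof (induction n)
  case (Suc n)
  have "smooth (iterated_deriv (replicate n (1, 0)) f)"
    by (rule smooth_iterated_deriv[OF assms(1)]) (auto simp: Basis_plane)
  then show ?case
    using Suc by (simp add: iterated_deriv_Cons partial_deriv_x_tensor assms(2))
qed simp

lemma test_functionI:
  assumes "smooth_gen \<phi>" "compact K" "K \<subseteq> S" "\<And>p. p \<notin> K \<Longrightarrow> \<phi> p = 0"
  shows "\<phi> \<in> test_functions S"
proof -
  have "closure {p. \<phi> p \<noteq> 0} \<subseteq> K"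
    using assms by (intro closure_minimal) (auto simp: compact_imp_closed)
  moreover from this have "compact (closure {p. \<phi> p \<noteq> 0})"
    using assms(2) by (metis closed_closure compact_Int_closed inf.absorb_iff2)
  ultimately show ?thesis
    using assms by (auto simp: test_functions_def smooth_gen_smooth)
qed

text \<open>Freezing the time of \<phi> destroys compact support in time; the cutoff restores it.
  The weight \<open>T - s\<close> of \<open>tail\<close> is built into the test function.\<close>

lemma test_function_slice:
  assumes \<phi>: "\<phi> \<in> test_functions (Omega L T)" and ab: "0 < a" "b < T"
  shows "(\<lambda>p. \<phi> (fst p, t) * ((T - snd p) * cutoff a b n (snd p))) \<in> test_functions (Omega L T)"
proof (rule test_functionI)
  let ?K = "closure {p. \<phi> p \<noteq> 0}"
  have K: "smooth \<phi>" "compact ?K" "?K \<subseteq> Omega L T" using \<phi> by (auto simp: test_functions_def)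
  have "smooth_gen (\<lambda>p. \<phi> (fst p, t) * ((T + (-1) * snd p) * cutoff a b n (snd p)))"
    by (intro smooth_gen.mult smooth_gen.slice smooth_gen.add smooth_gen.const smooth_gen.snd smooth_gen_cutoff K)
  then show "smooth_gen (\<lambda>p. \<phi> (fst p, t) * ((T - snd p) * cutoff a b n (snd p)))" by simp
  \<comment> \<open>The compact set is the projection of the support of \<phi> to the
    \<open>x\<close> axis, times the time interval of the cutoff.\<close>
  show "compact (fst ` ?K \<times> {a..b})"
    using K by (intro compact_Times compact_continuous_image continuous_intros) auto
  show "fst ` ?K \<times> {a..b} \<subseteq> Omega L T"
    using K(3) ab by (auto simp: Omega_def)
  show "\<phi> (fst p, t) * ((T - snd p) * cutoff a b n (snd p)) = 0" if "p \<notin> fst ` ?K \<times> {a..b}" for p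
  proof (cases "snd p \<in> {a..b}")
    case True
    then have "fst p \<notin> fst ` ?K" using that by (metis mem_Times_iff)
    then have "(fst p, t) \<notin> ?K" by (metis fst_conv image_eqI)
    moreover have "{p. \<phi> p \<noteq> 0} \<subseteq> ?K" by (rule closure_subset)
    ultimately show ?thesis by auto
  next
    case False
    then have "cutoff a b n (snd p) = 0" by (intro cutoff_outside) auto
    then show ?thesis by simp
  qed
qed

lemma integrable_tail_mult:
  assumes F: "sqint (Omega L T) F" and h: "sqint (Omega L T) h" and "T > 0"
  shows "integrable lborel (\<lambda>p. tail T F p * h p)"
proof -
  note [measurable] = sqint_measurable[OF F] sqint_measurable[OF h]
  \<comment> \<open>\<open>tail T F\<close> itself need not vanish for \<open>t < 0\<close>, so it
    is first cut off to Omega; since \<open>h\<close> vanishes outside, the product does not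
    change.\<close>
  have "sqint (Omega L T) (\<lambda>p. indicator (Omega L T) p * tail T F p)"
  proof -
    have "(\<lambda>p. (indicator (Omega L T) p * tail T F p)\<^sup>2) = (\<lambda>p. indicator (Omega L T) p * (tail T F p)\<^sup>2)"
      by (auto simp: indicator_def fun_eq_iff)
    then show ?thesis
      using tail_L2(1)[OF F \<open>T > 0\<close>] by (simp add: sqint_def L2_borel_iff)
  qed
  from sqint_mult_integrable[OF this h]
  have "integrable lborel (\<lambda>p. indicator (Omega L T) p * tail T F p * h p)" .
  moreover have "(\<lambda>p. indicator (Omega L T) p * tail T F p * h p) = (\<lambda>p. tail T F p * h p)"
    using h by (auto simp: sqint_def indicator_def fun_eq_iff)
  ultimately show ?thesis by simp
qed

text \<open>For a fixed time \<open>t\<close>, test the weak derivative of \<open>f\<close> with \<open>\<phi>(x, t) (T - s) \<chi>(s)\<close> and let the cutoff \<open>\<chi>\<close>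
  tend to the indicator of \<open>(t, T)\<close>; then integrate over \<open>t\<close>.\<close>

lemma tail_weak_x:
  fixes L T :: real and n :: nat
  defines "bs \<equiv> replicate n (1, 0)"
  assumes w: "has_weak_deriv (Omega L T) bs f g" and f: "sqint (Omega L T) f" and g: "sqint (Omega L T) g" and "T > 0"
  shows "has_weak_deriv (Omega L T) bs (tail T f) (tail T g)"
proof -
  have bs: "set bs \<subseteq> Basis" by (auto simp: bs_def Basis_plane)
  note [measurable] = sqint_measurable[OF f] sqint_measurable[OF g]
  have w': "(LINT p|lborel. f p * iterated_deriv bs \<phi> p) = (-1) ^ n * (LINT p|lborel. g p * \<phi> p)"
    if "\<phi> \<in> test_functions (Omega L T)" for \<phi>
    using w that bs f g by (simp add: has_weak_deriv_borel_iff sqint_measurable) (simp add: bs_def)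
  have slice: "(LINT x|lborel. tail T f (x, t) * iterated_deriv bs \<phi> (x, t))
      = (-1) ^ n * (LINT x|lborel. tail T g (x, t) * \<phi> (x, t))"
    if p: "\<phi> \<in> test_functions (Omega L T)" for \<phi> t
  proof (cases "t \<in> {0<..<T}")
    case False
    then have "(x, t) \<notin> Omega L T" for x by (auto simp: Omega_def)
    then have "iterated_deriv bs \<phi> (x, t) = 0" "\<phi> (x, t) = 0" for x
      using test_function_properties(2)[OF p bs] test_function_properties(2)[OF p, of "[]"] by auto
    then show ?thesis by simp
  next
    case True
    \<comment> \<open>The cutoffs live between \<open>A m\<close> and \<open>B m\<close>, strictly
      inside \<open>(t, T)\<close>. For small \<open>m\<close> that interval may be empty; the test
      function is then zero.\<close>
    define A where "A = (\<lambda>m. t + 1 / real (Suc m))"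
    define B where "B = (\<lambda>m. T - 1 / real (Suc m))"
    have "(\<lambda>m. 1 / real (Suc m)) \<longlonglongrightarrow> 0"
      using LIMSEQ_inverse_real_of_nat by (simp add: inverse_eq_divide)
    from tendsto_add[OF tendsto_const[of t] this] tendsto_diff[OF tendsto_const[of T] this]
    have AB: "A \<longlonglongrightarrow> t" "B \<longlonglongrightarrow> T" "\<And>m. t \<le> A m" "\<And>m. B m \<le> T" "\<And>m. 0 < A m" "\<And>m. B m < T"
      unfolding A_def B_def using True
      by (auto intro!: add_pos_pos)
    let ?c = "\<lambda>m s. (T - s) * cutoff (A m) (B m) m s"
    \<comment> \<open>Stated for general \<open>F\<close> and \<open>h\<close>, since it is applied
      to \<open>f\<close> with the derivative of \<phi> and to \<open>g\<close> with \<phi>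
      itself.\<close>
    have lim: "(\<lambda>m. LINT p|lborel. F p * (h (fst p, t) * ?c m (snd p)))
        \<longlonglongrightarrow> (LINT x|lborel. tail T F (x, t) * h (x, t))"
      if F: "sqint (Omega L T) F" and h: "continuous_on UNIV h" and bd: "\<And>p. \<bar>h p\<bar> \<le> C" for F h C
    proof -
      note [measurable] = sqint_measurable[OF F] borel_measurable_continuous_onI[OF h]
        borel_measurable_continuous_onI[OF continuous_cutoff]
      have hs [measurable]: "(\<lambda>p. h (fst p, t)) \<in> borel_measurable borel"
        by (intro borel_measurable_continuous_onI continuous_on_compose2[OF h] continuous_intros) auto
      let ?G = "\<lambda>p. F p * (h (fst p, t) * ((T - snd p) * indicator {t<..<T} (snd p)))"
      \<comment> \<open>\<open>C\<close> bounds \<open>h\<close>, and \<open>T\<close> bounds the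
        weight wherever \<open>F\<close> is nonzero.\<close>
      let ?dom = "\<lambda>p. C * T * \<bar>F p\<bar>"
      have dom: "integrable lborel ?dom"
        using sqint_integrable[OF F Omega_bounded Omega_sets] by simp
      have C: "C \<ge> 0" using bd[of undefined] by simp
      have le: "\<bar>F p * (h (fst p, t) * ((T - snd p) * c))\<bar> \<le> ?dom p" if "0 \<le> c" "c \<le> 1" for c p
      proof (cases "p \<in> Omega L T")
        case True
        then have "\<bar>(T - snd p) * c\<bar> \<le> T * 1"
          unfolding abs_mult using that by (intro mult_mono) (auto simp: Omega_def)
        then have "\<bar>h (fst p, t) * ((T - snd p) * c)\<bar> \<le> C * T"
          unfolding abs_mult[of "h _"] using bd C by (intro mult_mono) auto
        then show ?thesis
          unfolding abs_mult[of "F p"] by (metis abs_ge_zero mult.commute mult_left_mono)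
      next
        case False
        then have "F p = 0" using F unfolding sqint_def by blast
        then show ?thesis by simp
      qed
      have "(\<lambda>m. LINT p|lborel. F p * (h (fst p, t) * ?c m (snd p))) \<longlonglongrightarrow> (LINT p|lborel. ?G p)"
      proof (rule integral_dominated_convergence[where w="?dom"])
        show "AE p in lborel. (\<lambda>m. F p * (h (fst p, t) * ?c m (snd p))) \<longlonglongrightarrow> ?G p"
          by (intro AE_I2 tendsto_mult[OF tendsto_const] cutoff_tendsto[OF AB(1-4)])
        show "AE p in lborel. norm (F p * (h (fst p, t) * ?c m (snd p))) \<le> ?dom p" for m
          unfolding real_norm_def by (intro AE_I2 le cutoff_range)
      qed (use dom in measurable)
      moreover have "(LINT p|lborel. ?G p) = (LINT x|lborel. LINT s|lborel. ?G (x, s))"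
      proof (rule plane_Fubini(5))
        show "integrable lborel ?G"
        proof (rule Bochner_Integration.integrable_bound[OF dom])
          show "AE p in lborel. norm (?G p) \<le> norm (?dom p)"
            unfolding real_norm_def by (intro AE_I2 order_trans[OF le abs_ge_self]) (auto simp: indicator_def)
        qed measurable
      qed
      moreover have "(LINT s|lborel. ?G (x, s)) = tail T F (x, t) * h (x, t)" for x
      proof -
        \<comment> \<open>The upper limit \<open>T\<close> disappears because \<open>F\<close>
          vanishes from time \<open>T\<close> on.\<close>
        have "?G (x, s) = indicator {t<..} s * ((T - s) * F (x, s)) * h (x, t)" for s
          using F by (auto simp: indicator_def sqint_def Omega_def)
        then have "(LINT s|lborel. ?G (x, s)) = (LINT s|lborel. indicator {t<..} s * ((T - s) * F (x, s)) * h (x, t))"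
          by (intro Bochner_Integration.integral_cong refl)
        then show ?thesis by (simp add: tail_def)
      qed
      ultimately show ?thesis by simp
    qed
    have eq: "(LINT p|lborel. f p * (iterated_deriv bs \<phi> (fst p, t) * ?c m (snd p)))
       = (-1) ^ n * (LINT p|lborel. g p * (\<phi> (fst p, t) * ?c m (snd p)))" for m
    proof -
      let ?\<psi> = "\<lambda>p. \<phi> (fst p, t) * ?c m (snd p)"
      have c: "\<exists>D. ((\<lambda>s. ?c m s) has_real_derivative D) (at s)" for s
      proof -
        obtain D where D: "(cutoff (A m) (B m) m has_real_derivative D) (at s)"
          using cutoff_has_derivative[of "A m" "B m" m s] by blast
        show ?thesis by (rule exI) (rule derivative_eq_intros D refl)+
      qed
      have "smooth \<phi>" using p by (simp add: test_functions_def)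
      then have d: "iterated_deriv bs ?\<psi> = (\<lambda>p. iterated_deriv bs \<phi> (fst p, t) * ?c m (snd p))"
        unfolding bs_def using c by (rule iterated_deriv_x_tensor)
      have "?\<psi> \<in> test_functions (Omega L T)"
        by (rule test_function_slice[OF p AB(5,6)])
      from w'[OF this] show ?thesis unfolding d .
    qed
    obtain C1 where C1: "\<And>x. \<bar>iterated_deriv bs \<phi> x\<bar> \<le> C1"
      using test_function_properties(3)[OF p bs] by blast
    obtain C2 where C2: "\<And>x. \<bar>\<phi> x\<bar> \<le> C2"
      using test_function_properties(3)[OF p, of "[]"] unfolding iterated_deriv_Nil by auto
    have "(\<lambda>m. LINT p|lborel. f p * (iterated_deriv bs \<phi> (fst p, t) * ?c m (snd p)))
          \<longlonglongrightarrow> (LINT x|lborel. tail T f (x, t) * iterated_deriv bs \<phi> (x, t))"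
      "(\<lambda>m. LINT p|lborel. g p * (\<phi> (fst p, t) * ?c m (snd p)))
          \<longlonglongrightarrow> (LINT x|lborel. tail T g (x, t) * \<phi> (x, t))"
      by (rule lim[OF f test_function_properties(1)[OF p bs] C1])
        (rule lim[OF g test_function_properties(1)[OF p, of "[]", simplified] C2])
    from LIMSEQ_unique[OF this(1)[unfolded eq] tendsto_mult_left[OF this(2)]] show ?thesis .
  qed
  have full: "(LINT p|lborel. tail T F p * h p) = (LINT t|lborel. LINT x|lborel. tail T F (x, t) * h (x, t))"
    if F: "sqint (Omega L T) F" and h: "sqint (Omega L T) h" for F h
    by (rule plane_Fubini(6)[OF integrable_tail_mult[OF F h \<open>T > 0\<close>]])
  have sq: "sqint (Omega L T) (iterated_deriv cs \<phi>)" if "\<phi> \<in> test_functions (Omega L T)" "set cs \<subseteq> Basis" for \<phi> cs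
    using test_function_properties[OF that] by (simp add: sqint_def)
  show ?thesis
    using bs tail_L2(1)[OF f] tail_L2(1)[OF g] \<open>T > 0\<close> slice full[OF f sq[OF _ bs]] full[OF g sq[of _ "[]"]]
    by (subst has_weak_deriv_borel_iff) (auto simp: bs_def)
qed

text \<open>On almost every line, Fubini on the triangle \<open>t < s\<close> moves the integration
  onto the time derivative of the test function, and the fundamental theorem recovers \<phi>, which
  vanishes at time \<open>0\<close>.\<close>

lemma tail_weak_t:
  assumes f: "sqint (Omega L T) f" and "T > 0"
  shows "has_weak_deriv (Omega L T) [(0, 1)] (tail T f) (\<lambda>p. - ((T - snd p) * f p))"
proof -
  have bs: "set [(0, 1) :: real \<times> real] \<subseteq> Basis" by (auto simp: Basis_plane)
  note [measurable] = sqint_measurable[OF f]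
  have wf: "sqint (Omega L T) (\<lambda>p. - (T - snd p) * f p)"
    by (rule sqint_bounded_mult[OF f, where C=T]) (auto simp: Omega_def)
  have "(LINT p|lborel. tail T f p * iterated_deriv [(0, 1)] \<phi> p)
      = - (LINT p|lborel. - ((T - snd p) * f p) * \<phi> p)" if p: "\<phi> \<in> test_functions (Omega L T)" for \<phi>
  proof -
    let ?q = "iterated_deriv [(0, 1)] \<phi>"
    note q = test_function_properties[OF p bs]
    note \<phi> = test_function_properties[OF p, of "[]", simplified]
    have sq: "sqint (Omega L T) ?q" "sqint (Omega L T) \<phi>" using q \<phi> by (simp_all add: sqint_def)
    have i: "integrable lborel (\<lambda>p. - (T - snd p) * f p * \<phi> p)"
      by (rule sqint_mult_integrable[OF wf sq(2)])
    have D: "((\<lambda>t. \<phi> (x, t)) has_real_derivative ?q (x, t)) (at t)" for x t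
    proof -
      have F: "(\<phi> has_derivative frechet_derivative \<phi> (at (x, t))) (at (x, t))"
        using p smooth_differentiable by (auto simp: test_functions_def frechet_derivative_works[symmetric])
      have "((\<lambda>t. (x, t)) has_derivative (\<lambda>h. (0, h))) (at t)" by (auto intro!: derivative_eq_intros)
      from has_derivative_compose[OF this F]
      have "((\<lambda>t. \<phi> (x, t)) has_derivative (\<lambda>h. frechet_derivative \<phi> (at (x, t)) (0, h))) (at t)" .
      moreover have "frechet_derivative \<phi> (at (x, t)) (0, h) = ?q (x, t) * h" for h
        using linear_scale[OF has_derivative_linear[OF F], of h "(0, 1)"]
        by (simp add: iterated_deriv_Cons partial_deriv_def)
      ultimately show ?thesis by (simp add: has_field_derivative_def)
    qed
    have sec: "(LINT t|lborel. tail T f (x, t) * ?q (x, t)) = (LINT s|lborel. (T - s) * f (x, s) * \<phi> (x, s))"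
      if x: "sqint {0<..<T} (\<lambda>t. f (x, t))" for x
    proof -
      let ?g = "\<lambda>s. (T - s) * f (x, s)"
      have g: "integrable lborel ?g" by (rule sqint_Ioo_integrable[OF sqint_weight[OF x]])
      have qc: "continuous_on UNIV (\<lambda>t. ?q (x, t))"
        by (intro continuous_on_compose2[OF q(1)] continuous_intros) auto
      have qz: "?q (x, t) = 0" if "t \<notin> {0<..<T}" for t
        using that by (intro q(2)) (auto simp: Omega_def)
      obtain C where C: "\<And>p. \<bar>?q p\<bar> \<le> C" using q(3) by blast
      note [measurable] = borel_measurable_continuous_onI[OF qc] sqint_measurable[OF x]
      have qi: "integrable lborel (\<lambda>t. ?q (x, t))"
      proof (rule Bochner_Integration.integrable_bound)
        show "integrable lborel (\<lambda>t. C * indicator {0<..<T} t)" by simp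
        show "AE t in lborel. norm (?q (x, t)) \<le> norm (C * indicator {0<..<T} t)"
          using C qz by (intro AE_I2) (auto simp: indicator_def intro: order_trans[OF _ abs_ge_self])
      qed measurable
      let ?F = "\<lambda>p. (if fst p < snd p then ?q (x, fst p) * ?g (snd p) else 0)"
      have "?F \<in> borel_measurable borel" by measurable
      then have F: "integrable lborel ?F"
        by (rule integrable_plane_bounded[OF _ qi g]) simp
      have "?F (t, s) = ?q (x, t) * (indicator {t<..} s * ?g s)" for t s by simp
      then have "(LINT t|lborel. tail T f (x, t) * ?q (x, t)) = (LINT t|lborel. LINT s|lborel. ?F (t, s))"
        by (simp only: integral_mult_right_zero tail_def fst_conv snd_conv mult.commute)
      also have "\<dots> = (LINT s|lborel. LINT t|lborel. ?F (t, s))"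
        using plane_Fubini(5,6)[OF F] by simp
      also have "\<dots> = (LINT s|lborel. ?g s * \<phi> (x, s))"
      proof (rule Bochner_Integration.integral_cong[OF refl])
        fix s
        have "?F (t, s) = ?g s * (indicator {..<s} t * ?q (x, t))" for t by simp
        then have "(LINT t|lborel. ?F (t, s)) = ?g s * (LINT t|lborel. indicator {..<s} t * ?q (x, t))"
          by (simp only: integral_mult_right_zero)
        also have "\<dots> = ?g s * \<phi> (x, s)"
        proof (cases "s \<in> {0<..<T}")
          case True
          have "(LINT t|lborel. indicator {..<s} t * ?q (x, t)) = \<phi> (x, s) - \<phi> (x, 0)"
            using True by (intro integral_lessThan_FTC D qc qz) auto
          moreover have "\<phi> (x, 0) = 0" by (intro \<phi>(2)) (auto simp: Omega_def)
          ultimately show ?thesis by simp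
        next
          case False
          then have "f (x, s) = 0" using x by (simp add: sqint_def)
          then show ?thesis by simp
        qed
        finally show "(LINT t|lborel. ?F (t, s)) = ?g s * \<phi> (x, s)" .
      qed
      finally show ?thesis .
    qed
    have it: "integrable lborel (\<lambda>p. tail T f p * ?q p)"
      by (rule integrable_tail_mult[OF f sq(1) \<open>T > 0\<close>])
    have "(LINT p|lborel. tail T f p * ?q p) = (LINT x|lborel. LINT t|lborel. tail T f (x, t) * ?q (x, t))"
      by (rule plane_Fubini(5)[OF it])
    also have "\<dots> = (LINT x|lborel. LINT s|lborel. - (- (T - s) * f (x, s) * \<phi> (x, s)))"
    proof (rule integral_cong_AE)
      show "AE x in lborel. (LINT t|lborel. tail T f (x, t) * ?q (x, t)) = (LINT s|lborel. - (- (T - s) * f (x, s) * \<phi> (x, s)))"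
        using sqint_sections(1)[OF f] by eventually_elim (simp only: sec minus_mult_left[symmetric] minus_minus)
    qed (use plane_Fubini(3)[OF it] plane_Fubini(3)[OF i] in auto)
    also have "\<dots> = - (LINT p|lborel. - (T - snd p) * f p * \<phi> p)"
      using plane_Fubini(5)[OF i] by simp
    finally show ?thesis by (simp only: minus_mult_left)
  qed
  moreover have "(\<lambda>p. - ((T - snd p) * f p)) \<in> L2 (Omega L T)"
    using sqint_L2[OF Omega_sets wf] by (simp only: minus_mult_left)
  ultimately show ?thesis
    using bs tail_L2(1)[OF f \<open>T > 0\<close>]
    by (subst has_weak_deriv_borel_iff) auto
qed

subsection \<open>Weak time derivatives on lines\<close>

definition rect_integral :: "(real \<times> real \<Rightarrow> real) \<Rightarrow> real \<Rightarrow> real \<Rightarrow> real \<Rightarrow> real \<Rightarrow> real" where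
  "rect_integral E a b c d = (LINT p|lborel. indicator {a<..<b} (fst p) * indicator {c<..<d} (snd p) * E p)"

lemma indicator_Ioo_tendsto:
  fixes a b x :: real
  assumes "A \<longlonglongrightarrow> a" "B \<longlonglongrightarrow> b" "\<And>n. a \<le> A n" "\<And>n. B n \<le> b"
  shows "(\<lambda>n. indicator {A n<..<B n} x :: real) \<longlonglongrightarrow> indicator {a<..<b} x"
proof (cases "x \<in> {a<..<b}")
  case True
  have "eventually (\<lambda>n. A n < x) sequentially" "eventually (\<lambda>n. x < B n) sequentially"
    using True order_tendstoD(2)[OF assms(1), of x] order_tendstoD(1)[OF assms(2), of x] by auto
  then have "eventually (\<lambda>n. indicator {A n<..<B n} x = (1::real)) sequentially"
    by eventually_elim simp
  then show ?thesis using True tendsto_eventually by simp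
next
  case False
  then have "indicator {A n<..<B n} x = (0::real)" for n
    using assms(3,4)[of n] by (auto simp: indicator_def)
  then show ?thesis using False by simp
qed

lemma rect_integral_tendsto:
  assumes E: "integrable lborel E"
    and "A \<longlonglongrightarrow> a" "B \<longlonglongrightarrow> b" "\<And>n. a \<le> A n" "\<And>n. B n \<le> b"
    and "C \<longlonglongrightarrow> c" "D \<longlonglongrightarrow> d" "\<And>n. c \<le> C n" "\<And>n. D n \<le> d"
  shows "(\<lambda>n. rect_integral E (A n) (B n) (C n) (D n)) \<longlonglongrightarrow> rect_integral E a b c d"
  unfolding rect_integral_def
proof (rule integral_dominated_convergence[where w="\<lambda>p. \<bar>E p\<bar>"])
  have [measurable]: "E \<in> borel_measurable borel" using E by auto
  show "AE p in lborel. (\<lambda>n. indicator {A n<..<B n} (fst p) * indicator {C n<..<D n} (snd p) * E p)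
      \<longlonglongrightarrow> indicator {a<..<b} (fst p) * indicator {c<..<d} (snd p) * E p"
    by (intro AE_I2 tendsto_mult[OF tendsto_mult tendsto_const] indicator_Ioo_tendsto assms)
  show "AE p in lborel. norm (indicator {A n<..<B n} (fst p) * indicator {C n<..<D n} (snd p) * E p) \<le> \<bar>E p\<bar>" for n
    by (auto simp: indicator_def)
  show "integrable lborel (\<lambda>p. \<bar>E p\<bar>)" using E by simp
  show "(\<lambda>p. indicator {a<..<b} (fst p) * indicator {c<..<d} (snd p) * E p) \<in> borel_measurable lborel"
    "\<And>n. (\<lambda>p. indicator {A n<..<B n} (fst p) * indicator {C n<..<D n} (snd p) * E p) \<in> borel_measurable lborel"
    by measurable
qed

text \<open>Test functions only see rectangles compactly inside Omega. Limits from inside give all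
  rectangles, since \<open>E\<close> vanishes off Omega. Boxes are stable under intersection and
  generate the Borel sets, so the integral of \<open>E\<close> over every Borel set is zero.\<close>

lemma AE_zero_if_rect_integrals:
  assumes E: "integrable lborel E" and out: "\<And>p. p \<notin> Omega L T \<Longrightarrow> E p = 0"
    and rect: "\<And>a b c d. 0 < a \<Longrightarrow> b < L \<Longrightarrow> 0 < c \<Longrightarrow> d < T \<Longrightarrow> rect_integral E a b c d = 0"
  shows "AE p in lborel. E p = 0"
proof -
  have [measurable]: "E \<in> borel_measurable borel" using E by auto
  have lim: "(\<lambda>n. 1 / real (Suc n)) \<longlonglongrightarrow> 0"
    using LIMSEQ_inverse_real_of_nat by (simp add: inverse_eq_divide)
  have r0: "rect_integral E a b c d = 0" for a b c d
  proof -
    \<comment> \<open>The rectangle is clipped to Omega and then shrunk by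
      \<open>1 / (n + 1)\<close>, which separates it from the boundary.\<close>
    let ?A = "\<lambda>n. max a 0 + 1 / real (Suc n)" and ?B = "\<lambda>n. min b L - 1 / real (Suc n)"
      and ?C = "\<lambda>n. max c 0 + 1 / real (Suc n)" and ?D = "\<lambda>n. min d T - 1 / real (Suc n)"
    have "(\<lambda>n. rect_integral E (?A n) (?B n) (?C n) (?D n))
        \<longlonglongrightarrow> rect_integral E (max a 0) (min b L) (max c 0) (min d T)"
    proof (rule rect_integral_tendsto[OF E])
      show "?A \<longlonglongrightarrow> max a 0" "?C \<longlonglongrightarrow> max c 0"
        using tendsto_add[OF tendsto_const lim] by auto
      show "?B \<longlonglongrightarrow> min b L" "?D \<longlonglongrightarrow> min d T"
        using tendsto_diff[OF tendsto_const lim] by auto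
      show "?B n \<le> min b L" "?D n \<le> min d T" for n
        by (simp_all del: min.bounded_iff)
    qed auto
    moreover have "rect_integral E (?A n) (?B n) (?C n) (?D n) = 0" for n
    proof (rule rect)
      have "1 / real (Suc n) > 0" "0 \<le> max a 0" "0 \<le> max c 0" "min b L \<le> L" "min d T \<le> T" by auto
      then show "0 < ?A n" "?B n < L" "0 < ?C n" "?D n < T" by linarith+
    qed
    ultimately have "(\<lambda>n. 0) \<longlonglongrightarrow> rect_integral E (max a 0) (min b L) (max c 0) (min d T)"
      by (simp only:)
    then have "rect_integral E (max a 0) (min b L) (max c 0) (min d T) = 0"
      by (simp only: LIMSEQ_const_iff)
    have "indicator {max a 0<..<min b L} (fst p) * indicator {max c 0<..<min d T} (snd p) * E p
        = indicator {a<..<b} (fst p) * indicator {c<..<d} (snd p) * E p" for p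
    proof (cases "p \<in> Omega L T")
      case True
      then show ?thesis by (auto simp: indicator_def Omega_def)
    qed (simp add: out)
    then have "rect_integral E (max a 0) (min b L) (max c 0) (min d T) = rect_integral E a b c d"
      unfolding rect_integral_def by (intro Bochner_Integration.integral_cong refl)
    with \<open>rect_integral E (max a 0) (min b L) (max c 0) (min d T) = 0\<close> show ?thesis by simp
  qed
  \<comment> \<open>The total integral is what the complement step of the induction over the
    generated sigma-algebra requires.\<close>
  have tot: "(LINT p|lborel. E p) = 0"
  proof -
    have "E p = indicator {0<..<L} (fst p) * indicator {0<..<T} (snd p) * E p" for p
    proof (cases "p \<in> Omega L T")
      case True
      then show ?thesis by (auto simp: indicator_def Omega_def)
    qed (simp add: out)
    then have "(LINT p|lborel. E p) = rect_integral E 0 L 0 T"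
      unfolding rect_integral_def by (intro Bochner_Integration.integral_cong refl)
    then show ?thesis using r0 by simp
  qed
  let ?G = "range (\<lambda>(a, b). box a b :: (real \<times> real) set)"
  have borel: "sets borel = sigma_sets UNIV ?G" by (subst borel_eq_box) simp
  have sub: "?G \<subseteq> Pow UNIV" by simp
  have stable: "Int_stable ?G"
  proof (rule Int_stableI_image)
    fix i j :: "(real \<times> real) \<times> (real \<times> real)"
    show "\<exists>k\<in>UNIV. (case i of (a, b) \<Rightarrow> box a b) \<inter> (case j of (a, b) \<Rightarrow> box a b) = (case k of (a, b) \<Rightarrow> box a b)"
      by (cases i, cases j) (simp only: prod.case box_Int_box, intro bexI[OF _ UNIV_I], rule case_prod_conv[symmetric])
  qed
  have "set_lebesgue_integral lborel A E = 0" if "A \<in> sigma_sets UNIV ?G" for A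
    using stable sub that
  proof (induction rule: sigma_sets_induct_disjoint)
    case (basic A)
    then obtain a b where A: "A = box a b" by auto
    have "set_lebesgue_integral lborel A E = rect_integral E (fst a) (fst b) (snd a) (snd b)"
      unfolding set_lebesgue_integral_def rect_integral_def A
      by (intro Bochner_Integration.integral_cong refl) (auto simp: box_prod indicator_def)
    then show ?case using r0 by simp
  next
    case empty
    show ?case by (simp add: set_lebesgue_integral_def)
  next
    case (compl A)
    then have [measurable]: "A \<in> sets borel" using borel by simp
    have "integrable lborel (\<lambda>p. indicator A p * E p)"
      using E by (intro integrable_real_mult_indicator_left) auto
    moreover have "indicator (UNIV - A) p *\<^sub>R E p = E p - indicator A p * E p" for p
      by (auto simp: indicator_def)
    ultimately show ?case
      using compl(2) E tot by (simp add: set_lebesgue_integral_def)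
  next
    case (union A)
    then have A: "\<And>i. A i \<in> sets lborel" using borel by auto
    have "(LINT x:(\<Union>i. A i)|lborel. E x) = (\<Sum>i. (LINT x:(A i)|lborel. E x))"
    proof (rule lebesgue_integral_countable_add)
      show "set_integrable lborel (\<Union>i. A i) E"
        unfolding set_integrable_def using A E by (intro integrable_mult_indicator) auto
    qed (use A union in \<open>auto simp: disjoint_family_on_def\<close>)
    then show ?case using union by simp
  qed
  then show ?thesis
    using sigma_finite_measure.density_zero[OF sigma_finite_lborel E] borel by simp
qed

section \<open>Time primitives and test functions of product form\<close>

lemma continuous_antiderivative:
  fixes q :: "real \<Rightarrow> real"
  assumes "continuous_on UNIV q"
  obtains I where "\<And>t. (I has_real_derivative q t) (at t)" "I c = 0"
proof -
  have "\<exists>F. \<forall>x::real. -\<infinity> < ereal x \<longrightarrow> ereal x < \<infinity> \<longrightarrow> (F has_vector_derivative q x) (at x)"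
    using assms by (intro einterval_antiderivative) (auto simp: continuous_on_eq_continuous_at)
  then obtain F where "\<And>t. (F has_real_derivative q t) (at t)"
    by (auto simp: has_real_derivative_iff_has_vector_derivative)
  then have "((\<lambda>t. F t - F c) has_real_derivative q t) (at t)" for t
    by (auto intro!: derivative_eq_intros)
  then show ?thesis using that[of "\<lambda>t. F t - F c"] by simp
qed

text \<open>The bound is required only on almost every line because a primitive in time can be
  estimated only where the section is integrable.\<close>

lemma integrable_plane_bounded_AE:
  fixes F :: "real \<times> real \<Rightarrow> real"
  assumes [measurable]: "F \<in> borel_measurable borel" and g: "integrable lborel g" and h: "integrable lborel h"
    and b: "AE x in lborel. \<forall>t. \<bar>F (x, t)\<bar> \<le> g x * h t"
  shows "integrable lborel F"
proof (rule plane_integrable)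
  have "AE x in lborel. integrable lborel (\<lambda>t. F (x, t)) \<and> (LINT t|lborel. \<bar>F (x, t)\<bar>) \<le> g x * (LINT t|lborel. h t)"
    using b
  proof eventually_elim
    case (elim x)
    have i: "integrable lborel (\<lambda>t. g x * h t)" using h by simp
    have F: "integrable lborel (\<lambda>t. F (x, t))"
      by (rule Bochner_Integration.integrable_bound[OF i])
        (use elim in \<open>auto intro!: AE_I2 order_trans[OF _ abs_ge_self] simp del: abs_mult\<close>)
    have "(LINT t|lborel. \<bar>F (x, t)\<bar>) \<le> (LINT t|lborel. g x * h t)"
      using elim by (intro integral_mono i integrable_abs F) auto
    then show ?case using F by simp
  qed
  note s = this
  show "AE x in lborel. integrable lborel (\<lambda>t. F (x, t))"
    using s by (auto elim: eventually_mono)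
  show "integrable lborel (\<lambda>x. LINT t|lborel. \<bar>F (x, t)\<bar>)"
  proof (rule Bochner_Integration.integrable_bound)
    show "integrable lborel (\<lambda>x. g x * (LINT t|lborel. h t))" using g by simp
    show "AE x in lborel. norm (LINT t|lborel. \<bar>F (x, t)\<bar>) \<le> norm (g x * (LINT t|lborel. h t))"
      using s by eventually_elim (auto intro: order_trans[OF _ abs_ge_self] simp del: abs_mult)
  qed measurable
qed measurable

text \<open>For \<open>f\<close> vanishing outside Omega this is its integral from time
  \<open>0\<close>, set to zero outside Omega so that it can agree with a function extended by
  zero.\<close>

definition prim :: "real \<Rightarrow> real \<Rightarrow> (real \<times> real \<Rightarrow> real) \<Rightarrow> real \<times> real \<Rightarrow> real" where
  "prim L T f p = indicator (Omega L T) p * head (\<lambda>s. f (fst p, s)) (snd p)"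

lemma prim_measurable [measurable]:
  assumes [measurable]: "f \<in> borel_measurable borel"
  shows "prim L T f \<in> borel_measurable borel"
proof -
  have "(\<lambda>p. LINT s|lborel. (if s < snd p then f (fst p, s) else 0)) \<in> borel_measurable borel"
    by (intro lborel.borel_measurable_lebesgue_integral) measurable
  moreover have "indicator {..<a} s * c = (if s < a then c else 0)" for a s c :: real
    by simp
  ultimately have [measurable]: "(\<lambda>p. head (\<lambda>s. f (fst p, s)) (snd p)) \<in> borel_measurable borel"
    unfolding head_def by simp
  show ?thesis unfolding prim_def by measurable
qed

lemma prim_integrable:
  assumes f: "sqint (Omega L T) f"
  shows "integrable lborel (prim L T f)"
proof (rule integrable_plane_bounded_AE)
  note [measurable] = sqint_measurable[OF f]
  have fi: "integrable lborel (\<lambda>p. \<bar>f p\<bar>)" using sqint_integrable[OF f Omega_bounded] by simp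
  show "prim L T f \<in> borel_measurable borel" by measurable
  show "integrable lborel (\<lambda>x. LINT s|lborel. \<bar>f (x, s)\<bar>)" by (rule plane_Fubini(3)[OF fi])
  show "integrable lborel (indicator {0<..<T} :: real \<Rightarrow> real)" by simp
  show "AE x in lborel. \<forall>t. \<bar>prim L T f (x, t)\<bar> \<le> (LINT s|lborel. \<bar>f (x, s)\<bar>) * indicator {0<..<T} t"
    using sqint_sections(1)[OF f]
  proof eventually_elim
    case (elim x)
    from head_bound[OF sqint_Ioo_integrable[OF this]] show ?case
      by (auto simp: prim_def indicator_def Omega_def)
  qed
qed

lemma test_function_tensor:
  assumes "0 < a" "b < L" "0 < c" "d < T"
    and I: "\<And>t. (I has_real_derivative q t) (at t)" "\<And>t. t \<notin> {c..d} \<Longrightarrow> I t = 0"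
    and q: "smooth_gen (\<lambda>p. q (snd p))"
  shows "(\<lambda>p. cutoff a b n (fst p) * I (snd p)) \<in> test_functions (Omega L T)"
    and "iterated_deriv [(0, 1)] (\<lambda>p. cutoff a b n (fst p) * I (snd p)) = (\<lambda>p. cutoff a b n (fst p) * q (snd p))"
proof -
  show "(\<lambda>p. cutoff a b n (fst p) * I (snd p)) \<in> test_functions (Omega L T)"
  proof (rule test_functionI)
    show "smooth_gen (\<lambda>p. cutoff a b n (fst p) * I (snd p))"
      by (intro smooth_gen.mult smooth_gen_cutoff smooth_gen.fst smooth_gen.primitive[OF I(1) q])
    show "compact ({a..b} \<times> {c..d})" by (intro compact_Times) auto
    show "{a..b} \<times> {c..d} \<subseteq> Omega L T" using assms by (auto simp: Omega_def)
    show "cutoff a b n (fst p) * I (snd p) = 0" if "p \<notin> {a..b} \<times> {c..d}" for p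
    proof (cases "snd p \<in> {c..d}")
      case True
      then have "fst p \<notin> {a<..<b}" using that by (auto simp: mem_Times_iff)
      then show ?thesis by (simp add: cutoff_outside)
    qed (simp add: I)
  qed
  show "iterated_deriv [(0, 1)] (\<lambda>p. cutoff a b n (fst p) * I (snd p)) = (\<lambda>p. cutoff a b n (fst p) * q (snd p))"
  proof
    fix p :: "real \<times> real"
    obtain D where D: "(cutoff a b n has_real_derivative D) (at (fst p))" using cutoff_has_derivative[of a b n "fst p"] by blast
    have 1: "((\<lambda>p. cutoff a b n (fst p)) has_derivative (\<lambda>h. D * fst h)) (at p)"
      using has_derivative_compose[OF bounded_linear_imp_has_derivative[OF bounded_linear_fst]
        D[unfolded has_field_derivative_def]] .
    have 2: "((\<lambda>p. I (snd p)) has_derivative (\<lambda>h. q (snd p) * snd h)) (at p)"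
      using has_derivative_compose[OF bounded_linear_imp_has_derivative[OF bounded_linear_snd]
        I(1)[of "snd p", unfolded has_field_derivative_def]] .
    from partial_deriv_eq[OF has_derivative_mult[OF 1 2], of "(0, 1)"]
    show "iterated_deriv [(0, 1)] (\<lambda>p. cutoff a b n (fst p) * I (snd p)) p = cutoff a b n (fst p) * q (snd p)"
      by (simp add: iterated_deriv_Cons)
  qed
qed

text \<open>Zero mean is what makes the primitive vanish to the right of \<open>d\<close> as well as
  to the left of \<open>c\<close>, so that it can be the time factor of a test function.\<close>

lemma mean_zero_antiderivative:
  fixes q :: "real \<Rightarrow> real"
  assumes q: "continuous_on UNIV q" "\<And>t. t \<notin> {c<..<d} \<Longrightarrow> q t = 0" and z: "(LINT t|lborel. q t) = 0"
  obtains I where "\<And>t. (I has_real_derivative q t) (at t)" "\<And>t. t \<notin> {c..d} \<Longrightarrow> I t = 0"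
    "\<And>t. (LINT s|lborel. indicator {..<t} s * q s) = I t"
proof -
  obtain I where I: "\<And>t. (I has_real_derivative q t) (at t)" "I (min c d) = 0"
    using continuous_antiderivative[OF q(1)] by blast
  have F: "(LINT t|lborel. indicator {..<s} t * q t) = I s" for s
  proof (cases "min c d \<le> s")
    case True
    show ?thesis using integral_lessThan_FTC[OF I(1) q(1) q(2) True] I(2) by auto
  next
    case False
    have 0: "indicator {..<u} t * q t = 0" if "u \<le> min c d" for t u
      using q(2)[of t] that by (auto simp: indicator_def)
    have "(LINT t|lborel. indicator {..<min c d} t * q t) = I (min c d) - I s"
      by (rule integral_lessThan_FTC[OF I(1) q(1) q(2)]) (use False in auto)
    moreover have "(LINT t|lborel. indicator {..<min c d} t * q t) = 0" "(LINT t|lborel. indicator {..<s} t * q t) = 0"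
      using 0[of "min c d"] 0[of s] False by (simp_all only: Bochner_Integration.integral_zero order_refl linear not_le less_imp_le)
    ultimately show ?thesis using I(2) by simp
  qed
  have "I t = 0" if "t \<notin> {c..d}" for t
  proof (cases "t < c")
    case True
    then have "indicator {..<t} s * q s = 0" for s using q(2)[of s] by (auto simp: indicator_def)
    then have "(LINT s|lborel. indicator {..<t} s * q s) = 0" by (simp only: Bochner_Integration.integral_zero)
    then show ?thesis using F[of t] by simp
  next
    case False
    then have "indicator {..<t} s * q s = q s" for s using q(2)[of s] that by (auto simp: indicator_def)
    then have "(LINT s|lborel. indicator {..<t} s * q s) = (LINT s|lborel. q s)" by (simp only:)
    then show ?thesis using F[of t] z by simp
  qed
  with I(1) F show ?thesis using that by blast
qed

text \<open>Integration by parts in time through Fubini: after the exchange, the integral of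
  \<open>q\<close> over \<open>t > s\<close> is \<open>- I s\<close>, because \<open>q\<close> has
  mean zero. Thus \<open>prim L T f\<close> satisfies, for such products, the identity that defines
  \<open>f\<close> as a weak time derivative.\<close>

lemma integral_prim_mult:
  assumes f: "sqint (Omega L T) f" and X [measurable]: "X \<in> borel_measurable borel"
    and Xb: "\<And>x. \<bar>X x\<bar> \<le> 1"
    and q: "continuous_on UNIV q" "\<And>t. t \<notin> {c<..<d} \<Longrightarrow> q t = 0" "integrable lborel q" "\<And>t. \<bar>q t\<bar> \<le> M"
    and z: "(LINT t|lborel. q t) = 0" and cd: "0 < c" "d < T"
    and I: "\<And>t. (LINT s|lborel. indicator {..<t} s * q s) = I t" "continuous_on UNIV I"
  shows "(LINT p|lborel. prim L T f p * (X (fst p) * q (snd p))) = - (LINT p|lborel. f p * (X (fst p) * I (snd p)))"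
proof -
  note [measurable] = sqint_measurable[OF f] borel_measurable_continuous_onI[OF q(1)]
    borel_measurable_continuous_onI[OF I(2)]
  have Ib: "\<bar>I t\<bar> \<le> (LINT t|lborel. \<bar>q t\<bar>)" for t
    using head_bound[OF q(3), of t] I(1) by (simp add: head_def)
  have i1: "integrable lborel (\<lambda>p. prim L T f p * (X (fst p) * q (snd p)))"
  proof (rule Bochner_Integration.integrable_bound)
    show "integrable lborel (\<lambda>p. M * prim L T f p)" using prim_integrable[OF f] by simp
    have "\<bar>X x * q t\<bar> \<le> \<bar>M\<bar>" for x t
      using mult_mono[OF Xb[of x] q(4)[of t]] by (simp add: abs_mult)
    then show "AE p in lborel. norm (prim L T f p * (X (fst p) * q (snd p))) \<le> norm (M * prim L T f p)"
      unfolding real_norm_def abs_mult[of "prim L T f _"] abs_mult[of M]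
      by (intro AE_I2) (metis abs_ge_zero mult.commute mult_left_mono)
  qed measurable
  have i2: "integrable lborel (\<lambda>p. f p * (X (fst p) * I (snd p)))"
  proof (rule Bochner_Integration.integrable_bound)
    let ?M = "LINT t|lborel. \<bar>q t\<bar>"
    show "integrable lborel (\<lambda>p. ?M * f p)" using sqint_integrable[OF f Omega_bounded] by simp
    have "\<bar>X x * I t\<bar> \<le> \<bar>?M\<bar>" for x t
      using mult_mono[OF Xb[of x] Ib[of t]] by (simp add: abs_mult)
    then show "AE p in lborel. norm (f p * (X (fst p) * I (snd p))) \<le> norm (?M * f p)"
      unfolding real_norm_def abs_mult[of "f _"] abs_mult[of ?M]
      by (intro AE_I2) (metis abs_ge_zero mult.commute mult_left_mono)
  qed measurable
  have sec: "(LINT t|lborel. prim L T f (x, t) * (X x * q t)) = - (LINT s|lborel. f (x, s) * (X x * I s))"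
    if x: "sqint {0<..<T} (\<lambda>t. f (x, t))" for x
  proof (cases "x \<in> {0<..<L}")
    case False
    then have "prim L T f (x, t) = 0" "f (x, t) = 0" for t
      using f by (auto simp: prim_def sqint_def Omega_def)
    then show ?thesis by simp
  next
    case True
    note g = sqint_Ioo_integrable[OF x]
    note [measurable] = sqint_measurable[OF x]
    let ?F = "\<lambda>p. (if snd p < fst p then q (fst p) * f (x, snd p) else 0)"
    have "?F \<in> borel_measurable borel" by measurable
    then have F: "integrable lborel ?F"
      by (rule integrable_plane_bounded[OF _ q(3) g]) simp
    have "prim L T f (x, t) * (X x * q t) = X x * (LINT s|lborel. ?F (t, s))" for t
    proof -
      have "?F (t, s) = q t * (indicator {..<t} s * f (x, s))" for s by simp
      then have "(LINT s|lborel. ?F (t, s)) = q t * head (\<lambda>s. f (x, s)) t"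
        by (simp only: integral_mult_right_zero head_def)
      moreover have "q t = 0" if "t \<notin> {0<..<T}" using that cd by (intro q(2)) auto
      ultimately show ?thesis
        using True by (auto simp: prim_def indicator_def Omega_def)
    qed
    then have "(LINT t|lborel. prim L T f (x, t) * (X x * q t)) = X x * (LINT t|lborel. LINT s|lborel. ?F (t, s))"
      by (simp only: integral_mult_right_zero)
    also have "(LINT t|lborel. LINT s|lborel. ?F (t, s)) = (LINT s|lborel. LINT t|lborel. ?F (t, s))"
      using plane_Fubini(5,6)[OF F] by simp
    also have "\<dots> = (LINT s|lborel. - (f (x, s) * I s))"
    proof (rule Bochner_Integration.integral_cong[OF refl])
      fix s
      have "(LINT t|lborel. ?F (t, s)) = (LINT t|lborel. f (x, s) * (q t - indicator {..<s} t * q t))"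
      proof (rule integral_cong_AE)
        show "AE t in lborel. ?F (t, s) = f (x, s) * (q t - indicator {..<s} t * q t)"
          using AE_lborel_singleton[of s] by eventually_elim (auto simp: indicator_def)
      qed measurable
      also have "\<dots> = - (f (x, s) * I s)"
        using q(3) integrable_real_mult_indicator_left[OF _ q(3), of "{..<s}"] z I(1)[of s] by simp
      finally show "(LINT t|lborel. ?F (t, s)) = - (f (x, s) * I s)" .
    qed
    finally show ?thesis by (simp add: mult.left_commute)
  qed
  have "(LINT p|lborel. prim L T f p * (X (fst p) * q (snd p))) = (LINT x|lborel. LINT t|lborel. prim L T f (x, t) * (X x * q t))"
    using plane_Fubini(5)[OF i1] by simp
  also have "\<dots> = (LINT x|lborel. - (LINT s|lborel. f (x, s) * (X x * I s)))"
    using plane_Fubini(3)[OF i1] plane_Fubini(3)[OF i2] sqint_sections(1)[OF f]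
    by (intro integral_cong_AE) (auto elim!: eventually_mono simp: sec)
  also have "\<dots> = - (LINT p|lborel. f p * (X (fst p) * I (snd p)))"
    using plane_Fubini(5)[OF i2] by simp
  finally show ?thesis .
qed

lemma cutoff_integrable: "integrable lborel (cutoff a b n)"
  and cutoff_integral_bound: "\<bar>LINT t|lborel. cutoff a b n t\<bar> \<le> \<bar>b - a\<bar>"
proof -
  note [measurable] = borel_measurable_continuous_onI[OF continuous_cutoff]
  have le: "\<bar>cutoff a b n t\<bar> \<le> indicator {a<..<b} t" for t
    using cutoff_range[of a b n t] cutoff_outside[of t a b n] by (auto simp: indicator_def)
  show i: "integrable lborel (cutoff a b n)"
    by (rule Bochner_Integration.integrable_bound[OF integrable_indicator_Ioo[of a b]])
      (use le in \<open>auto intro!: AE_I2 order_trans[OF _ abs_ge_self] simp del: abs_indicator\<close>)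
  have "\<bar>LINT t|lborel. cutoff a b n t\<bar> \<le> (LINT t|lborel. indicator {a<..<b} t)"
    by (rule order_trans[OF integral_abs_bound]) (intro integral_mono integrable_abs i integrable_indicator_Ioo le)
  also have "\<dots> \<le> \<bar>b - a\<bar>"
    by (cases "a \<le> b") auto
  finally show "\<bar>LINT t|lborel. cutoff a b n t\<bar> \<le> \<bar>b - a\<bar>" .
qed

lemma cutoff_integral_tendsto:
  assumes "a < b"
  shows "(\<lambda>n. LINT t|lborel. cutoff a b n t) \<longlonglongrightarrow> b - a"
proof -
  note [measurable] = borel_measurable_continuous_onI[OF continuous_cutoff]
  have "(\<lambda>n. LINT t|lborel. cutoff a b n t) \<longlonglongrightarrow> (LINT t|lborel. indicator {a<..<b} t)"
  proof (rule integral_dominated_convergence[where w="indicator {a<..<b}"])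
    show "AE t in lborel. (\<lambda>n. cutoff a b n t) \<longlonglongrightarrow> indicator {a<..<b} t"
      by (intro AE_I2 cutoff_tendsto) auto
    show "AE t in lborel. norm (cutoff a b n t) \<le> indicator {a<..<b} t" for n
      using cutoff_range[of a b n] cutoff_outside[of _ a b n] by (intro AE_I2) (auto simp: indicator_def)
  qed auto
  then show ?thesis using assms by simp
qed

lemma mult_bounded_integrable:
  fixes E h :: "'a \<Rightarrow> real"
  assumes "integrable M E" "h \<in> borel_measurable M" "\<And>p. \<bar>h p\<bar> \<le> C"
  shows "integrable M (\<lambda>p. E p * h p)"
proof (rule Bochner_Integration.integrable_bound)
  show "integrable M (\<lambda>p. C * E p)" using assms by simp
  show "(\<lambda>p. E p * h p) \<in> borel_measurable M" using assms by (intro borel_measurable_times) auto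
  have "\<bar>E p * h p\<bar> \<le> \<bar>C * E p\<bar>" for p
  proof -
    have "\<bar>h p\<bar> \<le> \<bar>C\<bar>" using assms(3)[of p] by linarith
    then show ?thesis
      unfolding abs_mult mult.commute[of "\<bar>C\<bar>"] by (intro mult_left_mono) auto
  qed
  then show "AE p in M. norm (E p * h p) \<le> norm (C * E p)" by simp
qed

text \<open>Test with \<open>cutoff(x) I(t)\<close>, where \<open>I'\<close> is the mean-zero combination of the cutoffs of \<open>(c1, d1)\<close> and
  \<open>(c2, d2)\<close>: the time averages of \<open>v - \<integral>\<^sub>0\<^sup>t f\<close> over any two intervals agree.\<close>

lemma rect_integral_averages:
  assumes f: "sqint (Omega L T) f" and v: "sqint (Omega L T) v" and w: "has_weak_deriv (Omega L T) [(0, 1)] v f"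
    and ab: "0 < a" "b < L" and cd: "0 < c1" "c1 < d1" "d1 < T" "0 < c2" "c2 < d2" "d2 < T"
  shows "(d2 - c2) * rect_integral (\<lambda>p. v p - prim L T f p) a b c1 d1
    = (d1 - c1) * rect_integral (\<lambda>p. v p - prim L T f p) a b c2 d2"
proof -
  define E where "E = (\<lambda>p. v p - prim L T f p)"
  have vi: "integrable lborel v" by (rule sqint_integrable[OF v Omega_bounded Omega_sets])
  have pi: "integrable lborel (prim L T f)" by (rule prim_integrable[OF f])
  have E: "integrable lborel E" unfolding E_def using vi pi by simp
  note [measurable] = borel_measurable_continuous_onI[OF continuous_cutoff]
  have [measurable]: "E \<in> borel_measurable borel" using E by auto
  define z1 where "z1 = (\<lambda>n. LINT t|lborel. cutoff c1 d1 n t)"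
  define z2 where "z2 = (\<lambda>n. LINT t|lborel. cutoff c2 d2 n t)"
  \<comment> \<open>Each bump is weighted by the integral of the other, so \<open>q n\<close> has
    mean zero for every \<open>n\<close>, not merely in the limit. The weights tend to the interval
    lengths.\<close>
  define q where "q = (\<lambda>n t. cutoff c1 d1 n t * z2 n - cutoff c2 d2 n t * z1 n)"
  define M where "M = (d2 - c2) + (d1 - c1)"
  have z: "\<bar>z1 n\<bar> \<le> d1 - c1" "\<bar>z2 n\<bar> \<le> d2 - c2" for n
    using cutoff_integral_bound[of c1 d1 n] cutoff_integral_bound[of c2 d2 n] cd by (simp_all add: z1_def z2_def)
  have qM: "\<bar>q n t\<bar> \<le> M" for n t
  proof -
    have "\<bar>cutoff c1 d1 n t * z2 n\<bar> \<le> 1 * (d2 - c2)" "\<bar>cutoff c2 d2 n t * z1 n\<bar> \<le> 1 * (d1 - c1)"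
      unfolding abs_mult using z cutoff_range by (intro mult_mono; simp)+
    then have "\<bar>cutoff c1 d1 n t * z2 n\<bar> + \<bar>cutoff c2 d2 n t * z1 n\<bar> \<le> M" unfolding M_def by simp
    then show ?thesis unfolding q_def by (rule order_trans[OF abs_triangle_ineq4])
  qed
  have qc: "continuous_on UNIV (q n)" for n
    unfolding q_def by (intro continuous_intros continuous_cutoff)
  note [measurable] = borel_measurable_continuous_onI[OF qc]
  have XqM: "\<bar>cutoff a b n x * q n t\<bar> \<le> M" for n x t
  proof -
    have "\<bar>cutoff a b n x * q n t\<bar> \<le> 1 * M"
      unfolding abs_mult using qM[of n t] cutoff_range[of a b n x] by (intro mult_mono) auto
    then show ?thesis by simp
  qed
  \<comment> \<open>\<open>v\<close> and \<open>prim L T f\<close> give the same value against this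
    test function, so their difference \<open>E\<close> gives zero.\<close>
  have zero: "(LINT p|lborel. E p * (cutoff a b n (fst p) * q n (snd p))) = 0" for n
  proof -
    have qi: "integrable lborel (q n)"
      unfolding q_def using cutoff_integrable by simp
    have qz: "(LINT t|lborel. q n t) = 0"
      unfolding q_def using cutoff_integrable by (simp add: z1_def z2_def)
    let ?c = "min c1 c2" and ?d = "max d1 d2"
    have q0: "q n t = 0" if "t \<notin> {?c<..<?d}" for t
    proof -
      have "t \<notin> {c1<..<d1}" "t \<notin> {c2<..<d2}" using that by auto
      then show ?thesis by (simp add: q_def cutoff_outside)
    qed
    obtain I where I: "\<And>t. (I has_real_derivative q n t) (at t)" "\<And>t. t \<notin> {?c..?d} \<Longrightarrow> I t = 0"
      "\<And>t. (LINT s|lborel. indicator {..<t} s * q n s) = I t"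
      using mean_zero_antiderivative[OF qc q0 qz] by blast
    have Ic: "continuous_on UNIV I"
      using I(1) DERIV_isCont by (blast intro: continuous_at_imp_continuous_on)
    have "smooth_gen (\<lambda>p. cutoff c1 d1 n (snd p) * z2 n + (- 1) * (cutoff c2 d2 n (snd p) * z1 n))"
      by (intro smooth_gen.add smooth_gen.mult smooth_gen.const smooth_gen_cutoff smooth_gen.snd)
    then have qs: "smooth_gen (\<lambda>p. q n (snd p))" by (simp add: q_def)
    have cd': "0 < ?c" "?d < T" using cd by auto
    have \<psi>: "(\<lambda>p. cutoff a b n (fst p) * I (snd p)) \<in> test_functions (Omega L T)"
      "iterated_deriv [(0, 1)] (\<lambda>p. cutoff a b n (fst p) * I (snd p)) = (\<lambda>p. cutoff a b n (fst p) * q n (snd p))"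
      using test_function_tensor[of a b L ?c ?d T I "q n" n] ab cd' I(1,2) qs by blast+
    have bs: "set [(0, 1) :: real \<times> real] \<subseteq> Basis" by (auto simp: Basis_plane)
    have "\<forall>\<phi>\<in>test_functions (Omega L T). (LINT p|lborel. v p * iterated_deriv [(0, 1)] \<phi> p)
        = - (LINT p|lborel. f p * \<phi> p)"
      using w has_weak_deriv_borel_iff[OF Omega_sets sqint_measurable[OF v] sqint_measurable[OF f] bs] by simp
    from bspec[OF this \<psi>(1)]
    have "(LINT p|lborel. v p * (cutoff a b n (fst p) * q n (snd p))) = - (LINT p|lborel. f p * (cutoff a b n (fst p) * I (snd p)))"
      unfolding \<psi>(2) .
    moreover have "(LINT p|lborel. prim L T f p * (cutoff a b n (fst p) * q n (snd p))) = - (LINT p|lborel. f p * (cutoff a b n (fst p) * I (snd p)))"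
    proof (rule integral_prim_mult[OF f _ _ qc q0 qi qM qz cd' I(3) Ic])
      show "cutoff a b n \<in> borel_measurable borel" by measurable
      show "\<bar>cutoff a b n x\<bar> \<le> 1" for x using cutoff_range[of a b n x] by simp
    qed
    moreover have m: "(\<lambda>p. cutoff a b n (fst p) * q n (snd p)) \<in> borel_measurable lborel" by measurable
    have "(LINT p|lborel. E p * (cutoff a b n (fst p) * q n (snd p)))
      = (LINT p|lborel. v p * (cutoff a b n (fst p) * q n (snd p))) - (LINT p|lborel. prim L T f p * (cutoff a b n (fst p) * q n (snd p)))"
      unfolding E_def left_diff_distrib
      by (intro Bochner_Integration.integral_diff mult_bounded_integrable[OF vi m XqM] mult_bounded_integrable[OF pi m XqM])
    ultimately show ?thesis by simp
  qed
  let ?lim = "\<lambda>p. E p * (indicator {a<..<b} (fst p) * (indicator {c1<..<d1} (snd p) * (d2 - c2) - indicator {c2<..<d2} (snd p) * (d1 - c1)))"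
  have "(\<lambda>n. LINT p|lborel. E p * (cutoff a b n (fst p) * q n (snd p))) \<longlonglongrightarrow> (LINT p|lborel. ?lim p)"
  proof (rule integral_dominated_convergence[where w="\<lambda>p. M * \<bar>E p\<bar>"])
    have "z1 \<longlonglongrightarrow> d1 - c1" "z2 \<longlonglongrightarrow> d2 - c2"
      unfolding z1_def z2_def using cd by (auto intro: cutoff_integral_tendsto)
    then show "AE p in lborel. (\<lambda>n. E p * (cutoff a b n (fst p) * q n (snd p))) \<longlonglongrightarrow> ?lim p"
      unfolding q_def
      by (intro AE_I2 tendsto_mult tendsto_const tendsto_diff cutoff_tendsto[OF tendsto_const tendsto_const order_refl order_refl])
    show "AE p in lborel. norm (E p * (cutoff a b n (fst p) * q n (snd p))) \<le> M * \<bar>E p\<bar>" for n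
      unfolding real_norm_def abs_mult[of "E _"] using XqM by (intro AE_I2) (metis abs_ge_zero mult.commute mult_left_mono)
    show "integrable lborel (\<lambda>p. M * \<bar>E p\<bar>)" using E by simp
    show "?lim \<in> borel_measurable lborel" "\<And>n. (\<lambda>p. E p * (cutoff a b n (fst p) * q n (snd p))) \<in> borel_measurable lborel"
      by measurable
  qed
  then have "(LINT p|lborel. ?lim p) = 0" unfolding zero by (simp add: LIMSEQ_const_iff)
  moreover have "(LINT p|lborel. ?lim p) = (d2 - c2) * rect_integral E a b c1 d1 - (d1 - c1) * rect_integral E a b c2 d2"
  proof -
    have m: "integrable lborel (\<lambda>p. indicator {a<..<b} (fst p) * indicator {c<..<d} (snd p) * E p)" for c d
    proof -
      have "(\<lambda>p. indicator {a<..<b} (fst p) * indicator {c<..<d} (snd p) :: real) \<in> borel_measurable lborel" by measurable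
      from mult_bounded_integrable[OF E this, of 1] show ?thesis
        by (simp add: mult.commute abs_mult indicator_def)
    qed
    have "?lim p = (d2 - c2) * (indicator {a<..<b} (fst p) * indicator {c1<..<d1} (snd p) * E p)
        - (d1 - c1) * (indicator {a<..<b} (fst p) * indicator {c2<..<d2} (snd p) * E p)" for p
      by (simp add: algebra_simps)
    then have "(LINT p|lborel. ?lim p) = (LINT p|lborel. (d2 - c2) * (indicator {a<..<b} (fst p) * indicator {c1<..<d1} (snd p) * E p)
        - (d1 - c1) * (indicator {a<..<b} (fst p) * indicator {c2<..<d2} (snd p) * E p))"
      by (simp only:)
    also have "\<dots> = (d2 - c2) * rect_integral E a b c1 d1 - (d1 - c1) * rect_integral E a b c2 d2"
      unfolding rect_integral_def using m by (subst Bochner_Integration.integral_diff) auto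
    finally show ?thesis .
  qed
  ultimately show ?thesis by (simp add: E_def)
qed

text \<open>The common average is zero because, near \<open>t = 0\<close>, \<open>u\<close> is uniformly small and so is \<open>\<integral>\<^sub>0\<^sup>t f\<close> in the mean.\<close>

lemma weak_t_eq_prim:
  assumes "L > 0" "T > 0" and f: "sqint (Omega L T) f" and v: "sqint (Omega L T) v"
    and w: "has_weak_deriv (Omega L T) [(0, 1)] v f"
    and u: "continuous_on ({0..L} \<times> {0..T}) u" "\<And>p. p \<in> Omega L T \<Longrightarrow> v p = u p"
    and u0: "\<And>x. x \<in> {0..L} \<Longrightarrow> u (x, 0) = 0"
  shows "AE p in lborel. v p = prim L T f p"
proof -
  define E where "E = (\<lambda>p. v p - prim L T f p)"
  have vi: "integrable lborel v" by (rule sqint_integrable[OF v Omega_bounded Omega_sets])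
  have fi: "integrable lborel f" by (rule sqint_integrable[OF f Omega_bounded Omega_sets])
  have pi: "integrable lborel (prim L T f)" by (rule prim_integrable[OF f])
  have E: "integrable lborel E" unfolding E_def using vi pi by simp
  note [measurable] = sqint_measurable[OF f] sqint_measurable[OF v]
  \<comment> \<open>With \<open>n + 3\<close> in the denominator, \<open>2 * \<delta> n < T\<close>
    holds from \<open>n = 0\<close> on.\<close>
  define \<delta> where "\<delta> = (\<lambda>n. T / real (n + 3))"
  define r where "r = (\<lambda>n. LINT p|lborel. indicator {..<2 * \<delta> n} (snd p) * \<bar>f p\<bar>)"
  have \<delta>: "0 < \<delta> n" "2 * \<delta> n < T" for n using \<open>T > 0\<close> by (auto simp: \<delta>_def field_simps intro!: add_pos_nonneg)
  have \<delta>0: "\<delta> \<longlonglongrightarrow> 0"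
    unfolding \<delta>_def by (rule LIMSEQ_ignore_initial_segment[OF lim_const_over_n])
  have r0: "r \<longlonglongrightarrow> 0"
  proof -
    have "r \<longlonglongrightarrow> (LINT p::real \<times> real|lborel. 0)"
      unfolding r_def
    proof (rule integral_dominated_convergence[where w="\<lambda>p. \<bar>f p\<bar>"])
      show "AE p in lborel. (\<lambda>n. indicator {..<2 * \<delta> n} (snd p) * \<bar>f p\<bar>) \<longlonglongrightarrow> 0"
      proof (rule AE_I2)
        fix p
        show "(\<lambda>n. indicator {..<2 * \<delta> n} (snd p) * \<bar>f p\<bar>) \<longlonglongrightarrow> 0"
        proof (cases "snd p > 0")
          case True
          have "(\<lambda>n. 2 * \<delta> n) \<longlonglongrightarrow> 0" using tendsto_mult_left[OF \<delta>0, of 2] by simp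
          then have "eventually (\<lambda>n. 2 * \<delta> n < snd p) sequentially" by (rule order_tendstoD(2)[OF _ True])
          then have "eventually (\<lambda>n. indicator {..<2 * \<delta> n} (snd p) * \<bar>f p\<bar> = 0) sequentially"
            by eventually_elim (auto simp: indicator_def)
          then show ?thesis by (rule tendsto_eventually)
        next
          case False
          then have "f p = 0" using f by (cases p) (simp add: sqint_def Omega_def)
          then show ?thesis by simp
        qed
      qed
      show "AE p in lborel. norm (indicator {..<2 * \<delta> n} (snd p) * \<bar>f p\<bar>) \<le> \<bar>f p\<bar>" for n
        by (auto simp: indicator_def)
      show "(\<lambda>p. indicator {..<2 * \<delta> n} (snd p) * \<bar>f p\<bar>) \<in> borel_measurable lborel" for n
        by measurable
    qed (use fi in auto)
    then show ?thesis by simp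
  qed
  let ?Q = "\<lambda>n p. indicator {\<delta> n<..<2 * \<delta> n} (snd p) :: real"
  \<comment> \<open>For \<open>t\<close> in \<open>(\<delta> n, 2 * \<delta> n)\<close> the
    primitive is at most the integral of \<open>\<bar>f\<bar>\<close> up to
    \<open>2 * \<delta> n\<close>; integrating over an interval of length \<open>\<delta> n\<close>
    gives the factor that is divided out in \<open>avg\<close>.\<close>
  have prim_part: "(LINT p|lborel. ?Q n p * \<bar>prim L T f p\<bar>) \<le> \<delta> n * r n" for n
  proof -
    have i: "integrable lborel (\<lambda>p. indicator {..<2 * \<delta> n} (snd p) * \<bar>f p\<bar>)"
      by (rule Bochner_Integration.integrable_bound[OF fi]) (auto simp: indicator_def)
    let ?M = "\<lambda>x. LINT s|lborel. indicator {..<2 * \<delta> n} s * \<bar>f (x, s)\<bar>"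
    have Mi: "integrable lborel ?M" and Mr: "(LINT x|lborel. ?M x) = r n"
      using plane_Fubini(3,5)[OF i] by (simp_all add: r_def)
    have qi: "integrable lborel (\<lambda>p. ?Q n p * \<bar>prim L T f p\<bar>)"
      by (rule Bochner_Integration.integrable_bound[OF pi]) (auto simp: indicator_def)
    have "(LINT p|lborel. ?Q n p * \<bar>prim L T f p\<bar>) = (LINT x|lborel. LINT t|lborel. ?Q n (x, t) * \<bar>prim L T f (x, t)\<bar>)"
      by (rule plane_Fubini(5)[OF qi])
    also have "\<dots> \<le> (LINT x|lborel. \<delta> n * ?M x)"
    proof (rule integral_mono_AE)
      show "integrable lborel (\<lambda>x. LINT t|lborel. ?Q n (x, t) * \<bar>prim L T f (x, t)\<bar>)"
        by (rule plane_Fubini(3)[OF qi])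
      show "integrable lborel (\<lambda>x. \<delta> n * ?M x)" using Mi by simp
      show "AE x in lborel. (LINT t|lborel. ?Q n (x, t) * \<bar>prim L T f (x, t)\<bar>) \<le> \<delta> n * ?M x"
        using sqint_sections(1)[OF f] plane_Fubini(1)[OF qi]
      proof eventually_elim
        case (elim x)
        note g = sqint_Ioo_integrable[OF elim(1)]
        have le: "?Q n (x, t) * \<bar>prim L T f (x, t)\<bar> \<le> ?M x * indicator {\<delta> n<..<2 * \<delta> n} t" for t
        proof (cases "t \<in> {\<delta> n<..<2 * \<delta> n}")
          case True
          have "\<bar>head (\<lambda>s. f (x, s)) t\<bar> \<le> (LINT s|lborel. \<bar>indicator {..<t} s * f (x, s)\<bar>)"
            unfolding head_def by (rule integral_abs_bound)
          also have "\<dots> \<le> ?M x"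
            using True g
            by (intro integral_mono integrable_abs integrable_real_mult_indicator_left) (auto simp: indicator_def)
          finally have "\<bar>head (\<lambda>s. f (x, s)) t\<bar> \<le> ?M x" .
          moreover have "0 \<le> ?M x" by simp
          ultimately show ?thesis using True by (simp add: prim_def indicator_def)
        qed simp
        have "(LINT t|lborel. ?Q n (x, t) * \<bar>prim L T f (x, t)\<bar>) \<le> (LINT t|lborel. ?M x * indicator {\<delta> n<..<2 * \<delta> n} t)"
          by (intro integral_mono elim(2) le) simp
        also have "\<dots> = \<delta> n * ?M x" using \<delta>(1)[of n] by simp
        finally show ?case .
      qed
    qed
    also have "\<dots> = \<delta> n * r n" using Mr by simp
    finally show ?thesis .
  qed
  have avg: "(\<lambda>n. rect_integral E a b (\<delta> n) (2 * \<delta> n) / \<delta> n) \<longlonglongrightarrow> 0" for a b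
  proof (rule tendstoI)
    fix e :: real assume "e > 0"
    \<comment> \<open>The part from \<open>v\<close> contributes at most
      \<open>\<epsilon> * L = e / 2\<close> to the average, which leaves \<open>e / 2\<close> for
      \<open>r n\<close>.\<close>
    define \<epsilon> where "\<epsilon> = e / (2 * L)"
    have "\<epsilon> > 0" using \<open>e > 0\<close> \<open>L > 0\<close> by (simp add: \<epsilon>_def)
    have "uniformly_continuous_on ({0..L} \<times> {0..T}) u"
      by (intro compact_uniformly_continuous u compact_Times) auto
    then obtain h where h: "h > 0" "\<And>p p'. p \<in> {0..L} \<times> {0..T} \<Longrightarrow> p' \<in> {0..L} \<times> {0..T} \<Longrightarrow> dist p' p < h \<Longrightarrow> dist (u p') (u p) < \<epsilon>"
      unfolding uniformly_continuous_on_def using \<open>\<epsilon> > 0\<close> by blast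
    have small: "\<bar>v p\<bar> \<le> \<epsilon> * indicator {0<..<L} (fst p)" if "snd p < h" for p
    proof (cases "p \<in> Omega L T")
      case True
      then have "dist p (fst p, 0) < h" using that by (cases p) (simp add: dist_Pair_Pair Omega_def)
      moreover have "p \<in> {0..L} \<times> {0..T}" "(fst p, 0) \<in> {0..L} \<times> {0..T}" "fst p \<in> {0<..<L}"
        using True \<open>T > 0\<close> by (auto simp: Omega_def)
      ultimately have "dist (u p) (u (fst p, 0)) < \<epsilon>" by (intro h(2))
      then show ?thesis using u0[of "fst p"] u(2)[OF True] \<open>fst p \<in> {0<..<L}\<close> by (simp add: dist_real_def)
    next
      case False
      then have "v p = 0" using v unfolding sqint_def by blast
      then show ?thesis using \<open>\<epsilon> > 0\<close> by simp
    qed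
    have "eventually (\<lambda>n. 2 * \<delta> n < h) sequentially"
      by (rule order_tendstoD(2)[OF _ h(1)]) (use tendsto_mult_left[OF \<delta>0, of 2] in simp)
    moreover have "eventually (\<lambda>n. r n < e / 2) sequentially"
      by (rule order_tendstoD(2)[OF r0]) (use \<open>e > 0\<close> in simp)
    ultimately show "eventually (\<lambda>n. dist (rect_integral E a b (\<delta> n) (2 * \<delta> n) / \<delta> n) 0 < e) sequentially"
    proof eventually_elim
      case (elim n)
      let ?A = "\<lambda>p. \<epsilon> * (indicator {0<..<L} (fst p) * ?Q n p)" and ?B = "\<lambda>p. ?Q n p * \<bar>prim L T f p\<bar>"
      have A: "integrable lborel ?A"
        using integrable_tensor[OF integrable_indicator_Ioo[of 0 L] integrable_indicator_Ioo[of "\<delta> n" "2 * \<delta> n"]]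
        by simp
      have B: "integrable lborel ?B"
        by (rule Bochner_Integration.integrable_bound[OF pi]) (auto simp: indicator_def)
      have A': "(LINT p|lborel. ?A p) = \<epsilon> * L * \<delta> n"
        using plane_Fubini(5)[OF A] \<open>L > 0\<close> \<delta>(1)[of n] by simp
      have le: "\<bar>indicator {a<..<b} (fst p) * ?Q n p * E p\<bar> \<le> ?A p + ?B p" for p
      proof (cases "snd p \<in> {\<delta> n<..<2 * \<delta> n}")
        case True
        then have "\<bar>v p\<bar> \<le> \<epsilon> * indicator {0<..<L} (fst p)" using elim by (intro small) auto
        moreover have "\<bar>indicator {a<..<b} (fst p) * E p\<bar> \<le> \<bar>v p\<bar> + \<bar>prim L T f p\<bar>"
          by (auto simp: E_def indicator_def)
        ultimately show ?thesis using True by simp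
      qed simp
      have "\<bar>rect_integral E a b (\<delta> n) (2 * \<delta> n)\<bar> \<le> (LINT p|lborel. ?A p + ?B p)"
        unfolding rect_integral_def
      proof (rule order_trans[OF integral_abs_bound], rule integral_mono)
        show "integrable lborel (\<lambda>p. ?A p + ?B p)" by (intro Bochner_Integration.integrable_add A B)
        show "integrable lborel (\<lambda>p. \<bar>indicator {a<..<b} (fst p) * ?Q n p * E p\<bar>)"
          by (rule Bochner_Integration.integrable_bound[OF E]) (use E in \<open>auto simp: indicator_def\<close>)
      qed (rule le)
      also have "\<dots> = \<epsilon> * L * \<delta> n + (LINT p|lborel. ?B p)"
        by (subst Bochner_Integration.integral_add[OF A B]) (simp only: A')
      also have "\<dots> \<le> \<delta> n * (\<epsilon> * L + r n)"
        using prim_part[of n] by (simp add: algebra_simps)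
      also have "\<dots> < \<delta> n * e"
        using elim \<delta>(1)[of n] \<open>L > 0\<close> by (intro mult_strict_left_mono) (simp_all add: \<epsilon>_def)
      finally show ?case using \<delta>(1)[of n] by (simp add: field_simps)
    qed
  qed
  have "AE p in lborel. E p = 0"
  proof (rule AE_zero_if_rect_integrals[OF E])
    show "E p = 0" if "p \<notin> Omega L T" for p
      using that v by (simp add: E_def prim_def) (unfold sqint_def, blast)
    show "rect_integral E a b c d = 0" if "0 < a" "b < L" "0 < c" "d < T" for a b c d
    proof (cases "c < d")
      case False
      then have "indicator {c<..<d} t = (0::real)" for t by (auto simp: indicator_def)
      then show ?thesis by (simp add: rect_integral_def)
    next
      case True
      \<comment> \<open>The time average over \<open>(c, d)\<close> agrees with the one over
        \<open>(\<delta> n, 2 * \<delta> n)\<close> for every \<open>n\<close>, and the latter tend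
        to zero.\<close>
      have "rect_integral E a b c d = (d - c) * (rect_integral E a b (\<delta> n) (2 * \<delta> n) / \<delta> n)" for n
      proof -
        have "(d - c) * rect_integral E a b (\<delta> n) (2 * \<delta> n) = (2 * \<delta> n - \<delta> n) * rect_integral E a b c d"
          unfolding E_def using that True \<delta>[of n] by (intro rect_integral_averages[OF f v w]) auto
        then show ?thesis using \<delta>(1)[of n] by (simp add: field_simps)
      qed
      moreover have "(\<lambda>n. (d - c) * (rect_integral E a b (\<delta> n) (2 * \<delta> n) / \<delta> n)) \<longlonglongrightarrow> (d - c) * 0"
        by (rule tendsto_mult_left[OF avg])
      ultimately have "(\<lambda>n. rect_integral E a b c d) \<longlonglongrightarrow> (d - c) * 0" by (simp only:)
      then show ?thesis by (simp add: LIMSEQ_const_iff)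
    qed
  qed
  then show ?thesis by eventually_elim (simp add: E_def)
qed

subsection \<open>The energy estimate\<close>

text \<open>Sequential continuity by dominated convergence: \<open>u\<close> is bounded on the
  compact rectangle, and the moving lower limit spoils convergence of the integrand at most at
  \<open>s = snd p\<close>.\<close>

lemma tail_continuous:
  assumes "T > 0" and u: "continuous_on ({0..L} \<times> {0..T}) u"
    and v: "\<And>p. v p = indicator (Omega L T) p * u p"
    and bd: "\<And>t. t \<in> {0..T} \<Longrightarrow> u (0, t) = 0 \<and> u (L, t) = 0"
  shows "continuous_on ({0..L} \<times> {0..T}) (tail T v)"
  unfolding continuous_on_sequentially
proof (intro ballI allI impI, unfold o_def, elim conjE)
  let ?S = "{0..L} \<times> {0..T}"
  fix P p assume p: "p \<in> ?S" and P: "\<forall>n. P n \<in> ?S" "P \<longlonglongrightarrow> p"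
  \<comment> \<open>The zero boundary values are what admits \<open>x = 0\<close> and
    \<open>x = L\<close> here; otherwise \<open>v\<close> would jump at the lateral sides.\<close>
  have v_eq: "v (x, s) = indicator {0<..<T} s * u (x, s)" if "x \<in> {0..L}" for x s
    using that bd[of s] by (cases "x = 0"; cases "x = L") (auto simp: v Omega_def indicator_def less_le)
  obtain B where B: "\<And>q. q \<in> ?S \<Longrightarrow> \<bar>u q\<bar> \<le> B"
    using compact_imp_bounded[OF compact_continuous_image[OF u compact_Times]]
    by (auto simp: bounded_real)
  have v_meas: "(\<lambda>s. indicator {t<..} s * ((T - s) * v (x, s))) \<in> borel_measurable borel" for x t
  proof -
    have "(\<lambda>q. indicator (Omega L T) q *\<^sub>R u q) \<in> borel_measurable borel"
      using u by (intro borel_measurable_continuous_on_indicator Omega_sets)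
        (auto elim!: continuous_on_subset simp: Omega_def)
    then have [measurable]: "v \<in> borel_measurable borel" by (simp add: v[abs_def])
    show ?thesis by measurable
  qed
  have bound: "\<bar>indicator {t<..} s * ((T - s) * v (x, s))\<bar> \<le> T * B * indicator {0<..<T} s" if "x \<in> {0..L}" for x s t
  proof (cases "s \<in> {0<..<T}")
    case True
    then have "\<bar>u (x, s)\<bar> \<le> B" using B[of "(x, s)"] that by auto
    then have "\<bar>(T - s) * u (x, s)\<bar> \<le> T * B"
      unfolding abs_mult using True by (intro mult_mono) auto
    moreover have "0 \<le> T * B" using \<open>T > 0\<close> \<open>\<bar>u (x, s)\<bar> \<le> B\<close> by simp
    ultimately show ?thesis using True that by (simp add: v_eq indicator_def)
  next
    case False
    then show ?thesis using that by (simp add: v_eq)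
  qed
  show "(\<lambda>n. tail T v (P n)) \<longlonglongrightarrow> tail T v p"
    unfolding tail_def
  proof (rule integral_dominated_convergence[where w="\<lambda>s. T * B * indicator {0<..<T} s"])
    show "AE s in lborel. norm (indicator {snd (P n)<..} s * ((T - s) * v (fst (P n), s))) \<le> T * B * indicator {0<..<T} s" for n
      using P(1) bound[of "fst (P n)"] by (auto simp: mem_Times_iff)
    show "AE s in lborel. (\<lambda>n. indicator {snd (P n)<..} s * ((T - s) * v (fst (P n), s)))
        \<longlonglongrightarrow> indicator {snd p<..} s * ((T - s) * v (fst p, s))"
      using AE_lborel_singleton[of "snd p"]
    proof eventually_elim
      case (elim s)
      have "(\<lambda>n. snd (P n)) \<longlonglongrightarrow> snd p" using P(2) by (rule tendsto_snd)
      then have "eventually (\<lambda>n. indicator {snd (P n)<..} s = (indicator {snd p<..} s :: real)) sequentially"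
      proof (cases "snd p < s")
        case True
        with order_tendstoD(2)[OF \<open>(\<lambda>n. snd (P n)) \<longlonglongrightarrow> snd p\<close>] have "eventually (\<lambda>n. snd (P n) < s) sequentially" by blast
        then show ?thesis by (rule eventually_mono) (use True in simp)
      next
        case False
        with elim have "s < snd p" by simp
        with order_tendstoD(1)[OF \<open>(\<lambda>n. snd (P n)) \<longlonglongrightarrow> snd p\<close>] have "eventually (\<lambda>n. s < snd (P n)) sequentially" by blast
        then show ?thesis by (rule eventually_mono) (use \<open>s < snd p\<close> in simp)
      qed
      then have 1: "(\<lambda>n. indicator {snd (P n)<..} s :: real) \<longlonglongrightarrow> indicator {snd p<..} s"
        by (rule tendsto_eventually)
      have 2: "(\<lambda>n. v (fst (P n), s)) \<longlonglongrightarrow> v (fst p, s)"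
      proof (cases "s \<in> {0<..<T}")
        case True
        have "(\<lambda>n. u (fst (P n), s)) \<longlonglongrightarrow> u (fst p, s)"
        proof (rule continuous_on_tendsto_compose[OF u])
          show "(\<lambda>n. (fst (P n), s)) \<longlonglongrightarrow> (fst p, s)" by (intro tendsto_intros P(2))
        qed (use p P(1) True in \<open>auto simp: mem_Times_iff\<close>)
        then show ?thesis using True p P(1) by (simp add: v_eq mem_Times_iff)
      next
        case False
        then show ?thesis by (simp add: v Omega_def)
      qed
      show ?case by (intro tendsto_mult 1 2 tendsto_const)
    qed
  qed (simp_all add: v_meas)
qed

lemma AE_plane_fst:
  assumes "AE x in lborel. P (x::real)"
  shows "AE p in lborel. P (fst (p :: real \<times> real))"
proof -
  obtain N where N: "N \<in> null_sets lborel" "{x. \<not> P x} \<subseteq> N"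
    using assms by (auto elim!: AE_E simp: null_sets_def)
  have [measurable]: "N \<in> sets borel" using N(1) by (auto simp: null_sets_def)
  have "AE p in lborel. fst (p :: real \<times> real) \<notin> N"
    unfolding lborel_prod[symmetric]
  proof (rule lborel_pair.AE_pair_measure)
    show "{p \<in> space (lborel \<Otimes>\<^sub>M (lborel :: real measure)). fst p \<notin> N} \<in> sets (lborel \<Otimes>\<^sub>M lborel)" by measurable
    show "AE x in lborel. AE y::real in lborel. fst (x, y) \<notin> N"
      using AE_not_in[OF N(1)] by eventually_elim simp
  qed
  then show ?thesis by eventually_elim (use N(2) in auto)
qed

lemma Linf_nonneg_representative:
  fixes k :: "real \<Rightarrow> real"
  assumes "k \<in> Linf {0<..<L}" "AE x in lebesgue_on {0<..<L}. k x > 0"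
  obtains \<kappa> C where "\<kappa> \<in> borel_measurable borel" "\<And>x. 0 \<le> \<kappa> x" "\<And>x. \<kappa> x \<le> C"
    "AE x in lborel. x \<in> {0<..<L} \<longrightarrow> k x = \<kappa> x"
proof -
  have k: "k \<in> borel_measurable (lebesgue_on {0<..<L})" using assms(1) by (simp add: Linf_def)
  obtain C where C: "AE x in lebesgue_on {0<..<L}. \<bar>k x\<bar> \<le> C" using assms(1) by (auto simp: Linf_def)
  have "{0<..<L} \<in> sets borel" by simp
  from borel_representative[OF this k]
  obtain g where g: "g \<in> borel_measurable borel" "AE x in lebesgue_on {0<..<L}. k x = g x"
    by blast
  \<comment> \<open>Clipping turns the almost-everywhere bounds into pointwise ones and changes
    nothing almost everywhere on \<open>(0, L)\<close>.\<close>
  define \<kappa> where "\<kappa> x = max 0 (min \<bar>C\<bar> (g x))" for x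
  have "AE x in lebesgue_on {0<..<L}. k x = \<kappa> x"
    using C g(2) assms(2) by eventually_elim (auto simp: \<kappa>_def)
  then have "AE x in lebesgue. x \<in> {0<..<L} \<longrightarrow> k x = \<kappa> x"
    by (subst (asm) AE_restrict_space_iff) auto
  then have "AE x in lborel. x \<in> {0<..<L} \<longrightarrow> k x = \<kappa> x"
    by (simp add: AE_completion_iff)
  moreover have "\<kappa> \<in> borel_measurable borel" using g(1) unfolding \<kappa>_def by measurable
  ultimately show ?thesis using that[of \<kappa> "\<bar>C\<bar>"] by (auto simp: \<kappa>_def)
qed

text \<open>Once \<open>v\<close> is replaced by the primitive of \<open>f\<close>, this is
  \<open>integral_weight_head\<close> on almost every line.\<close>

lemma integral_weight_weak_t:
  assumes "T > 0" and f: "sqint (Omega L T) f" and v: "sqint (Omega L T) v"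
    and prim: "AE p in lborel. v p = prim L T f p"
  shows "(LINT p|lborel. (T - snd p) * (f p * v p)) = (LINT p|lborel. (v p)\<^sup>2) / 2"
proof -
  note [measurable] = sqint_measurable[OF f] sqint_measurable[OF v]
  let ?pr = "prim L T f"
  have "sqint (Omega L T) (\<lambda>p. (T - snd p) * f p)"
    by (rule sqint_bounded_mult[OF f, where C=T]) (auto simp: Omega_def)
  from sqint_mult_integrable[OF this v] have "integrable lborel (\<lambda>p. (T - snd p) * (f p * v p))"
    by (simp add: mult.assoc)
  moreover have eq1: "AE p in lborel. (T - snd p) * (f p * v p) = (T - snd p) * (f p * ?pr p)"
    using prim by eventually_elim simp
  ultimately have i1: "integrable lborel (\<lambda>p. (T - snd p) * (f p * ?pr p))"
    by (subst (asm) integrable_cong_AE) auto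
  have "integrable lborel (\<lambda>p. (v p)\<^sup>2)" using v by (simp add: sqint_def)
  moreover have eq2: "AE p in lborel. (v p)\<^sup>2 = (?pr p)\<^sup>2"
    using prim by eventually_elim simp
  ultimately have i2: "integrable lborel (\<lambda>p. (?pr p)\<^sup>2)"
    by (subst (asm) integrable_cong_AE) auto
  have sec: "(LINT t|lborel. (T - t) * (f (x, t) * ?pr (x, t))) = (LINT t|lborel. (?pr (x, t))\<^sup>2) / 2"
    if x: "sqint {0<..<T} (\<lambda>t. f (x, t))" for x
  proof (cases "x \<in> {0<..<L}")
    case False
    then have "?pr (x, t) = 0" for t by (auto simp: prim_def Omega_def indicator_def)
    then show ?thesis by simp
  next
    case True
    then have pr: "?pr (x, t) = indicator {0<..<T} t * head (\<lambda>t. f (x, t)) t" for t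
      by (simp add: prim_def Omega_def indicator_def)
    have "(T - t) * (f (x, t) * ?pr (x, t)) = (T - t) * (f (x, t) * head (\<lambda>t. f (x, t)) t)" for t
      using x by (auto simp: pr sqint_def indicator_def)
    moreover have "(?pr (x, t))\<^sup>2 = indicator {0<..<T} t * (head (\<lambda>t. f (x, t)) t)\<^sup>2" for t
      by (simp add: pr indicator_def)
    ultimately show ?thesis
      using integral_weight_head[OF x] by (simp only:)
  qed
  have "(LINT p|lborel. (T - snd p) * (f p * v p)) = (LINT p|lborel. (T - snd p) * (f p * ?pr p))"
    by (rule integral_cong_AE[OF _ _ eq1]) measurable
  also have "\<dots> = (LINT x|lborel. LINT t|lborel. (T - t) * (f (x, t) * ?pr (x, t)))"
    using plane_Fubini(5)[OF i1] by simp
  also have "\<dots> = (LINT x|lborel. (LINT t|lborel. (?pr (x, t))\<^sup>2) / 2)"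
    using sqint_sections(1)[OF f] plane_Fubini(3)[OF i1] plane_Fubini(3)[OF i2]
    by (intro integral_cong_AE) (auto elim!: eventually_mono simp: sec)
  also have "\<dots> = (LINT p|lborel. (?pr p)\<^sup>2) / 2"
    using plane_Fubini(5)[OF i2] by simp
  also have "(LINT p|lborel. (?pr p)\<^sup>2) = (LINT p|lborel. (v p)\<^sup>2)"
    using eq2 by (intro integral_cong_AE) (auto elim!: eventually_mono)
  finally show ?thesis .
qed

text \<open>The coefficient depends on \<open>x\<close> only, so it comes out of the time integral,
  and \<open>integral_mult_tail\<close> writes that integral as half the integral of a square on
  almost every line.\<close>

lemma integral_tail_nonneg:
  assumes "T > 0" and g: "sqint (Omega L T) g" and [measurable]: "\<kappa> \<in> borel_measurable borel"
    and \<kappa>: "\<And>x. 0 \<le> \<kappa> x" "\<And>x. \<kappa> x \<le> C"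
  shows "integrable lborel (\<lambda>p. \<kappa> (fst p) * (g p * tail T g p))"
    and "0 \<le> (LINT p|lborel. \<kappa> (fst p) * (g p * tail T g p))"
proof -
  note [measurable] = sqint_measurable[OF g]
  have "sqint (Omega L T) (\<lambda>p. \<kappa> (fst p) * g p)"
    by (rule sqint_bounded_mult[OF g, where C=C]) (use \<kappa> in auto)
  from integrable_tail_mult[OF g this \<open>T > 0\<close>]
  show i: "integrable lborel (\<lambda>p. \<kappa> (fst p) * (g p * tail T g p))" by (simp add: mult_ac)
  have "(LINT p|lborel. \<kappa> (fst p) * (g p * tail T g p)) = (LINT x|lborel. \<kappa> x * (LINT t|lborel. g (x, t) * tail T g (x, t)))"
    using plane_Fubini(5)[OF i] by simp
  also have "\<dots> \<ge> 0"
  proof (rule integral_nonneg_AE)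
    show "AE x in lborel. 0 \<le> \<kappa> x * (LINT t|lborel. g (x, t) * tail T g (x, t))"
      using sqint_sections(1)[OF g]
    proof eventually_elim
      case (elim x)
      from integral_mult_tail[OF this]
      have "(LINT t|lborel. g (x, t) * tail T g (x, t)) = (LINT s|lborel. indicator {0<..<T} s * (head (\<lambda>t. g (x, t)) s)\<^sup>2) / 2"
        by (simp add: tail_def)
      moreover have "0 \<le> (LINT s|lborel. indicator {0<..<T} s * (head (\<lambda>t. g (x, t)) s)\<^sup>2)"
        by (intro Bochner_Integration.integral_nonneg) simp
      ultimately have "0 \<le> (LINT t|lborel. g (x, t) * tail T g (x, t))" by linarith
      then show ?case by (intro mult_nonneg_nonneg \<kappa>(1))
    qed
  qed
  finally show "0 \<le> (LINT p|lborel. \<kappa> (fst p) * (g p * tail T g p))" .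
qed

section \<open>Operations on admissible functions and on the beam form\<close>

lemma L2_cong: "(\<And>x. x \<in> S \<Longrightarrow> f x = g x) \<Longrightarrow> f \<in> L2 S \<longleftrightarrow> g \<in> L2 S"
proof -
  assume eq: "\<And>x. x \<in> S \<Longrightarrow> f x = g x"
  then have "f \<in> borel_measurable (lebesgue_on S) \<longleftrightarrow> g \<in> borel_measurable (lebesgue_on S)"
    by (intro measurable_cong) simp
  moreover have "integrable (lebesgue_on S) (\<lambda>x. (f x)\<^sup>2) \<longleftrightarrow> integrable (lebesgue_on S) (\<lambda>x. (g x)\<^sup>2)"
    using eq by (intro Bochner_Integration.integrable_cong) auto
  ultimately show ?thesis by (simp add: L2_def)
qed

lemma L2_mult_integrable: "f \<in> L2 S \<Longrightarrow> g \<in> L2 S \<Longrightarrow> integrable (lebesgue_on S) (\<lambda>x. f x * g x)"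
  by (intro square_integrable_mult) (auto simp: L2_def)

lemma H21_hat_L2: "f \<in> H21_hat L T \<Longrightarrow> f \<in> L2 (Omega L T)"
  by (simp add: H21_hat_def H21_def)

lemma continuous_section_L2:
  assumes f: "continuous_on ({0..L} \<times> {0..T}) f" and t: "t \<in> {0..T}"
  shows "(\<lambda>x. f (x, t)) \<in> L2 {0<..<L::real}"
proof -
  let ?g = "\<lambda>x. indicator {0<..<L} x * f (x, t)"
  have c: "continuous_on {0..L} (\<lambda>x. f (x, t))"
    by (rule continuous_on_compose2[OF f]) (use t in \<open>auto intro!: continuous_intros\<close>)
  have "(\<lambda>x. indicator {0<..<L} x *\<^sub>R f (x, t)) \<in> borel_measurable borel"
    by (intro borel_measurable_continuous_on_indicator continuous_on_subset[OF c]) auto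
  then have g: "?g \<in> borel_measurable borel" by simp
  obtain B where B: "\<forall>x\<in>{0..L}. \<bar>f (x, t)\<bar> \<le> B"
    using compact_imp_bounded[OF compact_continuous_image[OF c compact_Icc]] by (auto simp: bounded_real)
  have "integrable lborel (\<lambda>x. (?g x)\<^sup>2)"
  proof (rule Bochner_Integration.integrable_bound)
    show "integrable lborel (\<lambda>x. B\<^sup>2 * indicator {0<..<L} x)" by simp
    have "(?g x)\<^sup>2 \<le> B\<^sup>2 * indicator {0<..<L} x" for x
    proof (cases "x \<in> {0<..<L}")
      case True
      then have "\<bar>f (x, t)\<bar> \<le> \<bar>B\<bar>" using B by (intro order_trans[OF _ abs_ge_self]) auto
      then show ?thesis using True by (simp add: abs_le_square_iff)
    qed simp
    then show "AE x in lborel. norm ((?g x)\<^sup>2) \<le> norm (B\<^sup>2 * indicator {0<..<L} x)" by simp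
  qed (use g in measurable)
  with g have "sqint {0<..<L} ?g" by (simp add: sqint_def)
  then have "?g \<in> L2 {0<..<L}" by (intro sqint_L2) auto
  then show ?thesis by (rule L2_cong[THEN iffD1, rotated]) simp
qed

lemma H21_hat_diff:
  assumes "f \<in> H21_hat L T" "g \<in> H21_hat L T"
  shows "(\<lambda>p. f p - g p) \<in> H21_hat L T"
proof -
  have B: "set [(0, 1) :: real \<times> real] \<subseteq> Basis" "set [(1, 0) :: real \<times> real] \<subseteq> Basis"
    "set [(1, 0), (1, 0) :: real \<times> real] \<subseteq> Basis" by (auto simp: Basis_plane)
  note d = has_weak_deriv_diff[OF _ _ B(1) Omega_sets] has_weak_deriv_diff[OF _ _ B(2) Omega_sets]
    has_weak_deriv_diff[OF _ _ B(3) Omega_sets]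
  show ?thesis
    using assms unfolding H21_hat_def H21_def
    by (auto intro!: L2_diff continuous_on_diff dest: d; blast dest: d)
qed

text \<open>\<open>k\<close> is only Lebesgue measurable on the line, so measurability of
  \<open>k (fst p)\<close> in the plane is deduced from almost-everywhere equality with a Borel
  function and completeness of Lebesgue measure.\<close>

lemma coefficient_representative:
  fixes k :: "real \<Rightarrow> real"
  assumes "k \<in> Linf {0<..<L}" "AE x in lebesgue_on {0<..<L}. k x > 0"
  obtains \<kappa> C where "\<kappa> \<in> borel_measurable borel" "\<And>x. 0 \<le> \<kappa> x" "\<And>x. \<kappa> x \<le> C"
    "AE p in lebesgue_on (Omega L T). k (fst p) = \<kappa> (fst p)"
    "(\<lambda>p. k (fst p)) \<in> borel_measurable (lebesgue_on (Omega L T))"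
proof -
  obtain \<kappa> C where \<kappa>: "\<kappa> \<in> borel_measurable borel" "\<And>x. 0 \<le> \<kappa> x" "\<And>x. \<kappa> x \<le> C"
    "AE x in lborel. x \<in> {0<..<L} \<longrightarrow> k x = \<kappa> x"
    using Linf_nonneg_representative[OF assms] by blast
  note [measurable] = \<kappa>(1)
  have ae: "AE p in lebesgue. fst p \<in> {0<..<L} \<longrightarrow> k (fst p) = \<kappa> (fst (p :: real \<times> real))"
    using AE_completion[OF AE_plane_fst[OF \<kappa>(4)]] .
  then have "AE p in lebesgue. p \<in> Omega L T \<longrightarrow> k (fst p) = \<kappa> (fst p)"
    by eventually_elim (auto simp: Omega_def)
  then have 1: "AE p in lebesgue_on (Omega L T). k (fst p) = \<kappa> (fst p)"
    by (subst AE_restrict_space_iff) auto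
  have "(\<lambda>p. \<kappa> (fst p) * indicator (Omega L T) p) \<in> borel_measurable lebesgue"
    by (intro measurable_completion) measurable
  moreover have "AE p in lebesgue. \<kappa> (fst p) * indicator (Omega L T) p = k (fst p) * indicator (Omega L T) p"
    using ae by eventually_elim (auto simp: indicator_def Omega_def)
  ultimately have "(\<lambda>p. k (fst p) * indicator (Omega L T) p) \<in> borel_measurable lebesgue"
    by (rule borel_measurable_AE)
  then have "(\<lambda>p. k (fst p)) \<in> borel_measurable (lebesgue_on (Omega L T))"
    by (subst borel_measurable_restrict_space_iff) (auto simp: mult.commute)
  with 1 \<kappa> show ?thesis using that by blast
qed

lemma coefficient_mult_integrable:
  fixes k :: "real \<Rightarrow> real"
  assumes k: "k \<in> Linf {0<..<L}" "AE x in lebesgue_on {0<..<L}. k x > 0"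
    and a: "a \<in> L2 (Omega L T)" and b: "b \<in> L2 (Omega L T)"
  shows "integrable (lebesgue_on (Omega L T)) (\<lambda>p. k (fst p) * a p * b p)"
proof -
  obtain \<kappa> C where \<kappa>: "\<kappa> \<in> borel_measurable borel" "\<And>x. 0 \<le> \<kappa> x" "\<And>x. \<kappa> x \<le> C"
    "AE p in lebesgue_on (Omega L T). k (fst p) = \<kappa> (fst p)"
    "(\<lambda>p. k (fst p)) \<in> borel_measurable (lebesgue_on (Omega L T))"
    using coefficient_representative[OF k] by blast
  note [measurable] = \<kappa>(5)
  have [measurable]: "a \<in> borel_measurable (lebesgue_on (Omega L T))" "b \<in> borel_measurable (lebesgue_on (Omega L T))"
    using a b by (auto simp: L2_def)
  show ?thesis
  proof (rule Bochner_Integration.integrable_bound)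
    show "integrable (lebesgue_on (Omega L T)) (\<lambda>p. C * (a p * b p))"
      using L2_mult_integrable[OF a b] by simp
    show "AE p in lebesgue_on (Omega L T). norm (k (fst p) * a p * b p) \<le> norm (C * (a p * b p))"
      using \<kappa>(4)
    proof eventually_elim
      case (elim p)
      have "\<bar>\<kappa> (fst p)\<bar> \<le> \<bar>C\<bar>" using \<kappa>(2,3)[of "fst p"] by linarith
      then show ?case
        unfolding elim real_norm_def abs_mult mult.assoc by (rule mult_right_mono) simp
    qed
  qed measurable
qed

lemma beam_form_diff:
  assumes k: "k \<in> Linf {0<..<L}" "AE x in lebesgue_on {0<..<L}. k x > 0"
    and f: "f \<in> H21_hat L T"
    and a: "beam_form L T k f \<eta> a" and b: "beam_form L T k g \<eta> b"
  shows "beam_form L T k (\<lambda>p. f p - g p) \<eta> (a - b)"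
  unfolding beam_form_def
proof (intro allI impI)
  let ?\<Omega> = "Omega L T"
  fix ht hxx \<eta>t \<eta>xx
  assume h: "weak_t ?\<Omega> (\<lambda>p. f p - g p) ht" "weak_xx ?\<Omega> (\<lambda>p. f p - g p) hxx"
    and \<eta>: "weak_t ?\<Omega> \<eta> \<eta>t" "weak_xx ?\<Omega> \<eta> \<eta>xx"
  obtain ft fxx where f': "weak_t ?\<Omega> f ft" "weak_xx ?\<Omega> f fxx"
    using f by (auto simp: H21_hat_def H21_def)
  have B: "set [(0, 1) :: real \<times> real] \<subseteq> Basis" "set [(1, 0), (1, 0) :: real \<times> real] \<subseteq> Basis"
    by (auto simp: Basis_plane)
  \<comment> \<open>\<open>beam_form\<close> speaks about arbitrary weak derivatives of the
    difference. Subtracting them from chosen derivatives of \<open>f\<close> yields derivatives of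
    \<open>g\<close>, so the three integrands match exactly.\<close>
  have "weak_t ?\<Omega> g (\<lambda>p. ft p - ht p)" "weak_xx ?\<Omega> g (\<lambda>p. fxx p - hxx p)"
    using has_weak_deriv_diff[OF f'(1) h(1) B(1) Omega_sets] has_weak_deriv_diff[OF f'(2) h(2) B(2) Omega_sets]
    by simp_all
  with b \<eta> have b': "b = (LINT (x, t)|lebesgue_on ?\<Omega>. - (ft (x, t) - ht (x, t)) * \<eta>t (x, t) + k x * (fxx (x, t) - hxx (x, t)) * \<eta>xx (x, t))"
    unfolding beam_form_def by blast
  have a': "a = (LINT (x, t)|lebesgue_on ?\<Omega>. - ft (x, t) * \<eta>t (x, t) + k x * fxx (x, t) * \<eta>xx (x, t))"
    using a f' \<eta> unfolding beam_form_def by blast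
  have L2: "ft \<in> L2 ?\<Omega>" "fxx \<in> L2 ?\<Omega>" "ht \<in> L2 ?\<Omega>" "hxx \<in> L2 ?\<Omega>" "\<eta>t \<in> L2 ?\<Omega>" "\<eta>xx \<in> L2 ?\<Omega>"
    using f' h \<eta> by (auto simp: has_weak_deriv_def)
  note i = L2_mult_integrable[OF L2(1) L2(5)] L2_mult_integrable[OF L2(3) L2(5)]
    coefficient_mult_integrable[OF k L2(2) L2(6)] coefficient_mult_integrable[OF k L2(4) L2(6)]
  have "a - b = (LINT p|lebesgue_on ?\<Omega>. (- (ft p * \<eta>t p) + k (fst p) * fxx p * \<eta>xx p)
     - (- (ft p * \<eta>t p) + ht p * \<eta>t p + (k (fst p) * fxx p * \<eta>xx p - k (fst p) * hxx p * \<eta>xx p)))"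
    unfolding a' b' using i by (subst Bochner_Integration.integral_diff) (auto simp: case_prod_beta' algebra_simps)
  also have "\<dots> = (LINT (x, t)|lebesgue_on ?\<Omega>. - ht (x, t) * \<eta>t (x, t) + k x * hxx (x, t) * \<eta>xx (x, t))"
    by (intro Bochner_Integration.integral_cong refl) (simp add: case_prod_beta')
  finally show "(LINT (x, t)|lebesgue_on ?\<Omega>. - ht (x, t) * \<eta>t (x, t) + k x * hxx (x, t) * \<eta>xx (x, t)) = a - b"
    by simp
qed

lemma beam_form_symmetric:
  assumes "f \<in> H21_hat L T" "g \<in> H21_hat L T" "beam_form L T k f g a" "beam_form L T k g f b"
  shows "a = b"
proof -
  obtain ft fxx gt gxx where d: "weak_t (Omega L T) f ft" "weak_xx (Omega L T) f fxx"
    "weak_t (Omega L T) g gt" "weak_xx (Omega L T) g gxx"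
    using assms(1,2) by (auto simp: H21_hat_def H21_def)
  have "a = (LINT (x, t)|lebesgue_on (Omega L T). - ft (x, t) * gt (x, t) + k x * fxx (x, t) * gxx (x, t))"
    using assms(3) d unfolding beam_form_def by blast
  moreover have "b = (LINT (x, t)|lebesgue_on (Omega L T). - gt (x, t) * ft (x, t) + k x * gxx (x, t) * fxx (x, t))"
    using assms(4) d unfolding beam_form_def by blast
  ultimately show ?thesis by (simp add: mult_ac)
qed

text \<open>One pair of derivatives has to serve two functions: \<open>beam_form\<close> refers to
  \<open>u\<close> itself, while the line-by-line arguments need its extension \<open>v\<close> by
  zero.\<close>

lemma H21_hat_representatives:
  assumes u: "u \<in> H21_hat L T" and "L > 0" "T > 0"
  obtains v ut uxx where "\<And>p. v p = indicator (Omega L T) p * u p" "sqint (Omega L T) v"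
    "sqint (Omega L T) ut" "sqint (Omega L T) uxx"
    "weak_t (Omega L T) u ut" "weak_xx (Omega L T) u uxx" "weak_t (Omega L T) v ut"
    "tail T v \<in> H21_hat L T"
    "weak_t (Omega L T) (tail T v) (\<lambda>p. - ((T - snd p) * v p))"
    "weak_xx (Omega L T) (tail T v) (tail T uxx)"
proof -
  let ?\<Omega> = "Omega L T"
  have cont: "continuous_on ({0..L} \<times> {0..T}) u" and bd: "\<And>t. t \<in> {0..T} \<Longrightarrow> u (0, t) = 0 \<and> u (L, t) = 0"
    and uL2: "u \<in> L2 ?\<Omega>" using u by (auto simp: H21_hat_def H21_def)
  define v where v: "v = (\<lambda>p. indicator ?\<Omega> p * u p)"
  have "(\<lambda>q. indicator ?\<Omega> q *\<^sub>R u q) \<in> borel_measurable borel"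
    using cont by (intro borel_measurable_continuous_on_indicator Omega_sets)
      (auto elim!: continuous_on_subset simp: Omega_def)
  then have vm: "v \<in> borel_measurable borel" by (simp add: v)
  have "v \<in> L2 ?\<Omega>" using uL2 by (rule L2_cong[THEN iffD1, rotated]) (simp add: v)
  then have "integrable lborel (\<lambda>p. indicator ?\<Omega> p * (v p)\<^sup>2)" using vm by (simp add: L2_borel_iff)
  moreover have "(\<lambda>p. indicator ?\<Omega> p * (v p)\<^sup>2) = (\<lambda>p. (v p)\<^sup>2)" by (auto simp: v indicator_def)
  ultimately have vs: "sqint ?\<Omega> v" using vm by (simp add: sqint_def v)
  have rep: "\<exists>g'. sqint ?\<Omega> g' \<and> has_weak_deriv ?\<Omega> bs u g' \<and> has_weak_deriv ?\<Omega> bs v g'"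
    if g: "has_weak_deriv ?\<Omega> bs u g" and bs: "set bs \<subseteq> Basis" for bs g
  proof -
    have "g \<in> L2 ?\<Omega>" using g by (simp add: has_weak_deriv_def)
    then obtain g' where g': "sqint ?\<Omega> g'" "AE p in lebesgue_on ?\<Omega>. g p = g' p"
      using L2_representative[OF Omega_sets] by blast
    have m: "g' \<in> borel_measurable (lebesgue_on ?\<Omega>)" "v \<in> borel_measurable (lebesgue_on ?\<Omega>)"
      "u \<in> borel_measurable (lebesgue_on ?\<Omega>)"
      using vm sqint_measurable[OF g'(1)] uL2 by (auto intro: borel_measurable_lebesgue_on_if_borel simp: L2_def)
    have "AE p in lebesgue_on ?\<Omega>. u p = v p" by (rule AE_I2) (simp add: v)
    then show ?thesis
      using has_weak_deriv_cong_AE[OF g _ g'(2) _ m(1) bs] m g'(1) by auto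
  qed
  have B: "set [(0, 1) :: real \<times> real] \<subseteq> Basis" "set [(1, 0) :: real \<times> real] \<subseteq> Basis"
    "set [(1, 0), (1, 0) :: real \<times> real] \<subseteq> Basis" by (auto simp: Basis_plane)
  obtain ut where ut: "sqint ?\<Omega> ut" "weak_t ?\<Omega> u ut" "weak_t ?\<Omega> v ut"
    using u rep[OF _ B(1)] unfolding H21_hat_def H21_def by blast
  obtain ux where ux: "sqint ?\<Omega> ux" "weak_x ?\<Omega> v ux"
    using u rep[OF _ B(2)] unfolding H21_hat_def H21_def by blast
  obtain uxx where uxx: "sqint ?\<Omega> uxx" "weak_xx ?\<Omega> u uxx" "weak_xx ?\<Omega> v uxx"
    using u rep[OF _ B(3)] unfolding H21_hat_def H21_def by blast
  have wt: "weak_t ?\<Omega> (tail T v) (\<lambda>p. - ((T - snd p) * v p))"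
    by (rule tail_weak_t[OF vs \<open>T > 0\<close>])
  have wx: "weak_x ?\<Omega> (tail T v) (tail T ux)"
    using tail_weak_x[of L T 1 v ux, OF _ vs ux(1) \<open>T > 0\<close>] ux(2) by simp
  have wxx: "weak_xx ?\<Omega> (tail T v) (tail T uxx)"
    using tail_weak_x[of L T 2 v uxx, OF _ vs uxx(1) \<open>T > 0\<close>] uxx(3) by (simp add: numeral_2_eq_2)
  have "tail T v \<in> H21_hat L T"
    unfolding H21_hat_def H21_def
  proof (intro CollectI conjI ballI)
    show "tail T v \<in> L2 ?\<Omega>" by (rule tail_L2(1)[OF vs \<open>T > 0\<close>])
    show "continuous_on ({0..L} \<times> {0..T}) (tail T v)"
      by (rule tail_continuous[OF \<open>T > 0\<close> cont _ bd]) (simp_all add: v)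
    show "tail T v (0, t) = 0" "tail T v (L, t) = 0" for t
      by (simp_all add: tail_def v Omega_def)
  qed (use wt wx wxx in blast)+
  then show ?thesis
    using that[of v ut uxx] vs ut uxx wt wxx by (simp add: v)
qed

lemma energy_estimate:
  fixes k :: "real \<Rightarrow> real"
  assumes "L > 0" "T > 0" and k: "k \<in> Linf {0<..<L}" "AE x in lebesgue_on {0<..<L}. k x > 0"
    and u: "u \<in> H21_hat L T" "\<And>x. x \<in> {0<..<L} \<Longrightarrow> u (x, 0) = 0" and d: "d \<in> L2 {0<..<L}"
    and weak: "\<And>\<eta>. \<eta> \<in> H21_hat L T \<Longrightarrow> (\<forall>x\<in>{0<..<L}. \<eta> (x, T) = 0)
      \<Longrightarrow> beam_form L T k u \<eta> (LINT x|lebesgue_on {0<..<L}. d x * \<eta> (x, 0))"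
  shows "(LINT p|lebesgue_on (Omega L T). (u p)\<^sup>2) \<le> 4 * T ^ 3 * (LINT x|lebesgue_on {0<..<L}. (d x)\<^sup>2)"
proof -
  let ?\<Omega> = "Omega L T"
  obtain v ut uxx where v: "\<And>p. v p = indicator ?\<Omega> p * u p" and sq: "sqint ?\<Omega> v" "sqint ?\<Omega> ut" "sqint ?\<Omega> uxx"
    and du: "weak_t ?\<Omega> u ut" "weak_xx ?\<Omega> u uxx" "weak_t ?\<Omega> v ut"
    and tail: "tail T v \<in> H21_hat L T" "weak_t ?\<Omega> (tail T v) (\<lambda>p. - ((T - snd p) * v p))"
      "weak_xx ?\<Omega> (tail T v) (tail T uxx)"
    using H21_hat_representatives[OF u(1) \<open>L > 0\<close> \<open>T > 0\<close>] by blast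
  obtain \<kappa> C where \<kappa>: "\<kappa> \<in> borel_measurable borel" "\<And>x. 0 \<le> \<kappa> x" "\<And>x. \<kappa> x \<le> C"
    "AE p in lebesgue_on ?\<Omega>. k (fst p) = \<kappa> (fst p)"
    "(\<lambda>p. k (fst p)) \<in> borel_measurable (lebesgue_on ?\<Omega>)"
    using coefficient_representative[OF k] by blast
  note [measurable] = \<kappa>(1) sqint_measurable[OF sq(1)] sqint_measurable[OF sq(2)] sqint_measurable[OF sq(3)]
  define c where "c = (LINT x|lebesgue_on {0<..<L}. d x * tail T v (x, 0))"
  define N where "N = (LINT p|lborel. (v p)\<^sup>2)"
  have u0: "u (x, 0) = 0" if "x \<in> {0..L}" for x
    using that u \<open>T > 0\<close> by (cases "x = 0 \<or> x = L") (auto simp: H21_hat_def)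
  have cont: "continuous_on ({0..L} \<times> {0..T}) u" using u(1) by (simp add: H21_hat_def)
  have prim: "AE p in lborel. v p = prim L T ut p"
    by (rule weak_t_eq_prim[OF \<open>L > 0\<close> \<open>T > 0\<close> sq(2,1) du(3) cont _ u0]) (simp_all add: v)
  have "indicator {T<..} s * ((T - s) * v (x, s)) = 0" for s x
    by (auto simp: v Omega_def indicator_def)
  then have "tail T v (x, T) = 0" for x
    by (simp only: tail_def fst_conv snd_conv Bochner_Integration.integral_zero)
  from weak[OF tail(1)] this have "beam_form L T k u (tail T v) c" by (simp add: c_def)
  from this[unfolded beam_form_def, rule_format, OF du(1,2) tail(2,3)]
  have "c = (LINT p|lebesgue_on ?\<Omega>. - ut p * - ((T - snd p) * v p) + k (fst p) * uxx p * tail T uxx p)"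
    by (simp add: case_prod_beta')
  \<comment> \<open>The minus sign of the inertia term meets the minus sign of
    \<open>\<eta>\<^sub>t\<close>, so both terms of the form get the favourable sign.\<close>
  also have "\<dots> = (LINT p|lebesgue_on ?\<Omega>. (T - snd p) * (ut p * v p) + \<kappa> (fst p) * (uxx p * tail T uxx p))"
  proof (rule integral_cong_AE)
    have m: "(\<lambda>p. - ut p * - ((T - snd p) * v p)) \<in> borel_measurable (lebesgue_on ?\<Omega>)"
      "(\<lambda>p. uxx p * tail T uxx p) \<in> borel_measurable (lebesgue_on ?\<Omega>)"
      by (intro borel_measurable_lebesgue_on_if_borel; measurable)+
    have "(\<lambda>p. - ut p * - ((T - snd p) * v p) + k (fst p) * (uxx p * tail T uxx p)) \<in> borel_measurable (lebesgue_on ?\<Omega>)"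
      by (intro borel_measurable_add borel_measurable_times[OF \<kappa>(5)] m)
    then show "(\<lambda>p. - ut p * - ((T - snd p) * v p) + k (fst p) * uxx p * tail T uxx p) \<in> borel_measurable (lebesgue_on ?\<Omega>)"
      by (simp only: mult.assoc)
    show "(\<lambda>p. (T - snd p) * (ut p * v p) + \<kappa> (fst p) * (uxx p * tail T uxx p)) \<in> borel_measurable (lebesgue_on ?\<Omega>)"
      by (intro borel_measurable_lebesgue_on_if_borel) measurable
    show "AE p in lebesgue_on ?\<Omega>. - ut p * - ((T - snd p) * v p) + k (fst p) * uxx p * tail T uxx p
        = (T - snd p) * (ut p * v p) + \<kappa> (fst p) * (uxx p * tail T uxx p)"
      using \<kappa>(4) by eventually_elim (simp add: algebra_simps)
  qed
  also have "\<dots> = (LINT p|lborel. indicator ?\<Omega> p * ((T - snd p) * (ut p * v p) + \<kappa> (fst p) * (uxx p * tail T uxx p)))"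
    by (rule integral_lebesgue_on_borel) measurable
  also have "\<dots> = (LINT p|lborel. (T - snd p) * (ut p * v p) + \<kappa> (fst p) * (uxx p * tail T uxx p))"
  proof (rule Bochner_Integration.integral_cong[OF refl])
    show "indicator ?\<Omega> p * ((T - snd p) * (ut p * v p) + \<kappa> (fst p) * (uxx p * tail T uxx p))
      = (T - snd p) * (ut p * v p) + \<kappa> (fst p) * (uxx p * tail T uxx p)" for p
    proof (cases "p \<in> ?\<Omega>")
      case False
      then have "v p = 0" "uxx p = 0" using sq unfolding sqint_def by blast+
      then show ?thesis by simp
    qed simp
  qed
  also have "\<dots> = (LINT p|lborel. (T - snd p) * (ut p * v p)) + (LINT p|lborel. \<kappa> (fst p) * (uxx p * tail T uxx p))"
  proof (rule Bochner_Integration.integral_add)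
    have "sqint ?\<Omega> (\<lambda>p. (T - snd p) * ut p)"
      by (rule sqint_bounded_mult[OF sq(2), where C=T]) (auto simp: Omega_def)
    from sqint_mult_integrable[OF this sq(1)]
    show "integrable lborel (\<lambda>p. (T - snd p) * (ut p * v p))" by (simp only: mult.assoc)
    show "integrable lborel (\<lambda>p. \<kappa> (fst p) * (uxx p * tail T uxx p))"
      by (rule integral_tail_nonneg(1)[OF \<open>T > 0\<close> sq(3) \<kappa>(1-3)])
  qed
  also have "\<dots> \<ge> N / 2"
    using integral_weight_weak_t[OF \<open>T > 0\<close> sq(2,1) prim] integral_tail_nonneg(2)[OF \<open>T > 0\<close> sq(3) \<kappa>(1-3)]
    by (simp add: N_def)
  finally have low: "N / 2 \<le> c" .
  have \<eta>L2: "(\<lambda>x. tail T v (x, 0)) \<in> L2 {0<..<L}"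
    using tail(1) \<open>T > 0\<close> by (intro continuous_section_L2) (auto simp: H21_hat_def)
  then have \<eta>i: "integrable (lebesgue_on {0<..<L}) (\<lambda>x. (tail T v (x, 0))\<^sup>2)" by (simp add: L2_def)
  have di: "integrable (lebesgue_on {0<..<L}) (\<lambda>x. (d x)\<^sup>2)" using d by (simp add: L2_def)
  have "(LINT x|lebesgue_on {0<..<L}. (tail T v (x, 0))\<^sup>2) = (LINT x|lborel. indicator {0<..<L} x * (tail T v (x, 0))\<^sup>2)"
    by (rule integral_lebesgue_on_borel) measurable
  also have "\<dots> \<le> (LINT x|lborel. (tail T v (x, 0))\<^sup>2)"
    using tail_L2(2)[OF sq(1) \<open>T > 0\<close>, of 0]
    by (intro integral_mono integrable_real_mult_indicator_left) (auto simp: indicator_def)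
  also have "\<dots> \<le> T ^ 3 * N"
    unfolding N_def by (rule tail_L2(3)[OF sq(1) \<open>T > 0\<close>])
  finally have \<eta>N: "(LINT x|lebesgue_on {0<..<L}. (tail T v (x, 0))\<^sup>2) \<le> T ^ 3 * N" .
  have T3: "T ^ 3 > 0" using \<open>T > 0\<close> by simp
  \<comment> \<open>Young's inequality with weight \<open>T ^ 3\<close>: since the trace has square
    norm at most \<open>T ^ 3 * N\<close>, its share is \<open>N / 4\<close>, half of the lower
    bound \<open>N / 2\<close> for \<open>c\<close>. Absorbing it produces the constant
    \<open>4 * T ^ 3\<close>.\<close>
  have "c \<le> (LINT x|lebesgue_on {0<..<L}. T ^ 3 * (d x)\<^sup>2 + (tail T v (x, 0))\<^sup>2 / (4 * T ^ 3))"
    unfolding c_def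
  proof (rule integral_mono)
    show "integrable (lebesgue_on {0<..<L}) (\<lambda>x. d x * tail T v (x, 0))"
      by (rule L2_mult_integrable[OF d \<eta>L2])
    show "integrable (lebesgue_on {0<..<L}) (\<lambda>x. T ^ 3 * (d x)\<^sup>2 + (tail T v (x, 0))\<^sup>2 / (4 * T ^ 3))"
      using di \<eta>i by simp
    show "d x * tail T v (x, 0) \<le> T ^ 3 * (d x)\<^sup>2 + (tail T v (x, 0))\<^sup>2 / (4 * T ^ 3)" for x
    proof -
      have "0 \<le> (2 * T ^ 3 * d x - tail T v (x, 0))\<^sup>2 / (4 * T ^ 3)" using T3 by simp
      also have "\<dots> = T ^ 3 * (d x)\<^sup>2 - d x * tail T v (x, 0) + (tail T v (x, 0))\<^sup>2 / (4 * T ^ 3)"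
        using \<open>T > 0\<close> by (simp add: power2_eq_square field_simps)
      finally show ?thesis by simp
    qed
  qed
  also have "\<dots> = T ^ 3 * (LINT x|lebesgue_on {0<..<L}. (d x)\<^sup>2) + (LINT x|lebesgue_on {0<..<L}. (tail T v (x, 0))\<^sup>2) / (4 * T ^ 3)"
    using di \<eta>i by simp
  also have "\<dots> \<le> T ^ 3 * (LINT x|lebesgue_on {0<..<L}. (d x)\<^sup>2) + N / 4"
    using \<eta>N T3 by (simp add: field_simps)
  finally have "N \<le> 4 * T ^ 3 * (LINT x|lebesgue_on {0<..<L}. (d x)\<^sup>2)" using low by simp
  moreover have "N = (LINT p|lebesgue_on ?\<Omega>. (u p)\<^sup>2)"
  proof -
    have "(LINT p|lebesgue_on ?\<Omega>. (u p)\<^sup>2) = (LINT p|lebesgue_on ?\<Omega>. (v p)\<^sup>2)"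
      by (intro Bochner_Integration.integral_cong refl) (simp add: v)
    also have "\<dots> = (LINT p|lborel. indicator ?\<Omega> p * (v p)\<^sup>2)"
      by (rule integral_lebesgue_on_borel) measurable
    also have "\<dots> = N"
      unfolding N_def by (intro Bochner_Integration.integral_cong refl) (simp add: v indicator_def)
    finally show ?thesis by simp
  qed
  ultimately show ?thesis by simp
qed

subsection \<open>Frechet gradients and the optimality condition\<close>

lemma L2_norm_sq: "(L2_norm S f)\<^sup>2 = (LINT x|lebesgue_on S. (f x)\<^sup>2)"
  by (simp add: L2_norm_def L2_inner_def power2_eq_square)

lemma L2_norm_nonneg: "0 \<le> L2_norm S f"
  by (simp add: L2_norm_def L2_inner_def)

lemma L2_norm_scale: "L2_norm S (\<lambda>x. s * f x) = \<bar>s\<bar> * L2_norm S f"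
  by (rule power2_eq_imp_eq) (simp_all add: L2_norm_sq L2_norm_nonneg power_mult_distrib)

lemma L2_inner_scale: "L2_inner S G (\<lambda>x. s * f x) = s * L2_inner S G f"
  unfolding L2_inner_def by (subst integral_mult_right_zero[symmetric]) (simp add: mult_ac)

text \<open>The conclusion covers all small \<open>t\<close>, so that two gradients can be compared
  at a common \<open>t\<close>. Only positive multiples of \<delta> occur: at a boundary point of
  the admissible set the opposite direction may leave it.\<close>

lemma frechet_gradient_direction:
  assumes G: "is_frechet_gradient S V J v G" and \<delta>: "\<delta> \<in> L2 S" and "\<epsilon> > 0"
    and V: "\<And>s. 0 < s \<Longrightarrow> s \<le> 1 \<Longrightarrow> (\<lambda>x. v x + s * \<delta> x) \<in> V"
  obtains s where "s > 0" "\<And>t. 0 < t \<Longrightarrow> t \<le> s \<Longrightarrow>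
    t \<le> 1 \<and> \<bar>J (\<lambda>x. v x + t * \<delta> x) - J v - t * L2_inner S G \<delta>\<bar> \<le> t * (\<epsilon> * L2_norm S \<delta>)"
proof -
  let ?n = "L2_norm S \<delta>"
  have n: "?n \<ge> 0" by (rule L2_norm_nonneg)
  obtain r where r: "r > 0" "\<And>h. h \<in> L2 S \<Longrightarrow> (\<lambda>x. v x + h x) \<in> V \<Longrightarrow> L2_norm S h < r \<Longrightarrow>
        \<bar>J (\<lambda>x. v x + h x) - J v - L2_inner S G h\<bar> \<le> \<epsilon> * L2_norm S h"
    using G \<open>\<epsilon> > 0\<close> unfolding is_frechet_gradient_def by blast
  \<comment> \<open>The denominator \<open>?n + 1\<close> is positive also for \<open>?n = 0\<close>
    and makes \<open>t * ?n < r\<close> strict.\<close>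
  define s where "s = min 1 (r / (?n + 1))"
  have s: "s > 0" using r(1) n by (simp add: s_def)
  show ?thesis
  proof (rule that[OF s])
    fix t assume t: "0 < t" "t \<le> s"
    then have t1: "t \<le> 1" and "t \<le> r / (?n + 1)" by (simp_all add: s_def)
    then have "t * (?n + 1) \<le> r" using n by (simp add: field_simps)
    then have "t * ?n < r" using t(1) by (simp add: distrib_left)
    then have "\<bar>J (\<lambda>x. v x + t * \<delta> x) - J v - L2_inner S G (\<lambda>x. t * \<delta> x)\<bar> \<le> \<epsilon> * L2_norm S (\<lambda>x. t * \<delta> x)"
      using t t1 V[of t] L2_cmult[OF \<delta>] by (intro r(2)) (simp_all add: L2_norm_scale)
    then show "t \<le> 1 \<and> \<bar>J (\<lambda>x. v x + t * \<delta> x) - J v - t * L2_inner S G \<delta>\<bar> \<le> t * (\<epsilon> * ?n)"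
      using t t1 by (simp add: L2_norm_scale L2_inner_scale mult_ac)
  qed
qed

text \<open>\<open>is_frechet_gradient\<close> tests only increments that stay in \<open>V\<close>,
  so the comparison is made along a segment in \<open>V\<close>; dividing by \<open>t\<close> leaves
  an arbitrarily small error.\<close>

lemma frechet_gradient_unique:
  assumes G: "is_frechet_gradient S V J v G" and H: "is_frechet_gradient S V J v H" and \<delta>: "\<delta> \<in> L2 S"
    and V: "\<And>s. 0 < s \<Longrightarrow> s \<le> 1 \<Longrightarrow> (\<lambda>x. v x + s * \<delta> x) \<in> V"
  shows "L2_inner S G \<delta> = L2_inner S H \<delta>"
proof -
  let ?n = "L2_norm S \<delta>"
  have n: "?n \<ge> 0" by (rule L2_norm_nonneg)
  have "\<bar>L2_inner S G \<delta> - L2_inner S H \<delta>\<bar> \<le> 0 + e" if "e > 0" for e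
  proof -
    define \<epsilon> where "\<epsilon> = e / (2 * (?n + 1))"
    have \<epsilon>: "\<epsilon> > 0" using \<open>e > 0\<close> n by (simp add: \<epsilon>_def)
    obtain s1 where s1: "s1 > 0" "\<And>t. 0 < t \<Longrightarrow> t \<le> s1 \<Longrightarrow>
      t \<le> 1 \<and> \<bar>J (\<lambda>x. v x + t * \<delta> x) - J v - t * L2_inner S G \<delta>\<bar> \<le> t * (\<epsilon> * ?n)"
      using frechet_gradient_direction[OF G \<delta> \<epsilon> V] by blast
    obtain s2 where s2: "s2 > 0" "\<And>t. 0 < t \<Longrightarrow> t \<le> s2 \<Longrightarrow>
      t \<le> 1 \<and> \<bar>J (\<lambda>x. v x + t * \<delta> x) - J v - t * L2_inner S H \<delta>\<bar> \<le> t * (\<epsilon> * ?n)"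
      using frechet_gradient_direction[OF H \<delta> \<epsilon> V] by blast
    define t where "t = min s1 s2"
    have t: "t > 0" "t \<le> s1" "t \<le> s2" using s1(1) s2(1) by (simp_all add: t_def)
    have "\<bar>t * L2_inner S G \<delta> - t * L2_inner S H \<delta>\<bar> \<le> 2 * (t * (\<epsilon> * ?n))"
      using s1(2)[OF t(1,2), THEN conjunct2] s2(2)[OF t(1,3), THEN conjunct2] by linarith
    then have "t * \<bar>L2_inner S G \<delta> - L2_inner S H \<delta>\<bar> \<le> t * (2 * (\<epsilon> * ?n))"
      using t by (simp add: abs_mult right_diff_distrib[symmetric])
    then have "\<bar>L2_inner S G \<delta> - L2_inner S H \<delta>\<bar> \<le> 2 * (\<epsilon> * ?n)"
      using t(1) by (rule mult_left_le_imp_le)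
    also have "\<dots> \<le> e" using \<open>e > 0\<close> n by (simp add: \<epsilon>_def field_simps)
    finally show ?thesis by simp
  qed
  then have "\<bar>L2_inner S G \<delta> - L2_inner S H \<delta>\<bar> \<le> 0" by (rule field_le_epsilon)
  then show ?thesis by simp
qed

text \<open>Minimality makes the difference quotients along the segment nonnegative, and their
  distance from the inner product is arbitrarily small.\<close>

lemma frechet_gradient_minimum:
  assumes G: "is_frechet_gradient S V J v G" and \<delta>: "\<delta> \<in> L2 S"
    and V: "\<And>s. 0 < s \<Longrightarrow> s \<le> 1 \<Longrightarrow> (\<lambda>x. v x + s * \<delta> x) \<in> V"
    and min: "\<And>v'. v' \<in> V \<Longrightarrow> J v \<le> J v'"
  shows "0 \<le> L2_inner S G \<delta>"
proof -
  let ?n = "L2_norm S \<delta>"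
  have n: "?n \<ge> 0" by (rule L2_norm_nonneg)
  have "- L2_inner S G \<delta> \<le> 0 + e" if "e > 0" for e
  proof -
    define \<epsilon> where "\<epsilon> = e / (?n + 1)"
    have \<epsilon>: "\<epsilon> > 0" using \<open>e > 0\<close> n by (simp add: \<epsilon>_def)
    obtain t where t: "t > 0" "t \<le> 1 \<and> \<bar>J (\<lambda>x. v x + t * \<delta> x) - J v - t * L2_inner S G \<delta>\<bar> \<le> t * (\<epsilon> * ?n)"
      using frechet_gradient_direction[OF G \<delta> \<epsilon> V] by (metis order_refl)
    have "J v \<le> J (\<lambda>x. v x + t * \<delta> x)" using t by (intro min V) auto
    then have "t * (- L2_inner S G \<delta>) \<le> t * (\<epsilon> * ?n)"
      unfolding mult_minus_right using t(2)[THEN conjunct2] by linarith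
    then have "- L2_inner S G \<delta> \<le> \<epsilon> * ?n"
      using t(1) by (rule mult_left_le_imp_le)
    also have "\<dots> \<le> e" using \<open>e > 0\<close> n by (simp add: \<epsilon>_def field_simps)
    finally show ?thesis by simp
  qed
  then have "- L2_inner S G \<delta> \<le> 0" by (rule field_le_epsilon)
  then show ?thesis by simp
qed

lemma frechet_gradient_quadratic:
  assumes G: "G \<in> L2 S" and v: "v \<in> L2 S" "V \<subseteq> L2 S"
    and q: "\<And>v'. v' \<in> V \<Longrightarrow> \<bar>J v' - J v - L2_inner S G (\<lambda>x. v' x - v x)\<bar> \<le> K * (L2_norm S (\<lambda>x. v' x - v x))\<^sup>2"
  shows "is_frechet_gradient S V J v G"
  unfolding is_frechet_gradient_def
proof (intro conjI allI impI G)
  fix \<epsilon> :: real assume "\<epsilon> > 0"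
  show "\<exists>r>0. \<forall>\<delta>v\<in>L2 S. (\<lambda>x. v x + \<delta>v x) \<in> V \<longrightarrow> L2_norm S \<delta>v < r \<longrightarrow>
        \<bar>J (\<lambda>x. v x + \<delta>v x) - J v - L2_inner S G \<delta>v\<bar> \<le> \<epsilon> * L2_norm S \<delta>v"
  \<comment> \<open>The radius is chosen so that \<open>K\<close> times the norm stays below
    \<epsilon>; \<open>\<bar>K\<bar> + 1\<close> keeps it positive whatever the sign of
    \<open>K\<close>.\<close>
  proof (intro exI[of _ "\<epsilon> / (\<bar>K\<bar> + 1)"] conjI ballI impI)
    show "0 < \<epsilon> / (\<bar>K\<bar> + 1)" using \<open>\<epsilon> > 0\<close> by simp
    fix h assume h: "(\<lambda>x. v x + h x) \<in> V" "L2_norm S h < \<epsilon> / (\<bar>K\<bar> + 1)"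
    have "(\<bar>K\<bar> + 1) * L2_norm S h < \<epsilon>" using h(2) by (simp add: field_simps)
    moreover have "K * L2_norm S h \<le> (\<bar>K\<bar> + 1) * L2_norm S h"
      by (intro mult_right_mono L2_norm_nonneg) simp
    ultimately have "K * L2_norm S h \<le> \<epsilon>" by simp
    then have "K * L2_norm S h * L2_norm S h \<le> \<epsilon> * L2_norm S h"
      by (intro mult_right_mono L2_norm_nonneg)
    with q[OF h(1)] show "\<bar>J (\<lambda>x. v x + h x) - J v - L2_inner S G h\<bar> \<le> \<epsilon> * L2_norm S h"
      by (simp add: power2_eq_square mult.assoc)
  qed
qed

text \<open>Convexity of the square is applied pointwise under the integral; the defect is
  \<open>s * (1 - s) * (v x - v' x)\<^sup>2\<close>.\<close>

lemma V_ad_convex: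
  assumes v: "v \<in> V_ad L vc" and v': "v' \<in> V_ad L vc" and s: "0 \<le> s" "s \<le> 1"
  shows "(\<lambda>x. v x + s * (v' x - v x)) \<in> V_ad L vc"
proof -
  let ?S = "{0<..<L}"
  let ?w = "\<lambda>x. v x + s * (v' x - v x)"
  have L2: "v \<in> L2 ?S" "v' \<in> L2 ?S" using v v' by (auto simp: V_ad_def)
  have w: "?w \<in> L2 ?S" by (intro L2_add L2_cmult L2_diff L2)
  have i: "integrable (lebesgue_on ?S) (\<lambda>x. (v x)\<^sup>2)" "integrable (lebesgue_on ?S) (\<lambda>x. (v' x)\<^sup>2)"
    "integrable (lebesgue_on ?S) (\<lambda>x. (?w x)\<^sup>2)" using L2 w by (auto simp: L2_def)
  have vc: "0 \<le> vc" using v L2_norm_nonneg[of ?S v] by (simp add: V_ad_def)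
  have n: "(L2_norm ?S v)\<^sup>2 \<le> vc\<^sup>2" "(L2_norm ?S v')\<^sup>2 \<le> vc\<^sup>2"
    using v v' by (auto simp: V_ad_def intro: power_mono L2_norm_nonneg)
  have "(L2_norm ?S ?w)\<^sup>2 \<le> (LINT x|lebesgue_on ?S. (1 - s) * (v x)\<^sup>2 + s * (v' x)\<^sup>2)"
    unfolding L2_norm_sq
  proof (rule integral_mono[OF i(3)])
    show "integrable (lebesgue_on ?S) (\<lambda>x. (1 - s) * (v x)\<^sup>2 + s * (v' x)\<^sup>2)" using i by simp
    show "(?w x)\<^sup>2 \<le> (1 - s) * (v x)\<^sup>2 + s * (v' x)\<^sup>2" for x
    proof -
      have "(1 - s) * (v x)\<^sup>2 + s * (v' x)\<^sup>2 - (?w x)\<^sup>2 = s * (1 - s) * (v x - v' x)\<^sup>2"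
        by (simp add: power2_eq_square algebra_simps)
      also have "\<dots> \<ge> 0" using s by simp
      finally show ?thesis by simp
    qed
  qed
  also have "\<dots> = (1 - s) * (L2_norm ?S v)\<^sup>2 + s * (L2_norm ?S v')\<^sup>2"
    using i by (simp add: L2_norm_sq)
  also have "\<dots> \<le> (1 - s) * vc\<^sup>2 + s * vc\<^sup>2"
    using n s by (intro add_mono mult_left_mono) auto
  finally have "(L2_norm ?S ?w)\<^sup>2 \<le> vc\<^sup>2" by (simp add: algebra_simps)
  then have "L2_norm ?S ?w \<le> vc" using vc by (rule power2_le_imp_le)
  with w show ?thesis by (simp add: V_ad_def)
qed

text \<open>The data \<open>w\<close> and \<open>F\<close> cancel in the difference
  \<open>?h\<close>, and its zero initial value is exactly the admissibility condition for test
  functions of the adjoint problem. The remainder constant is the energy constant plus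
  \<open>\<bar>\<alpha>\<bar>\<close> from the regularisation term.\<close>

lemma cost_expansion:
  fixes k :: "real \<Rightarrow> real"
  assumes "L > 0" "T > 0" and k: "k \<in> Linf {0<..<L}" "AE x in lebesgue_on {0<..<L}. k x > 0"
    and y: "y \<in> L2 (Omega L T)" and vL2: "v \<in> L2 {0<..<L}" "vs \<in> L2 {0<..<L}"
    and sol: "weak_solution L T k w v F (u v)" "weak_solution L T k w vs F (u vs)"
    and adj: "adjoint_weak_solution L T k y (u vs) \<psi>"
  shows "\<bar>cost L T \<alpha> y u v - cost L T \<alpha> y u vs
      - L2_inner {0<..<L} (\<lambda>x. - \<psi> (x, 0) + 2 * \<alpha> * vs x) (\<lambda>x. v x - vs x)\<bar>
    \<le> (4 * T ^ 3 + \<bar>\<alpha>\<bar>) * (L2_norm {0<..<L} (\<lambda>x. v x - vs x))\<^sup>2"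
proof -
  let ?\<Omega> = "Omega L T" and ?S = "{0<..<L}"
  let ?h = "\<lambda>p. u v p - u vs p" and ?d = "\<lambda>x. v x - vs x"
  have uv: "u v \<in> H21_hat L T" "u vs \<in> H21_hat L T" and \<psi>: "\<psi> \<in> H21_hat L T"
    using sol adj by (auto simp: weak_solution_def adjoint_weak_solution_def)
  have h: "?h \<in> H21_hat L T" by (rule H21_hat_diff[OF uv])
  have h0: "?h (x, 0) = 0" if "x \<in> ?S" for x
    using sol that by (auto simp: weak_solution_def)
  have d: "?d \<in> L2 ?S" by (rule L2_diff[OF vL2])
  have sec: "(\<lambda>x. \<eta> (x, 0)) \<in> L2 ?S" if "\<eta> \<in> H21_hat L T" for \<eta>
    using that \<open>T > 0\<close> by (intro continuous_section_L2) (auto simp: H21_hat_def)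
  have weak: "beam_form L T k ?h \<eta> (LINT x|lebesgue_on ?S. ?d x * \<eta> (x, 0))"
    if \<eta>: "\<eta> \<in> H21_hat L T" "\<forall>x\<in>?S. \<eta> (x, T) = 0" for \<eta>
  proof -
    let ?F = "LINT p|lebesgue_on ?\<Omega>. \<eta> p * F p"
    have "beam_form L T k ?h \<eta> ((?F + (LINT x|lebesgue_on ?S. v x * \<eta> (x, 0))) - (?F + (LINT x|lebesgue_on ?S. vs x * \<eta> (x, 0))))"
      using sol \<eta> by (intro beam_form_diff[OF k uv(1)]) (auto simp: weak_solution_def)
    moreover have "(LINT x|lebesgue_on ?S. ?d x * \<eta> (x, 0)) = (LINT x|lebesgue_on ?S. v x * \<eta> (x, 0)) - (LINT x|lebesgue_on ?S. vs x * \<eta> (x, 0))"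
      unfolding left_diff_distrib
      by (intro Bochner_Integration.integral_diff L2_mult_integrable vL2 sec \<eta>(1))
    ultimately show ?thesis by simp
  qed
  have energy: "(LINT p|lebesgue_on ?\<Omega>. (?h p)\<^sup>2) \<le> 4 * T ^ 3 * (LINT x|lebesgue_on ?S. (?d x)\<^sup>2)"
    by (rule energy_estimate[OF \<open>L > 0\<close> \<open>T > 0\<close> k h h0 d weak])
  define c where "c = (LINT x|lebesgue_on ?S. ?d x * \<psi> (x, 0))"
  have c: "c = - 2 * (LINT p|lebesgue_on ?\<Omega>. (u vs p - y p) * ?h p)"
  proof (rule beam_form_symmetric[OF h \<psi>])
    show "beam_form L T k ?h \<psi> c"
      unfolding c_def using \<psi> adj by (intro weak) (auto simp: adjoint_weak_solution_def)
    have A: "\<forall>\<eta>\<in>H21_hat L T. (\<forall>x\<in>?S. \<eta> (x, 0) = 0) \<longrightarrow>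
        beam_form L T k \<psi> \<eta> (- 2 * (LINT p|lebesgue_on ?\<Omega>. (u vs p - y p) * \<eta> p))"
      using adj by (simp add: adjoint_weak_solution_def)
    show "beam_form L T k \<psi> ?h (- 2 * (LINT p|lebesgue_on ?\<Omega>. (u vs p - y p) * ?h p))"
      by (rule bspec[OF A h, THEN mp]) (intro ballI h0)
  qed
  have L2\<Omega>: "?h \<in> L2 ?\<Omega>" "(\<lambda>p. u vs p - y p) \<in> L2 ?\<Omega>"
    using H21_hat_L2[OF h] L2_diff[OF H21_hat_L2[OF uv(2)] y] .
  have i\<Omega>: "integrable (lebesgue_on ?\<Omega>) (\<lambda>p. (u vs p - y p) * ?h p)"
    "integrable (lebesgue_on ?\<Omega>) (\<lambda>p. (?h p)\<^sup>2)" "integrable (lebesgue_on ?\<Omega>) (\<lambda>p. (u vs p - y p)\<^sup>2)"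
    using L2_mult_integrable[OF L2\<Omega>(2,1)] L2\<Omega> by (simp_all add: L2_def)
  have sq: "(a - z)\<^sup>2 = (b - z)\<^sup>2 + 2 * ((b - z) * (a - b)) + (a - b)\<^sup>2" for a b z :: real
    by (simp add: power2_eq_square algebra_simps)
  have "(LINT p|lebesgue_on ?\<Omega>. (u v p - y p)\<^sup>2)
      = (LINT p|lebesgue_on ?\<Omega>. (u vs p - y p)\<^sup>2 + 2 * ((u vs p - y p) * ?h p) + (?h p)\<^sup>2)"
    by (intro Bochner_Integration.integral_cong refl sq)
  also have "\<dots> = (LINT p|lebesgue_on ?\<Omega>. (u vs p - y p)\<^sup>2) + 2 * (LINT p|lebesgue_on ?\<Omega>. (u vs p - y p) * ?h p)
      + (LINT p|lebesgue_on ?\<Omega>. (?h p)\<^sup>2)"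
    using i\<Omega> by simp
  finally have 1: "(LINT p|lebesgue_on ?\<Omega>. (u v p - y p)\<^sup>2)
      = (LINT p|lebesgue_on ?\<Omega>. (u vs p - y p)\<^sup>2) - c + (LINT p|lebesgue_on ?\<Omega>. (?h p)\<^sup>2)"
    using c by simp
  have iS: "integrable (lebesgue_on ?S) (\<lambda>x. vs x * ?d x)"
    "integrable (lebesgue_on ?S) (\<lambda>x. (vs x)\<^sup>2)" "integrable (lebesgue_on ?S) (\<lambda>x. (?d x)\<^sup>2)"
    using L2_mult_integrable[OF vL2(2) d] vL2(2) d by (simp_all add: L2_def)
  have "(LINT x|lebesgue_on ?S. (v x)\<^sup>2) = (LINT x|lebesgue_on ?S. (vs x)\<^sup>2 + 2 * (vs x * ?d x) + (?d x)\<^sup>2)"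
    using sq[of "v _" 0 "vs _"] by (intro Bochner_Integration.integral_cong refl) simp
  also have "\<dots> = (LINT x|lebesgue_on ?S. (vs x)\<^sup>2) + 2 * (LINT x|lebesgue_on ?S. vs x * ?d x) + (LINT x|lebesgue_on ?S. (?d x)\<^sup>2)"
    using iS by simp
  finally have 2: "(LINT x|lebesgue_on ?S. (v x)\<^sup>2)
      = (LINT x|lebesgue_on ?S. (vs x)\<^sup>2) + 2 * (LINT x|lebesgue_on ?S. vs x * ?d x) + (LINT x|lebesgue_on ?S. (?d x)\<^sup>2)" .
  have "L2_inner ?S (\<lambda>x. - \<psi> (x, 0) + 2 * \<alpha> * vs x) ?d = (LINT x|lebesgue_on ?S. 2 * \<alpha> * (vs x * ?d x) - ?d x * \<psi> (x, 0))"
    unfolding L2_inner_def by (intro Bochner_Integration.integral_cong refl) (simp add: algebra_simps)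
  also have "\<dots> = 2 * \<alpha> * (LINT x|lebesgue_on ?S. vs x * ?d x) - c"
    unfolding c_def using iS(1) L2_mult_integrable[OF d sec[OF \<psi>]] by simp
  finally have 3: "L2_inner ?S (\<lambda>x. - \<psi> (x, 0) + 2 * \<alpha> * vs x) ?d = 2 * \<alpha> * (LINT x|lebesgue_on ?S. vs x * ?d x) - c" .
  let ?H = "LINT p|lebesgue_on ?\<Omega>. (?h p)\<^sup>2" and ?D = "LINT x|lebesgue_on ?S. (?d x)\<^sup>2"
  have "cost L T \<alpha> y u v - cost L T \<alpha> y u vs - L2_inner ?S (\<lambda>x. - \<psi> (x, 0) + 2 * \<alpha> * vs x) ?d = ?H + \<alpha> * ?D"
    unfolding cost_def 1 2 3 by (simp add: algebra_simps)
  moreover have "\<bar>?H + \<alpha> * ?D\<bar> \<le> ?H + \<bar>\<alpha>\<bar> * ?D"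
    by (rule order_trans[OF abs_triangle_ineq]) (simp add: abs_mult)
  ultimately show ?thesis
    using energy by (simp add: L2_norm_sq algebra_simps)
qed

text \<open>A gradient is determined at most up to null sets, so the conclusion speaks about every
  gradient \<open>G\<close>; the existence clause keeps it from being vacuous.\<close>

theorem theorem2:
  fixes L T \<alpha> vc :: real
    and k w vs :: "real \<Rightarrow> real"
    and F y \<psi>s :: "real \<times> real \<Rightarrow> real"
    and u :: "(real \<Rightarrow> real) \<Rightarrow> real \<times> real \<Rightarrow> real"
  assumes "L > 0" and "T > 0" and "\<alpha> > 0"
    and "k \<in> Linf {0<..<L}" and "AE x in lebesgue_on {0<..<L}. k x > 0"
    and "w \<in> H2 {0<..<L}" and "F \<in> L2 (Omega L T)" and "y \<in> L2 (Omega L T)"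
    and "\<forall>v\<in>V_ad L vc. weak_solution L T k w v F (u v)"
    and "vs \<in> V_ad L vc"
    and "adjoint_weak_solution L T k y (u vs) \<psi>s"
    and "cost L T \<alpha> y u vs = (INF v\<in>V_ad L vc. cost L T \<alpha> y u v)"
  shows "(\<exists>G. is_frechet_gradient {0<..<L} (V_ad L vc) (cost L T \<alpha> y u) vs G) \<and>
    (\<forall>G. is_frechet_gradient {0<..<L} (V_ad L vc) (cost L T \<alpha> y u) vs G \<longrightarrow>
      (\<forall>v\<in>V_ad L vc.
         L2_inner {0<..<L} G (\<lambda>x. v x - vs x)
           = L2_inner {0<..<L} (\<lambda>x. - \<psi>s (x, 0) + 2 * \<alpha> * vs x) (\<lambda>x. v x - vs x) \<and>
         L2_inner {0<..<L} (\<lambda>x. - \<psi>s (x, 0) + 2 * \<alpha> * vs x) (\<lambda>x. v x - vs x) \<ge> 0))"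
proof -
  let ?S = "{0<..<L}" and ?V = "V_ad L vc" and ?J = "cost L T \<alpha> y u"
  let ?G = "\<lambda>x. - \<psi>s (x, 0) + 2 * \<alpha> * vs x"
  have VL2: "?V \<subseteq> L2 ?S" by (auto simp: V_ad_def)
  have vs: "vs \<in> L2 ?S" using assms(10) VL2 by blast
  have "(\<lambda>x. \<psi>s (x, 0)) \<in> L2 ?S"
    using assms(2,11) by (intro continuous_section_L2) (auto simp: adjoint_weak_solution_def H21_hat_def)
  from L2_add[OF L2_cmult[OF this, of "-1"] L2_cmult[OF vs, of "2 * \<alpha>"]]
  have "?G \<in> L2 ?S" by simp
  then have G: "is_frechet_gradient ?S ?V ?J vs ?G"
  proof (rule frechet_gradient_quadratic[OF _ vs VL2])
    fix v assume v: "v \<in> ?V"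
    show "\<bar>?J v - ?J vs - L2_inner ?S ?G (\<lambda>x. v x - vs x)\<bar>
        \<le> (4 * T ^ 3 + \<bar>\<alpha>\<bar>) * (L2_norm ?S (\<lambda>x. v x - vs x))\<^sup>2"
      by (rule cost_expansion[where k=k and w=w and F=F])
        (use assms v VL2 vs in blast)+
  qed
  have min: "?J vs \<le> ?J v" if "v \<in> ?V" for v
    unfolding assms(12)
  proof (rule cINF_lower[OF _ that])
    \<comment> \<open>An infimum of reals is a lower bound only for a set bounded below;
      \<open>\<alpha> > 0\<close> makes the cost nonnegative.\<close>
    have "0 \<le> ?J v'" for v'
      using assms(3) by (simp add: cost_def)
    then show "bdd_below (?J ` ?V)" by (intro bdd_belowI2[where m=0])
  qed
  have "L2_inner ?S H (\<lambda>x. v x - vs x) = L2_inner ?S ?G (\<lambda>x. v x - vs x) \<and> 0 \<le> L2_inner ?S ?G (\<lambda>x. v x - vs x)"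
    if H: "is_frechet_gradient ?S ?V ?J vs H" and v: "v \<in> ?V" for H v
  proof
    have d: "(\<lambda>x. v x - vs x) \<in> L2 ?S" using v VL2 vs by (intro L2_diff) auto
    have seg: "(\<lambda>x. vs x + s * (v x - vs x)) \<in> ?V" if "0 < s" "s \<le> 1" for s
      using that by (intro V_ad_convex assms(10) v) auto
    show "L2_inner ?S H (\<lambda>x. v x - vs x) = L2_inner ?S ?G (\<lambda>x. v x - vs x)"
      by (rule frechet_gradient_unique[OF H G d seg])
    show "0 \<le> L2_inner ?S ?G (\<lambda>x. v x - vs x)"
      by (rule frechet_gradient_minimum[OF G d seg min])
  qed
  with G show ?thesis by blast
qed

end
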